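(* Let $\mathbf P$ and $\mathbf Q$ be shift-invariant Borel probability measures on $\mathcal A^{\mathbf N}$, where $\mathcal A$ is a finite set. Suppose that $\mathbf P$ is selectively lower decoupled (SLD), that $\mathbf P$ is upper decoupled (UD) with $\tau=0$, that $\mathbf Q$ is upper decoupled (UD) and ergodic, that the pair $(\mathbf P,\mathbf Q)$ is nondegenerate (ND), i.e. $\overline q(-1)<0$, and that $\operatorname{supp}\mathbf Q\subseteq\operatorname{supp}\mathbf P$. Then $$D_-\overline q(0)\ \le\ \liminf_{N\to\infty}Q_N(y,x)\ \le\ \limsup_{N\to\infty}Q_N(y,x)\ \le\ h_{\mathrm c}(\mathbf Q|\mathbf P)$$ for $(\mathbf P\otimes\mathbf Q)$-almost every $(x,y)$. If, moreover, $\mathbf Q$ satisfies UD with $k_n=O(1)$, then $$\lim_{N\to\infty}Q_N(y,x)=h_{\mathrm c}(\mathbf Q|\mathbf P)$$ for $(\mathbf P\otimes\mathbf Q)$-almost every $(x,y)$. Here $Q_N$ is the modified Ziv--Merhav estimator and $h_{\mathrm c}(\mathbf Q|\mathbf P)$ the specific cross entropy.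
   Context: Notation. $\mathcal A$ is a finite set, $\mathbf N=\{1,2,\dots\}$, $\mathcal A^{\mathbf N}$ carries the product ($=$ Borel) $\sigma$-algebra, and $T$ is the left shift. For $x=(x_k)_{k\ge1}$ write $x_i^j=x_ix_{i+1}\cdots x_j$. For $a\in\mathcal A^n$, $[a]=\{x: x_1^n=a\}$ and $\mathbf P[a]=\mathbf P([a])$; for the empty word $\mathbf P[\emptyset]=1$. $\operatorname{supp}\mathbf P_n=\{a\in\mathcal A^n:\mathbf P[a]>0\}$ (for $n=0$, the empty word only) and $\operatorname{supp}\mathbf P=\{x:\mathbf P[x_1^n]>0\text{ for all }n\}$; similarly for $\mathbf Q$. UD: $\mathbf P$ is upper decoupled if there are a nonnegative sequence $(k_n)_{n\ge1}$ with $k_n=o(n)$ and an integer $\tau\ge0$ such that for all $n,m\in\mathbf N$, $a\in\operatorname{supp}\mathbf P_n$, $\xi\in\operatorname{supp}\mathbf P_\tau$, $b\in\operatorname{supp}\mathbf P_m$: $\mathbf P[a\xi b]\le e^{k_n}\mathbf P[a]\mathbf P[b]$. "UD with $\tau=0$" (resp. "with $k_n=O(1)$") means that one can choose $\tau=0$ (resp. a bounded sequence $(k_n)$) in this definition. SLD: $\mathbf P$ is selectively lower decoupled if there are a nonnegative sequence $(k_n)_{n\ge1}$ with $k_n=o(n)$ and an integer $\tau\ge0$ such that for all $n,m\in\mathbf N$, $a\in\operatorname{supp}\mathbf P_n$, $b\in\operatorname{supp}\mathbf P_m$ there exist $0\le\ell\le\tau$ and $\xi\in\operatorname{supp}\mathbf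 P_\ell$ with $\mathbf P[a\xi b]\ge e^{-k_n}\mathbf P[a]\mathbf P[b]$. Cross-entropic pressure: $q_n(\alpha)=\ln\sum_{a\in\operatorname{supp}\mathbf P_n}\mathbf P[a]^{-\alpha}\,\mathbf Q[a]$ and $\overline q(\alpha)=\limsup_{n\to\infty}\frac1n q_n(\alpha)\in[-\infty,\infty]$, a nondecreasing convex function with $\overline q(0)=0$; $D_-\overline q(0)=\lim_{\alpha\uparrow0}\overline q(\alpha)/\alpha$ is its (possibly infinite) left derivative at $0$. Cross entropy: $h_{\mathrm c}(\mathbf Q|\mathbf P)=\lim_{n\to\infty}-\frac1n\sum_{a\in\mathcal A^n}\mathbf Q[a]\ln\mathbf P[a]$ (the limit exists in $[0,\infty]$ when $\mathbf P$ satisfies UD; terms with $\mathbf Q[a]=0$ are $0$). Modified Ziv--Merhav (mZM) parsing of $y_1^N$ with respect to $x_1^N$: the first word is the shortest prefix of $y_1^N$ that does not appear as a contiguous substring of $x_1^N$, or all of $y_1^N$ if no such prefix exists (in which case the procedure terminates). Given that the first $i$ words have lengths summing to $L_i<N$, the next word is the shortest prefix of $y_{L_i+1}^N$ that does not appear as a contiguous substring of $x_1^N$, or all of $y_{L_i+1}^N$ if no such prefix exists (in which case the procedure terminates). The procedure stops once all of $y_1^N$ is parsed. $c_N=c_N(y|x)$ is the number of words, and $Q_N(y,x)=\frac{c_N(y|x)\ln N}{N-c_N(y|x)}$ (understood as $+\infty$ if $c_N=N$). *)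

theory Defs
  imports "HOL-Probability.Probability" "HOL-Library.Landau_Symbols" "HOL-Library.Sublist"
begin

text \<open>
  The finite alphabet is a type of class \<open>finite\<close>. A one-sided sequence
  \<open>x\<^sub>1, x\<^sub>2, \<dots>\<close> is a function \<open>x :: nat \<Rightarrow> 'a\<close> indexed from \<open>0\<close>, so \<open>x k\<close> is \<open>x\<^sub>k\<^sub>+\<^sub>1\<close>;
  finite words are lists.
\<close>

definition seq_algebra :: "(nat \<Rightarrow> 'a::finite) measure" where
  "seq_algebra = PiM UNIV (\<lambda>_. count_space UNIV)"

definition left_shift :: "(nat \<Rightarrow> 'a) \<Rightarrow> nat \<Rightarrow> 'a" where
  "left_shift x = (\<lambda>k. x (Suc k))"

definition shift_invariant :: "(nat \<Rightarrow> 'a::finite) measure \<Rightarrow> bool" where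
  "shift_invariant P \<longleftrightarrow> (\<forall>E\<in>sets P. measure P (left_shift -` E \<inter> space P) = measure P E)"

definition ergodic :: "(nat \<Rightarrow> 'a::finite) measure \<Rightarrow> bool" where
  "ergodic P \<longleftrightarrow> (\<forall>E\<in>sets P. left_shift -` E \<inter> space P = E \<longrightarrow> measure P E = 0 \<or> measure P E = 1)"

definition initial_word :: "nat \<Rightarrow> (nat \<Rightarrow> 'a) \<Rightarrow> 'a list" where
  "initial_word n x = map x [0..<n]"

definition cylinder :: "'a list \<Rightarrow> (nat \<Rightarrow> 'a) set" where
  "cylinder a = {x. initial_word (length a) x = a}"

definition word_prob :: "(nat \<Rightarrow> 'a::finite) measure \<Rightarrow> 'a list \<Rightarrow> real" where
  "word_prob P a = measure P (cylinder a)"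

definition supp_words :: "(nat \<Rightarrow> 'a::finite) measure \<Rightarrow> nat \<Rightarrow> 'a list set" where
  "supp_words P n = {a. length a = n \<and> word_prob P a > 0}"

definition supp :: "(nat \<Rightarrow> 'a::finite) measure \<Rightarrow> (nat \<Rightarrow> 'a) set" where
  "supp P = {x. \<forall>n. word_prob P (initial_word n x) > 0}"


text \<open>The gap \<open>\<tau>\<close> and the sequence \<open>k\<close> (of which only \<open>k n\<close> for \<open>n \<ge> 1\<close> matters) are
  parameters, so that restrictions on either can be imposed.\<close>

definition upper_decoupled_with ::
    "nat \<Rightarrow> (nat \<Rightarrow> real) \<Rightarrow> (nat \<Rightarrow> 'a::finite) measure \<Rightarrow> bool" where
  "upper_decoupled_with \<tau> k P \<longleftrightarrow>
     (\<forall>n\<ge>1. k n \<ge> 0) \<and> k \<in> o(\<lambda>n. real n) \<and>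
     (\<forall>n\<ge>1. \<forall>m\<ge>1. \<forall>a\<in>supp_words P n. \<forall>\<xi>\<in>supp_words P \<tau>. \<forall>b\<in>supp_words P m.
        word_prob P (a @ \<xi> @ b) \<le> exp (k n) * word_prob P a * word_prob P b)"

definition upper_decoupled :: "(nat \<Rightarrow> 'a::finite) measure \<Rightarrow> bool" where
  "upper_decoupled P \<longleftrightarrow> (\<exists>\<tau> k. upper_decoupled_with \<tau> k P)"

definition selectively_lower_decoupled :: "(nat \<Rightarrow> 'a::finite) measure \<Rightarrow> bool" where
  "selectively_lower_decoupled P \<longleftrightarrow>
     (\<exists>(\<tau>::nat) (k :: nat \<Rightarrow> real). (\<forall>n\<ge>1. k n \<ge> 0) \<and> k \<in> o(\<lambda>n. real n) \<and>
        (\<forall>n\<ge>1. \<forall>m\<ge>1. \<forall>a\<in>supp_words P n. \<forall>b\<in>supp_words P m.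
           \<exists>l\<le>\<tau>. \<exists>\<xi>\<in>supp_words P l.
             word_prob P (a @ \<xi> @ b) \<ge> exp (- k n) * word_prob P a * word_prob P b))"


text \<open>The logarithm with the convention \<open>ln 0 = -\<infinity>\<close>; it is only applied to nonnegative
  numbers. The product of \<open>0\<close> and \<open>-\<infinity>\<close> in \<open>ereal\<close> is \<open>0\<close>.\<close>

definition ext_ln :: "real \<Rightarrow> ereal" where
  "ext_ln r = (if r > 0 then ereal (ln r) else - \<infinity>)"

definition pressure_n ::
    "(nat \<Rightarrow> 'a::finite) measure \<Rightarrow> (nat \<Rightarrow> 'a) measure \<Rightarrow> nat \<Rightarrow> real \<Rightarrow> ereal" where
  "pressure_n P Q n \<alpha> =
     ext_ln (\<Sum>a\<in>supp_words P n. word_prob P a powr (- \<alpha>) * word_prob Q a)"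

definition upper_pressure ::
    "(nat \<Rightarrow> 'a::finite) measure \<Rightarrow> (nat \<Rightarrow> 'a) measure \<Rightarrow> real \<Rightarrow> ereal" where
  "upper_pressure P Q \<alpha> = limsup (\<lambda>n. pressure_n P Q n \<alpha> / ereal (real n))"

definition pressure_left_deriv_0 ::
    "(nat \<Rightarrow> 'a::finite) measure \<Rightarrow> (nat \<Rightarrow> 'a) measure \<Rightarrow> ereal" where
  "pressure_left_deriv_0 P Q = Lim (at_left 0) (\<lambda>\<alpha>. upper_pressure P Q \<alpha> / ereal \<alpha>)"

definition nondegenerate ::
    "(nat \<Rightarrow> 'a::finite) measure \<Rightarrow> (nat \<Rightarrow> 'a) measure \<Rightarrow> bool" where
  "nondegenerate P Q \<longleftrightarrow> upper_pressure P Q (-1) < 0"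

definition cross_entropy ::
    "(nat \<Rightarrow> 'a::finite) measure \<Rightarrow> (nat \<Rightarrow> 'a) measure \<Rightarrow> ereal" where
  "cross_entropy Q P =
     lim (\<lambda>n. - (\<Sum>a | length a = n. ereal (word_prob Q a) * ext_ln (word_prob P a))
               / ereal (real n))"


text \<open>\<open>sublist\<close> is the contiguous-substring relation. Since \<open>take k w = w\<close> for
  \<open>k \<ge> length w\<close>, the \<open>LEAST\<close> below is at most \<open>length w\<close>.\<close>

definition mzm_word_length :: "'a list \<Rightarrow> 'a list \<Rightarrow> nat" where
  "mzm_word_length u w =
     (if \<exists>k. \<not> sublist (take k w) u then LEAST k. \<not> sublist (take k w) u else length w)"

lemma mzm_word_length_pos:
  assumes "w \<noteq> []"
  shows "mzm_word_length u w > 0"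
proof (cases "\<exists>k. \<not> sublist (take k w) u")
  case True
  then have "\<not> sublist (take (LEAST k. \<not> sublist (take k w) u) w) u"
    by (rule LeastI_ex)
  then have "(LEAST k. \<not> sublist (take k w) u) \<noteq> 0"
    by (intro notI) simp
  with True show ?thesis
    by (simp add: mzm_word_length_def)
next
  case False
  with assms show ?thesis
    by (simp add: mzm_word_length_def)
qed

function mzm_parsing :: "'a list \<Rightarrow> 'a list \<Rightarrow> 'a list list" where
  "mzm_parsing u w =
     (if w = [] then []
      else take (mzm_word_length u w) w # mzm_parsing u (drop (mzm_word_length u w) w))"
  by pat_completeness auto
termination
  by (relation "Wellfounded.measure (\<lambda>(u, w). length w)") (auto simp: mzm_word_length_pos)

declare mzm_parsing.simps [simp del]

definition mzm_count :: "nat \<Rightarrow> (nat \<Rightarrow> 'a) \<Rightarrow> (nat \<Rightarrow> 'a) \<Rightarrow> nat" where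
  "mzm_count N y x = length (mzm_parsing (initial_word N x) (initial_word N y))"

definition mzm_estimator :: "nat \<Rightarrow> (nat \<Rightarrow> 'a) \<Rightarrow> (nat \<Rightarrow> 'a) \<Rightarrow> ereal" where
  "mzm_estimator N y x =
     (if mzm_count N y x = N then \<infinity>
      else ereal (real (mzm_count N y x) * ln (real N) / (real N - real (mzm_count N y x))))"

end

theory Submission
  imports Defs "HOL-Real_Asymp.Real_Asymp"
begin

text \<open>
  Upper bound: by nondegeneracy all parsed words have length \<open>O(ln N)\<close>, and by selective lower
  decoupling every such word of probability at least \<open>N powr (\<epsilon> - 1)\<close> occurs in \<open>x\<^sub>1\<dots>x\<^sub>N\<close>. The
  parsed words are new, so each has smaller probability, and upper decoupling of \<open>P\<close> turns
  \<open>- ln P[y\<^sub>1\<dots>y\<^sub>N] \<le> (h + \<epsilon>) N\<close> into a bound on their number.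

  Lower bound: up to a bounded tail every parsed word occurs in \<open>x\<^sub>1\<dots>x\<^sub>N\<close>. For fixed \<open>x\<close>, upper
  decoupling of \<open>Q\<close> bounds the probability that \<open>y\<^sub>1\<dots>y\<^sub>N\<close> is a concatenation of \<open>c\<close> such words by
  \<open>exp (\<sigma> N)\<close> times the \<open>c\<close>-th power of a weighted \<open>Q\<close>-measure of the words occurring in
  \<open>x\<^sub>1\<dots>x\<^sub>N\<close>. That weight is at most \<open>N powr (s + \<delta>)\<close> for \<open>\<sigma>\<close> slightly above the pressure at \<open>- s\<close>,
  so few words are exponentially unlikely. If \<open>Q\<close> is decoupled with bounded errors, the entropy
  asymptotics along blocks show that the left derivative of the pressure is at least the cross
  entropy.
\<close>

subsection \<open>Word probabilities of a stationary process\<close>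

text \<open>Decoupling is used in the form of an error \<open>\<epsilon> * length + C\<close>. Along
  a concatenation the linear parts add up to at most \<epsilon> N, and a constant per parsed word is
  negligible against the ln N that each parsed word carries. For this reason a gap is harmless for
  Q: it leaves boundedly many fillings per word. P must be decoupled without gap, since a new word
  stripped of some letters need not be new.

  In the lower bound the words depend on both sequences. With x frozen, the parsing of y is
  injective, because \<open>concat\<close> inverts it, so the probability becomes a sum over lists
  of words. The weight exponential in the length encodes that these lengths add up to N. The
  exponent s balances how likely a word is to occur in x against how likely it is in y.

  The two halves of the entropy asymptotics come from one ergodic lemma, which only bounds from
  below: it is applied to \<open>ln p\<close> for one half and to a sum over windows for the
  other.\<close>

abbreviation words :: "nat \<Rightarrow> 'a list set" where
  "words n \<equiv> {a. length a = n}"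

abbreviation (input) shift_by :: "nat \<Rightarrow> (nat \<Rightarrow> 'a) \<Rightarrow> nat \<Rightarrow> 'a" where
  "shift_by i x \<equiv> (\<lambda>k. x (k + i))"

lemma finite_words [simp]: "finite (words n :: 'a::finite list set)"
  using finite_lists_length_eq[of "UNIV :: 'a set" n] by simp

lemma length_initial_word [simp]: "length (initial_word n x) = n"
  by (simp add: initial_word_def)

lemma initial_word_add: "initial_word (i + m) x = initial_word i x @ initial_word m (shift_by i x)"
  by (auto simp: initial_word_def list_eq_iff_nth_eq nth_append)

lemma take_initial_word: "take n (initial_word (n + m) x) = initial_word n x"
  by (simp add: initial_word_add)

lemma drop_initial_word: "drop n (initial_word (n + m) x) = initial_word m (shift_by n x)"
  by (simp add: initial_word_add)

lemma take_initial_word_le: "n \<le> m \<Longrightarrow> take n (initial_word m x) = initial_word n x"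
  using take_initial_word[of n "m - n"] by simp

lemma sum_words_add:
  fixes f :: "'a::finite list \<Rightarrow> 'b::comm_monoid_add"
  shows "(\<Sum>c\<in>words (n + m). f c) = (\<Sum>a\<in>words n. \<Sum>b\<in>words m. f (a @ b))"
proof -
  have "(\<Sum>a\<in>words n. \<Sum>b\<in>words m. f (a @ b)) = (\<Sum>(a,b)\<in>words n \<times> words m. f (a @ b))"
    by (simp add: sum.cartesian_product)
  also have "\<dots> = (\<Sum>c\<in>words (n + m). f c)"
    by (rule sum.reindex_bij_witness[of _ "\<lambda>c. (take n c, drop n c)" "\<lambda>(a,b). a @ b"]) auto
  finally show ?thesis ..
qed

locale stationary_process = prob_space M for M :: "(nat \<Rightarrow> 'a::finite) measure" +
  assumes sets_M: "sets M = sets seq_algebra" and shift_inv: "shift_invariant M"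
begin

abbreviation p :: "'a list \<Rightarrow> real" where "p \<equiv> word_prob M"

lemma space_M [simp]: "space M = UNIV"
  using sets_eq_imp_space_eq[OF sets_M] by (simp add: seq_algebra_def space_PiM)

lemma measurable_coord: "(\<lambda>x. x k) \<in> M \<rightarrow>\<^sub>M count_space UNIV"
  using measurable_component_singleton[of k UNIV "\<lambda>_. count_space UNIV :: 'a measure"]
  by (subst measurable_cong_sets[OF sets_M refl]) (simp add: seq_algebra_def)

lemma measurable_initial_word [measurable]: "initial_word n \<in> M \<rightarrow>\<^sub>M count_space UNIV"
proof (induction n)
  case 0
  show ?case by (simp add: initial_word_def[abs_def])
next
  case (Suc n)
  have "(\<lambda>x. initial_word n x @ [x n]) \<in> M \<rightarrow>\<^sub>M count_space UNIV"
    by (rule measurable_compose_countable[OF _ Suc])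
       (rule measurable_compose[OF measurable_coord], simp)
  then show ?case by (simp add: initial_word_def[abs_def])
qed

lemma measurable_left_shift [measurable]: "left_shift \<in> M \<rightarrow>\<^sub>M M"
proof -
  have "left_shift \<in> M \<rightarrow>\<^sub>M PiM UNIV (\<lambda>_. count_space UNIV :: 'a measure)"
    unfolding left_shift_def[abs_def]
    by (rule measurable_PiM_single') (auto intro: measurable_coord simp: space_PiM)
  then show ?thesis
    by (subst measurable_cong_sets[OF refl sets_M]) (simp add: seq_algebra_def)
qed

lemma distr_left_shift: "distr M M left_shift = M"
proof (rule measure_eqI)
  fix E assume "E \<in> sets (distr M M left_shift)"
  then have E: "E \<in> sets M" by simp
  have "measure M (left_shift -` E \<inter> space M) = measure M E"
    using shift_inv E by (auto simp: shift_invariant_def)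
  then show "emeasure (distr M M left_shift) E = emeasure M E"
    using E by (simp add: emeasure_distr emeasure_eq_measure)
qed simp

lemma measurable_shift_by [measurable]: "shift_by i \<in> M \<rightarrow>\<^sub>M M"
  and distr_shift_by: "distr M M (shift_by i) = M"
proof (induction i)
  case 0
  { case 1 show ?case by simp }
  { case 2 show ?case by (simp add: distr_id2) }
next
  case (Suc i)
  have eq: "shift_by (Suc i) = left_shift \<circ> (shift_by i :: (nat \<Rightarrow> 'a) \<Rightarrow> _)"
    by (auto simp: left_shift_def)
  { case 1 show ?case unfolding eq by (rule measurable_comp[OF Suc(1) measurable_left_shift]) }
  { case 2 show ?case unfolding eq
      using distr_distr[OF measurable_left_shift Suc(1)] Suc(2) distr_left_shift by simp }
qed

lemma sets_initial_word [measurable]: "{x. R (initial_word n x)} \<in> sets M"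
proof -
  have "initial_word n -` {a. R a} \<inter> space M \<in> sets M"
    by (rule measurable_sets[OF measurable_initial_word]) simp
  then show ?thesis by (simp add: vimage_def)
qed

lemma sets_cylinder [measurable]: "cylinder a \<in> sets M"
  unfolding cylinder_def by (rule sets_initial_word)

lemma p_nonneg [simp]: "0 \<le> p a" and p_le_1 [simp]: "p a \<le> 1"
  by (simp_all add: word_prob_def)

lemma p_Nil [simp]: "p [] = 1"
  using prob_space by (simp add: word_prob_def cylinder_def initial_word_def)

lemma integrable_initial_word [simp]: "integrable M (\<lambda>x. g (initial_word n x) :: real)"
proof (rule integrable_const_bound)
  show "AE x in M. norm (g (initial_word n x)) \<le> Max ((\<lambda>a. \<bar>g a\<bar>) ` words n)"
    by (intro AE_I2) (auto intro!: Max_ge)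
qed measurable

lemma expectation_initial_word:
  "expectation (\<lambda>x. g (initial_word n x) :: real) = (\<Sum>a\<in>words n. p a * g a)"
proof -
  have "g (initial_word n x) = (\<Sum>a\<in>words n. indicator (cylinder a) x * g a)" for x
  proof -
    have "(\<Sum>a\<in>words n. indicator (cylinder a) x * g a)
        = (\<Sum>a\<in>words n. if a = initial_word n x then g a else 0)"
      by (rule sum.cong) (auto simp: cylinder_def indicator_def)
    then show ?thesis by simp
  qed
  then have "expectation (\<lambda>x. g (initial_word n x))
      = expectation (\<lambda>x. \<Sum>a\<in>words n. indicator (cylinder a) x * g a)" by simp
  also have "\<dots> = (\<Sum>a\<in>words n. expectation (\<lambda>x. indicator (cylinder a) x * g a))"
    by (rule Bochner_Integration.integral_sum)
       (auto intro!: integrable_mult_left integrable_real_indicator simp: less_top[symmetric])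
  also have "\<dots> = (\<Sum>a\<in>words n. p a * g a)"
    by (simp add: word_prob_def)
  finally show ?thesis .
qed

lemma expectation_shift:
  "expectation (\<lambda>x. g (initial_word n (shift_by i x)) :: real) = expectation (\<lambda>x. g (initial_word n x))"
  using integral_distr[OF measurable_shift_by, of "\<lambda>x. g (initial_word n x)" i] distr_shift_by[of i]
  by (simp add: borel_measurable_integrable)

lemma prob_initial_word:
  "prob {x. R (initial_word n x)} = (\<Sum>a | length a = n \<and> R a. p a)"
proof -
  have "(\<lambda>x. of_bool (R (initial_word n x))) = (indicator {x. R (initial_word n x)} :: _ \<Rightarrow> real)"
    by (auto simp: fun_eq_iff)
  then have "prob {x. R (initial_word n x)} = expectation (\<lambda>x. of_bool (R (initial_word n x)))"
    by simp
  also have "\<dots> = (\<Sum>a | length a = n \<and> R a. p a)"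
    unfolding expectation_initial_word[of "\<lambda>a. of_bool (R a)"]
    by (rule sum.mono_neutral_cong_right) auto
  finally show ?thesis .
qed

text \<open>Stationarity in the form needed for sums over words: every window of length
  \<open>m\<close> inside a word of length \<open>n\<close> has the law of the first
  \<open>m\<close> letters.\<close>

lemma sum_factor:
  assumes "i + m \<le> n"
  shows "(\<Sum>a\<in>words n. p a * g (take m (drop i a))) = (\<Sum>b\<in>words m. p b * (g b :: real))"
proof -
  have "take m (drop i (initial_word n x)) = initial_word m (shift_by i x)" for x :: "nat \<Rightarrow> 'a"
  proof -
    have "drop i (initial_word n x) = initial_word (n - i) (shift_by i x)"
      using assms drop_initial_word[of i "n - i" x] by simp
    moreover have "m \<le> n - i" using assms by simp
    ultimately show ?thesis using take_initial_word_le[of m "n - i" "shift_by i x"] by simp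
  qed
  then show ?thesis
    using expectation_initial_word[of "\<lambda>a. g (take m (drop i a))" n]
      expectation_shift[of g m i] expectation_initial_word[of g m] by simp
qed

lemma sum_p [simp]: "(\<Sum>a\<in>words n. p a) = 1"
  using expectation_initial_word[of "\<lambda>_. 1" n] prob_space by simp

text \<open>Summing out letters on the left, unlike on the right, needs stationarity; it allows a
  past to be attached to a prescribed future.\<close>

lemma sum_p_append_left: "(\<Sum>a\<in>words n. p (a @ b)) = p b"
proof -
  have "(\<Sum>c\<in>words (n + length b). p c * of_bool (take (length b) (drop n c) = b))
      = (\<Sum>a\<in>words n. \<Sum>d\<in>words (length b). if d = b then p (a @ d) else 0)"
    unfolding sum_words_add by (intro sum.cong) auto
  also have "\<dots> = (\<Sum>a\<in>words n. p (a @ b))" by simp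
  moreover have "(\<Sum>c\<in>words (n + length b). p c * of_bool (take (length b) (drop n c) = b))
      = (\<Sum>d\<in>words (length b). p d * of_bool (d = b))"
    by (rule sum_factor) simp
  moreover have "\<dots> = (\<Sum>d\<in>words (length b). if d = b then p d else 0)"
    by (intro sum.cong) auto
  ultimately show ?thesis by simp
qed

lemma p_append_le2: "p (a @ b) \<le> p b"
  using member_le_sum[of a "words (length a)" "\<lambda>a. p (a @ b)"] by (simp add: sum_p_append_left)

lemma p_append_le1: "p (a @ b) \<le> p a"
proof -
  have "cylinder (a @ b) \<subseteq> cylinder a"
    by (auto simp: cylinder_def initial_word_add)
  then show ?thesis unfolding word_prob_def by (intro finite_measure_mono) auto
qed

lemma p_drop_le: "p a \<le> p (drop i a)"
  using p_append_le2[of "take i a" "drop i a"] by simp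

lemma AE_p_pos: "AE x in M. \<forall>n i. p (initial_word n (shift_by i x)) > 0"
proof -
  have "AE x in M. p (initial_word n x) > 0" for n
  proof (rule AE_I[where N = "{x. p (initial_word n x) = 0}"])
    have "prob {x. p (initial_word n x) = 0} = 0"
      unfolding prob_initial_word[of "\<lambda>a. p a = 0"] by simp
    then show "emeasure M {x. p (initial_word n x) = 0} = 0"
      by (simp add: emeasure_eq_measure)
    show "{x. p (initial_word n x) = 0} \<in> sets M"
      by (rule sets_initial_word[of "\<lambda>a. p a = 0"])
  qed (auto simp: less_le)
  then have "AE x in M. \<forall>n. p (initial_word n x) > 0" by (simp add: AE_all_countable)
  then show ?thesis
  proof (rule AE_mp, intro AE_I2 impI allI)
    fix x n i assume *: "\<forall>n. 0 < p (initial_word n x)"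
    have "0 < p (initial_word (i + n) x)" using * by blast
    also have "\<dots> \<le> p (initial_word n (shift_by i x))"
      unfolding initial_word_add by (rule p_append_le2)
    finally show "p (initial_word n (shift_by i x)) > 0" .
  qed
qed

text \<open>Union bound over the start positions. Positions below \<open>N\<close> suffice: a
  nonempty word starts there, and the empty word is found at 0, which needs
  \<open>N \<ge> 1\<close>.\<close>

lemma prob_sublist_le:
  assumes "N \<ge> 1"
  shows "prob {x. sublist a (initial_word N x)} \<le> real N * p a"
proof -
  have sub: "\<exists>i<N. initial_word (length a) (shift_by i x) = a"
    if sub: "sublist a (initial_word N x)" for x
  proof -
    obtain ps ss where eq: "initial_word N x = ps @ a @ ss" using sub by (auto simp: sublist_def)
    then have len: "N = length ps + (length a + length ss)"
      by (metis length_append length_initial_word)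
    have "initial_word (length a) (shift_by (length ps) x) = a"
      using eq unfolding len initial_word_add[of "length ps"] initial_word_add[of "length a"]
      by (metis append_eq_append_conv length_initial_word)
    moreover have "\<exists>i<N. initial_word (length a) (shift_by i x) = a" if "a = []"
      using that assms by (intro exI[of _ 0]) (auto simp: initial_word_def)
    moreover have "length ps < N" if "a \<noteq> []" using that len by auto
    ultimately show ?thesis by blast
  qed
  have m: "{x. initial_word (length a) (shift_by i x) = a} \<in> sets M"
    and pr: "prob {x. initial_word (length a) (shift_by i x) = a} = p a" for i
  proof -
    have eq: "{x. initial_word (length a) (shift_by i x) = a} = shift_by i -` cylinder a \<inter> space M"
      by (auto simp: cylinder_def)
    show "{x. initial_word (length a) (shift_by i x) = a} \<in> sets M"
      unfolding eq by measurable
    show "prob {x. initial_word (length a) (shift_by i x) = a} = p a"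
      unfolding eq word_prob_def using measure_distr[OF measurable_shift_by sets_cylinder, of i a]
      by (simp add: distr_shift_by)
  qed
  have "prob {x. sublist a (initial_word N x)}
      \<le> prob (\<Union>i<N. {x. initial_word (length a) (shift_by i x) = a})"
    using m sub by (intro finite_measure_mono) auto
  also have "\<dots> \<le> (\<Sum>i<N. prob {x. initial_word (length a) (shift_by i x) = a})"
    using m by (intro finite_measure_subadditive_finite) auto
  also have "\<dots> = real N * p a" by (simp add: pr)
  finally show ?thesis .
qed

end

subsection \<open>Decoupling and the subadditive ergodic theorem\<close>

text \<open>Trades o(n) for an error that is additive over the pieces of a word, up to one constant
  per piece. The finitely many early values, including the unconstrained one at 0, go into the
  constant.\<close>

lemma smallo_linear_bound:
  fixes k :: "nat \<Rightarrow> real"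
  assumes "k \<in> o(\<lambda>n. real n)" "\<epsilon> > 0"
  shows "\<exists>C\<ge>0. \<forall>n. k n \<le> \<epsilon> * real n + C"
proof -
  have "eventually (\<lambda>n. norm (k n) \<le> \<epsilon> * norm (real n)) sequentially"
    using landau_o.smallD[OF assms] .
  then obtain n0 where n0: "\<And>n. n \<ge> n0 \<Longrightarrow> \<bar>k n\<bar> \<le> \<epsilon> * real n"
    by (auto simp: eventually_sequentially)
  let ?C = "\<Sum>n<n0. \<bar>k n\<bar>"
  have "k n \<le> \<epsilon> * real n + ?C" for n
  proof (cases "n < n0")
    case True
    then have "\<bar>k n\<bar> \<le> ?C" by (intro member_le_sum) auto
    moreover have "0 \<le> \<epsilon> * real n" using assms by simp
    ultimately show ?thesis by linarith
  next
    case False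
    moreover have "0 \<le> ?C" by (intro sum_nonneg) auto
    ultimately show ?thesis using n0[of n] by linarith
  qed
  then show ?thesis by (intro exI[of _ ?C]) (auto intro: sum_nonneg)
qed

context stationary_process
begin

text \<open>The definition speaks only of nonempty words in the supports. A positive left side
  forces all three factors into their supports; for empty \<open>a\<close> or \<open>b\<close>
  monotonicity gives the factor 1, which is at most \<open>exp (h (length a))\<close> since
  \<open>h\<close> is nonnegative.\<close>

lemma upper_decoupled_bound:
  assumes ud: "upper_decoupled_with \<tau> k M" and h: "\<And>n. k n \<le> h n" "\<And>n. 0 \<le> h n"
    and \<xi>: "length \<xi> = \<tau>"
  shows "p (a @ \<xi> @ b) \<le> exp (h (length a)) * p a * p b"
proof (cases "p (a @ \<xi> @ b) = 0 \<or> a = [] \<or> b = []")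
  case True
  have e: "1 \<le> exp (h (length a))" using h by simp
  have "p (a @ \<xi> @ b) \<le> p a * p b"
    using True p_append_le2[of \<xi> b] p_append_le1[of a \<xi>] by auto
  also have "\<dots> \<le> exp (h (length a)) * (p a * p b)"
    using mult_right_mono[OF e, of "p a * p b"] by simp
  finally show ?thesis by (simp add: mult.assoc)
next
  case False
  then have pos: "p (a @ \<xi> @ b) > 0" and len: "length a \<ge> 1" "length b \<ge> 1"
    by (auto simp: less_le Suc_le_eq)
  have "p a > 0" "p \<xi> > 0" "p b > 0"
    using pos p_append_le1[of a "\<xi> @ b"] p_append_le2[of a "\<xi> @ b"] p_append_le1[of \<xi> b]
      p_append_le2[of \<xi> b] by linarith+
  then have "p (a @ \<xi> @ b) \<le> exp (k (length a)) * p a * p b"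
    using ud len \<xi> by (auto simp: upper_decoupled_with_def supp_words_def)
  also have "\<dots> \<le> exp (h (length a)) * p a * p b"
    using h by (intro mult_right_mono) auto
  finally show ?thesis .
qed

lemma upper_decoupled_linear:
  assumes "upper_decoupled_with \<tau> k M" "\<epsilon> > 0"
  shows "\<exists>C\<ge>0. \<forall>a \<xi> b. length \<xi> = \<tau> \<longrightarrow>
           p (a @ \<xi> @ b) \<le> exp (\<epsilon> * real (length a) + C) * p a * p b"
proof -
  have "k \<in> o(\<lambda>n. real n)" using assms by (simp add: upper_decoupled_with_def)
  from smallo_linear_bound[OF this assms(2)] obtain C where
    C: "C \<ge> 0" "\<And>n. k n \<le> \<epsilon> * real n + C" by auto
  then show ?thesis
    using upper_decoupled_bound[OF assms(1), of "\<lambda>n. \<epsilon> * real n + C"] assms(2)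
    by (intro exI[of _ C]) auto
qed

lemma upper_decoupled_bounded:
  assumes "upper_decoupled_with \<tau> k M" "k \<in> O(\<lambda>_. 1)"
  shows "\<exists>C\<ge>0. \<forall>a \<xi> b. length \<xi> = \<tau> \<longrightarrow> p (a @ \<xi> @ b) \<le> exp C * p a * p b"
proof -
  have "Bseq k"
  proof -
    from assms(2) obtain c where "eventually (\<lambda>n. norm (k n) \<le> c) sequentially"
      by (auto elim: landau_o.bigE)
    then show ?thesis by (auto intro: Bfun_metric_def BfunI)
  qed
  then obtain C where C: "C > 0" "\<And>n. \<bar>k n\<bar> \<le> C" by (auto elim: BseqE)
  have "k n \<le> C" for n using C(2)[of n] by linarith
  then show ?thesis
    using upper_decoupled_bound[OF assms(1), of "\<lambda>_. C"] C(1) by (intro exI[of _ C]) auto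
qed

lemma selectively_lower_decoupled_linear:
  assumes "selectively_lower_decoupled M"
  shows "\<exists>\<tau>. \<forall>\<epsilon>>0. \<exists>C\<ge>0. \<forall>a b. a \<noteq> [] \<longrightarrow> b \<noteq> [] \<longrightarrow> p a > 0 \<longrightarrow> p b > 0 \<longrightarrow>
      (\<exists>\<xi>. length \<xi> \<le> \<tau> \<and> p (a @ \<xi> @ b) \<ge> exp (- (\<epsilon> * real (length a) + C)) * p a * p b)"
proof -
  from assms obtain \<tau> k where k: "k \<in> o(\<lambda>n. real n)" and
    sld: "\<And>n m a b. n \<ge> 1 \<Longrightarrow> m \<ge> 1 \<Longrightarrow> a \<in> supp_words M n \<Longrightarrow> b \<in> supp_words M m \<Longrightarrow>
       \<exists>l\<le>\<tau>. \<exists>\<xi>\<in>supp_words M l. p (a @ \<xi> @ b) \<ge> exp (- k n) * p a * p b"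
    unfolding selectively_lower_decoupled_def by blast
  show ?thesis
  proof (intro exI[of _ \<tau>] allI impI)
    fix \<epsilon> :: real assume "\<epsilon> > 0"
    from smallo_linear_bound[OF k this] obtain C where
      C: "C \<ge> 0" "\<And>n. k n \<le> \<epsilon> * real n + C" by auto
    have "\<exists>\<xi>. length \<xi> \<le> \<tau> \<and> p (a @ \<xi> @ b) \<ge> exp (- (\<epsilon> * real (length a) + C)) * p a * p b"
      if "a \<noteq> []" "b \<noteq> []" "p a > 0" "p b > 0" for a b
    proof -
      have "length a \<ge> 1" "length b \<ge> 1" using that by (auto simp: Suc_le_eq)
      from sld[OF this, of a b] that obtain \<xi> where \<xi>: "length \<xi> \<le> \<tau>"
        "p (a @ \<xi> @ b) \<ge> exp (- k (length a)) * p a * p b" by (auto simp: supp_words_def)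
      have "exp (- (\<epsilon> * real (length a) + C)) * p a * p b \<le> exp (- k (length a)) * p a * p b"
        using C(2)[of "length a"] by (intro mult_right_mono) auto
      with \<xi> show ?thesis by force
    qed
    with C(1) show "\<exists>C\<ge>0. \<forall>a b. a \<noteq> [] \<longrightarrow> b \<noteq> [] \<longrightarrow> p a > 0 \<longrightarrow> p b > 0 \<longrightarrow>
      (\<exists>\<xi>. length \<xi> \<le> \<tau> \<and> p (a @ \<xi> @ b) \<ge> exp (- (\<epsilon> * real (length a) + C)) * p a * p b)"
      by blast
  qed
qed

text \<open>The preimages of \<open>G\<close> under the iterated shift increase and all have the
  measure of \<open>G\<close>; their union is strictly invariant, as \<open>ergodic\<close>
  demands.\<close>

lemma ergodic_subinvariant:
  assumes erg: "ergodic M" and G: "G \<in> sets M" and sub: "G \<subseteq> left_shift -` G"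
  shows "prob G = 0 \<or> prob G = 1"
proof -
  define H where "H n = shift_by n -` G" for n
  have shift_Suc: "shift_by (Suc n) = left_shift \<circ> (shift_by n :: (nat \<Rightarrow> 'a) \<Rightarrow> _)" for n
    by (auto simp: left_shift_def)
  have shift_Suc': "shift_by (Suc n) = (shift_by n :: (nat \<Rightarrow> 'a) \<Rightarrow> _) \<circ> left_shift" for n
    by (auto simp: left_shift_def)
  have H_sets: "H n \<in> sets M" for n
    using measurable_sets[OF measurable_shift_by G, of n] by (simp add: H_def)
  have prob_H: "prob (H n) = prob G" for n
    using measure_distr[OF measurable_shift_by G, of n] by (simp add: H_def distr_shift_by)
  have H_Suc: "H n \<subseteq> H (Suc n)" for n
    using sub unfolding H_def shift_Suc by auto
  then have inc: "incseq H" by (rule incseq_SucI)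
  have "(\<lambda>n. prob (H n)) \<longlonglongrightarrow> prob (\<Union>n. H n)"
    using H_sets inc by (intro finite_Lim_measure_incseq) auto
  then have eq: "prob (\<Union>n. H n) = prob G"
    by (simp add: prob_H LIMSEQ_const_iff)
  have "left_shift -` (\<Union>n. H n) = (\<Union>n. H (Suc n))"
    unfolding H_def shift_Suc' by auto
  also have "\<dots> = (\<Union>n. H n)" using H_Suc by blast
  finally have "left_shift -` (\<Union>n. H n) \<inter> space M = (\<Union>n. H n)" by simp
  moreover have "(\<Union>n. H n) \<in> sets M" using H_sets by blast
  ultimately have "prob (\<Union>n. H n) = 0 \<or> prob (\<Union>n. H n) = 1"
    using erg unfolding ergodic_def by blast
  then show ?thesis by (simp add: eq)
qed

text \<open>The nontrivial half of Kingman's theorem. If \<open>F / n\<close> dipped below \<open>c1 < c\<close> infinitely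
  often, then a long word could be cut greedily into blocks on which \<open>F\<close> is at most \<open>c1\<close> per
  letter, plus rare single letters, and its mean could not reach \<open>c\<close> per letter.\<close>

lemma subadditive_lower_AE:
  fixes F :: "'a list \<Rightarrow> real"
  assumes erg: "ergodic M"
    and sub: "\<And>\<epsilon>. \<epsilon> > 0 \<Longrightarrow>
      \<exists>C. \<forall>a b. p (a @ b) > 0 \<longrightarrow> F (a @ b) \<le> F a + F b + \<epsilon> * real (length a) + C"
    and bd: "\<And>a. p a > 0 \<Longrightarrow> F a \<le> B * real (length a) + B" and B: "B \<ge> 0"
    and freq: "\<exists>\<^sub>F n in sequentially. c * real n \<le> (\<Sum>a\<in>words n. p a * F a)"
    and c': "c' < c"
  shows "AE x in M. \<forall>\<^sub>F n in sequentially. c' * real n \<le> F (initial_word n x)"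
proof -
  define c1 where "c1 = (c + c') / 2"
  have c1: "c' < c1" "c1 < c" using c' by (auto simp: c1_def)
  \<comment> \<open>Three \<epsilon> are spent in \<open>mean\<close> below; the fourth yields the
    contradiction.\<close>
  define \<epsilon> where "\<epsilon> = (c - c1) / 4"
  have \<epsilon>: "\<epsilon> > 0" using c1 by (simp add: \<epsilon>_def)
  obtain C0 where C0: "\<And>a b. p (a @ b) > 0 \<Longrightarrow> F (a @ b) \<le> F a + F b + \<epsilon> * real (length a) + C0"
    using sub[OF \<epsilon>] by auto
  define C where "C = max C0 0"
  have C: "C \<ge> 0" "\<And>a b. p (a @ b) > 0 \<Longrightarrow> F (a @ b) \<le> F a + F b + \<epsilon> * real (length a) + C"
    using C0 by (force simp: C_def)+
  \<comment> \<open>This says liminf F / n \<ge> c1, with countable quantifiers to make it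
    measurable. The tolerances absorb the bounded loss in F when the first letter is removed.
    Positivity is carried along because subadditivity is assumed on words of positive probability
    only.\<close>
  define G where "G = {x. (\<forall>k. \<exists>N. \<forall>n\<ge>N. (c1 - 1 / real (Suc k)) * real n \<le> F (initial_word n x))
      \<and> (\<forall>n. p (initial_word n x) > 0)}"
  have G_sets: "G \<in> sets M"
  proof -
    have "{x \<in> space M. (\<forall>k. \<exists>N. \<forall>n. n \<ge> N \<longrightarrow> (c1 - 1 / real (Suc k)) * real n \<le> F (initial_word n x))
      \<and> (\<forall>n. p (initial_word n x) > 0)} \<in> sets M"
      by measurable
    then show ?thesis by (simp add: G_def)
  qed
  have G_sub: "G \<subseteq> left_shift -` G"
  proof
    fix x assume x: "x \<in> G"
    define y where "y = left_shift x"
    have iw: "initial_word (Suc n) x = [x 0] @ initial_word n y" for n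
      using initial_word_add[of 1 n x] by (simp add: y_def left_shift_def initial_word_def)
    have pos: "p ([x 0] @ initial_word n y) > 0" for n
      using x iw unfolding G_def by (metis (no_types, lifting) mem_Collect_eq)
    have pos_y: "p (initial_word n y) > 0" for n
      using pos p_append_le2 by (rule less_le_trans)
    define D where "D = \<bar>F [x 0]\<bar> + \<epsilon> + C + \<bar>c1\<bar> + 1"
    have FD: "F (initial_word (Suc n) x) \<le> F (initial_word n y) + (D - \<bar>c1\<bar> - 1)" for n
      using C(2)[OF pos[of n]] unfolding iw D_def by simp
    have "\<exists>N. \<forall>n\<ge>N. (c1 - 1 / real (Suc k)) * real n \<le> F (initial_word n y)" for k
    proof -
      obtain N where N: "\<And>n. n \<ge> N \<Longrightarrow>
          (c1 - 1 / real (Suc (Suc k))) * real n \<le> F (initial_word n x)"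
        using x unfolding G_def by blast
      \<comment> \<open>The difference of consecutive tolerances; times \<open>n\<close> it
        eventually beats the constant \<open>D\<close>.\<close>
      define d where "d = 1 / real (Suc k) - 1 / real (Suc (Suc k))"
      have d: "d > 0" by (simp add: d_def frac_less2)
      obtain N' where N': "D / d \<le> real N'" using real_arch_simple by blast
      have "(c1 - 1 / real (Suc k)) * real n \<le> F (initial_word n y)" if n: "n \<ge> max N N'" for n
      proof -
        have "D \<le> d * real n"
        proof -
          have "D / d \<le> real n" using N' n by linarith
          then show ?thesis using d by (simp add: field_simps)
        qed
        moreover have "(c1 - 1 / real (Suc (Suc k))) * real (Suc n) \<le> F (initial_word n y) + (D - \<bar>c1\<bar> - 1)"
          using N[of "Suc n"] FD[of n] n by linarith
        moreover have "(c1 - 1 / real (Suc (Suc k))) * real (Suc n)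
            = (c1 - 1 / real (Suc k)) * real n + d * real n + (c1 - 1 / real (Suc (Suc k)))"
          by (simp add: d_def algebra_simps add_divide_distrib)
        moreover have "1 / real (Suc (Suc k)) \<le> 1" by simp
        ultimately show ?thesis by linarith
      qed
      then show ?thesis by blast
    qed
    then show "x \<in> left_shift -` G" using pos_y by (auto simp: G_def y_def)
  qed
  have "prob G = 1"
  proof (rule ccontr)
    assume "prob G \<noteq> 1"
    then have "prob G = 0" using ergodic_subinvariant[OF erg G_sets G_sub] by blast
    then have "AE x in M. x \<notin> G"
      using G_sets by (intro AE_not_in) (simp add: null_sets_def emeasure_eq_measure)
    moreover have "AE x in M. \<forall>n. p (initial_word n x) > 0"
      using AE_p_pos
    proof (rule AE_mp, intro AE_I2 impI allI)
      fix x n assume "\<forall>n i. 0 < p (initial_word n (shift_by i x))"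
      then show "0 < p (initial_word n x)" by (elim allE[of _ n] allE[of _ 0]) simp
    qed
    ultimately have AE_low: "AE x in M. \<forall>N. \<exists>n\<ge>N. F (initial_word n x) < c1 * real n"
    proof eventually_elim
      case (elim x)
      then obtain k where k: "\<And>N. \<exists>n\<ge>N. F (initial_word n x) < (c1 - 1 / real (Suc k)) * real n"
        unfolding G_def by (auto simp: not_le)
      show ?case
      proof
        fix N
        obtain n where "n \<ge> N" "F (initial_word n x) < (c1 - 1 / real (Suc k)) * real n"
          using k by blast
        moreover have "(c1 - 1 / real (Suc k)) * real n \<le> c1 * real n"
          by (intro mult_right_mono) auto
        ultimately show "\<exists>n\<ge>N. F (initial_word n x) < c1 * real n" by force
      qed
    qed
    \<comment> \<open>From length \<open>n0\<close> on, the constant \<open>C\<close> of one cut is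
      at most \<epsilon> per letter of the block cut off.\<close>
    obtain n0' where n0': "C / \<epsilon> \<le> real n0'" using real_arch_simple by blast
    define n0 where "n0 = max n0' 1"
    have n0: "n0 \<ge> 1" "\<And>n. n \<ge> n0 \<Longrightarrow> C \<le> \<epsilon> * real n"
    proof -
      fix n assume "n \<ge> n0"
      then have "C / \<epsilon> \<le> real n" using n0' unfolding n0_def by linarith
      then show "C \<le> \<epsilon> * real n" using \<epsilon> by (simp add: field_simps)
    qed (simp add: n0_def)
    \<comment> \<open>No prefix of length between \<open>n0\<close> and \<open>m\<close> is cheap.
      As F dips below c1 arbitrarily late almost surely, these events shrink to a null set.\<close>
    define A where "A m = {x. \<forall>n. n0 \<le> n \<and> n \<le> m \<longrightarrow> c1 * real n < F (initial_word n x)}" for m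
    have A_sets: "A m \<in> sets M" for m
    proof -
      have "{x \<in> space M. \<forall>n. n0 \<le> n \<and> n \<le> m \<longrightarrow> c1 * real n < F (initial_word n x)} \<in> sets M"
        by measurable
      then show ?thesis by (simp add: A_def)
    qed
    have "decseq A" by (auto simp: A_def decseq_def)
    then have "(\<lambda>m. prob (A m)) \<longlonglongrightarrow> prob (\<Inter>m. A m)"
      using A_sets by (intro finite_Lim_measure_decseq) auto
    moreover have "prob (\<Inter>m. A m) = 0"
    proof -
      have "AE x in M. x \<notin> (\<Inter>m. A m)" using AE_low
      proof eventually_elim
        case (elim x)
        then obtain n where "n \<ge> n0" "F (initial_word n x) < c1 * real n" by blast
        then have "x \<notin> A n" by (auto simp: A_def intro!: exI[of _ n])
        then show ?case by blast
      qed
      moreover have "(\<Inter>m. A m) \<in> sets M" using A_sets by auto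
      ultimately show ?thesis using prob_eq_0 by blast
    qed
    ultimately have A_lim: "(\<lambda>m. prob (A m)) \<longlonglongrightarrow> 0" by simp
    \<comment> \<open>The price of one bad letter: \<open>2 * B\<close> bounds F on the letter,
      \<open>\<epsilon> + C\<close> pays for the cut, and the rest offsets a negative c1.\<close>
    define D where "D = 2 * B + \<epsilon> + C + \<bar>c1\<bar> + 1"
    have D: "D > 0" using B \<epsilon> C by (simp add: D_def)
    have "\<forall>\<^sub>F m in sequentially. prob (A m) < \<epsilon> / D"
      using A_lim \<epsilon> D by (intro order_tendstoD) auto
    moreover have "\<forall>\<^sub>F m in sequentially. m \<ge> n0" by (rule eventually_ge_at_top)
    ultimately have "\<forall>\<^sub>F m in sequentially. prob (A m) < \<epsilon> / D \<and> m \<ge> n0" by (rule eventually_conj)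
    then obtain m where m: "prob (A m) < \<epsilon> / D" "m \<ge> n0"
      by (auto simp: eventually_sequentially)
    define bad where "bad v \<longleftrightarrow> (\<forall>n. n0 \<le> n \<and> n \<le> m \<longrightarrow> c1 * real n < F (take n v))" for v
    define h :: "'a list \<Rightarrow> real" where "h v = of_bool (m \<le> length v \<and> bad (take m v))" for v
    \<comment> \<open>The number of positions from which no cheap block can be cut within the next
      \<open>m\<close> letters. A tail shorter than \<open>m\<close> counts as zero and is paid for
      by \<open>K\<close>.\<close>
    define bc where "bc v = (\<Sum>i<length v. h (drop i v))" for v
    have h_nonneg: "0 \<le> h v" for v by (simp add: h_def)
    have bc_nonneg: "0 \<le> bc v" for v unfolding bc_def by (intro sum_nonneg h_nonneg)
    have bc_Cons: "bc (z # v) = h (z # v) + bc v" for z v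
      unfolding bc_def by (simp add: sum.lessThan_Suc_shift del: sum.lessThan_Suc)
    have bc_drop: "bc (drop n v) \<le> bc v" for n v
    proof (induction v arbitrary: n)
      case (Cons z v)
      show ?case using Cons[of "n - 1"] bc_Cons[of z v] h_nonneg[of "z # v"] by (cases n) auto
    qed (simp)
    define K where "K = (B + \<bar>c1\<bar> + 2 * \<epsilon>) * real m + B"
    \<comment> \<open>Greedy cutting from the left by strong induction on the length: a single
      letter at a bad position, otherwise a block of length between \<open>n0\<close> and
      \<open>m\<close> on which F is at most c1 per letter.\<close>
    have claim: "p v > 0 \<Longrightarrow> F v \<le> (c1 + 2 * \<epsilon>) * real (length v) + D * bc v + K" for v
    proof (induction "length v" arbitrary: v rule: less_induct)
      case less
      show ?case
      proof (cases "length v < m")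
        case True
        have "F v \<le> B * real (length v) + B" using bd less.prems by blast
        also have "B * real (length v) \<le> B * real m" using True B by (intro mult_left_mono) auto
        finally have 1: "F v \<le> B * real m + B" by simp
        have 2: "(\<bar>c1\<bar> + 2 * \<epsilon>) * real (length v) \<le> (\<bar>c1\<bar> + 2 * \<epsilon>) * real m"
          using True \<epsilon> by (intro mult_left_mono) auto
        have 3: "(- (\<bar>c1\<bar> + 2 * \<epsilon>)) * real (length v) \<le> (c1 + 2 * \<epsilon>) * real (length v)"
          using \<epsilon> by (intro mult_right_mono) auto
        have 4: "0 \<le> D * bc v" using D bc_nonneg by simp
        show ?thesis using 1 2 3 4 unfolding K_def by (simp add: algebra_simps)
      next
        case False
        then have mv: "m \<le> length v" by simp
        show ?thesis
        proof (cases "bad (take m v)")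
          case True
          then have h1: "h v = 1" using mv by (simp add: h_def)
          have "v \<noteq> []" using mv m n0 by auto
          then obtain z w where v: "v = z # w" by (cases v) auto
          have pos: "p ([z] @ w) > 0" using less.prems v by simp
          have "p [z] > 0" "p w > 0"
            using pos p_append_le1[of "[z]" w] p_append_le2[of "[z]" w] by linarith+
          then have "F [z] \<le> 2 * B" "F w \<le> (c1 + 2 * \<epsilon>) * real (length w) + D * bc w + K"
            using bd[of "[z]"] less.hyps[of w] v by auto
          moreover have "F v \<le> F [z] + F w + \<epsilon> + C" using C(2)[OF pos] v by simp
          moreover have "D * bc v = D + D * bc w" using h1 v bc_Cons by (simp add: algebra_simps)
          moreover have "(c1 + 2 * \<epsilon>) * real (length v)
              = (c1 + 2 * \<epsilon>) * real (length w) + c1 + 2 * \<epsilon>" using v by (simp add: algebra_simps)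
          ultimately show ?thesis using \<epsilon> unfolding D_def by linarith
        next
          case False
          then obtain n where n: "n0 \<le> n" "n \<le> m" "F (take n (take m v)) \<le> c1 * real n"
            by (auto simp: bad_def not_less)
          have lt: "length (take n v) = n" using n mv by simp
          have pos: "p (take n v @ drop n v) > 0" using less.prems by simp
          then have "p (drop n v) > 0" using p_append_le2 by (rule less_le_trans)
          moreover have "length (drop n v) < length v" using n n0 mv by simp
          ultimately have "F (drop n v) \<le> (c1 + 2 * \<epsilon>) * real (length v - n) + D * bc (drop n v) + K"
            using less.hyps[of "drop n v"] by simp
          moreover have "D * bc (drop n v) \<le> D * bc v" using bc_drop D by simp
          moreover have "F v \<le> F (take n v) + F (drop n v) + \<epsilon> * real n + C"
            using C(2)[OF pos] lt by simp
          moreover have "C \<le> \<epsilon> * real n" using n0 n by blast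
          moreover have "F (take n v) \<le> c1 * real n" using n by (simp add: min_absorb1)
          moreover have "(c1 + 2 * \<epsilon>) * real (length v - n)
              = (c1 + 2 * \<epsilon>) * real (length v) - c1 * real n - 2 * (\<epsilon> * real n)"
            using n mv by (simp add: of_nat_diff algebra_simps)
          ultimately show ?thesis by linarith
        qed
      qed
    qed
    \<comment> \<open>By stationarity each position is bad with probability at most
      \<open>prob (A m)\<close>, which is below \<open>\<epsilon> / D\<close>: on average bad
      letters cost \<epsilon> per letter.\<close>
    have sum_bc: "(\<Sum>v\<in>words N. p v * bc v) \<le> real N * prob (A m)" for N
    proof -
      have A_eq: "prob (A m) = (\<Sum>b\<in>words m. p b * of_bool (bad b))"
      proof -
        have "A m = {x. bad (initial_word m x)}"
          unfolding A_def bad_def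
          by (intro Collect_cong) (metis (no_types, lifting) take_initial_word_le)
        then have "prob (A m) = (\<Sum>a | length a = m \<and> bad a. p a)"
          by (simp add: prob_initial_word)
        also have "\<dots> = (\<Sum>b\<in>words m. p b * of_bool (bad b))"
          by (rule sum.mono_neutral_cong_left) auto
        finally show ?thesis .
      qed
      have one: "(\<Sum>v\<in>words N. p v * h (drop i v)) \<le> prob (A m)" for i
      proof (cases "i + m \<le> N")
        case True
        have "(\<Sum>v\<in>words N. p v * h (drop i v))
            = (\<Sum>v\<in>words N. p v * of_bool (bad (take m (drop i v))))"
          using True by (intro sum.cong) (auto simp: h_def)
        also have "\<dots> = prob (A m)"
          unfolding A_eq by (rule sum_factor[OF True])
        finally show ?thesis by simp
      next
        case False
        then have "(\<Sum>v\<in>words N. p v * h (drop i v)) = 0"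
          using m n0 by (intro sum.neutral) (auto simp: h_def)
        then show ?thesis by simp
      qed
      have "(\<Sum>v\<in>words N. p v * bc v) = (\<Sum>v\<in>words N. \<Sum>i<N. p v * h (drop i v))"
        by (intro sum.cong) (auto simp: bc_def sum_distrib_left)
      also have "\<dots> = (\<Sum>i<N. \<Sum>v\<in>words N. p v * h (drop i v))" by (rule sum.swap)
      also have "\<dots> \<le> (\<Sum>i<N. prob (A m))" by (intro sum_mono one)
      finally show ?thesis by simp
    qed
    have mean: "(\<Sum>a\<in>words N. p a * F a) \<le> (c1 + 3 * \<epsilon>) * real N + K" for N
    proof -
      have "(\<Sum>a\<in>words N. p a * F a)
          \<le> (\<Sum>a\<in>words N. p a * ((c1 + 2 * \<epsilon>) * real N + K) + D * (p a * bc a))"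
      proof (rule sum_mono)
        fix a :: "'a list" assume a: "a \<in> words N"
        show "p a * F a \<le> p a * ((c1 + 2 * \<epsilon>) * real N + K) + D * (p a * bc a)"
        proof (cases "p a = 0")
          case False
          then have "p a > 0" by (simp add: less_le)
          then have "p a * F a \<le> p a * ((c1 + 2 * \<epsilon>) * real N + D * bc a + K)"
            using claim[of a] a by (intro mult_left_mono) auto
          then show ?thesis by (simp add: algebra_simps)
        qed simp
      qed
      also have "\<dots> = ((c1 + 2 * \<epsilon>) * real N + K) + D * (\<Sum>a\<in>words N. p a * bc a)"
        by (simp add: sum.distrib sum_distrib_left[symmetric] sum_distrib_right[symmetric])
      also have "D * (\<Sum>a\<in>words N. p a * bc a) \<le> D * (real N * (\<epsilon> / D))"
        using D m order_trans[OF sum_bc mult_left_mono[of "prob (A m)" "\<epsilon> / D" "real N"]]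
        by (intro mult_left_mono) auto
      also have "\<dots> = \<epsilon> * real N" using D by simp
      finally show ?thesis by (simp add: algebra_simps)
    qed
    obtain N0 where N0: "K / \<epsilon> < real N0" using reals_Archimedean2 by blast
    obtain N where N: "N \<ge> N0" "c * real N \<le> (\<Sum>a\<in>words N. p a * F a)"
      using freq unfolding frequently_sequentially by blast
    have "c * real N \<le> (c1 + 3 * \<epsilon>) * real N + K" using N(2) mean[of N] by linarith
    moreover have "c = c1 + 4 * \<epsilon>" by (simp add: \<epsilon>_def field_simps)
    ultimately have "\<epsilon> * real N \<le> K" by (simp add: distrib_right)
    moreover have "K < \<epsilon> * real N"
    proof -
      have "K / \<epsilon> < real N" using N0 N(1) by linarith
      then show ?thesis using \<epsilon> by (simp add: field_simps)
    qed
    ultimately show False by simp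
  qed
  then have "AE x in M. x \<in> G" using G_sets prob_eq_1 by blast
  then show ?thesis
  proof eventually_elim
    case (elim x)
    obtain k where k: "1 / real (Suc k) < c1 - c'"
      using nat_approx_posE[of "c1 - c'"] c1 by auto
    obtain N where "\<And>n. n \<ge> N \<Longrightarrow> (c1 - 1 / real (Suc k)) * real n \<le> F (initial_word n x)"
      using elim unfolding G_def by blast
    moreover have "c' * real n \<le> (c1 - 1 / real (Suc k)) * real n" for n
      using k by (intro mult_right_mono) auto
    ultimately show ?case
      unfolding eventually_sequentially by (metis order_trans)
  qed
qed

end

subsection \<open>Parsing and waiting times\<close>

lemma (in prob_space) borel_cantelli_AE:
  assumes "\<And>n. A n \<in> sets M" and "\<forall>\<^sub>F n in sequentially. prob (A n) \<le> \<beta> n" and "summable \<beta>"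
  shows "AE x in M. \<forall>\<^sub>F n in sequentially. x \<notin> A n"
proof -
  have "summable (\<lambda>n. prob (A n))"
  proof (rule summable_comparison_test_ev)
    show "\<forall>\<^sub>F n in sequentially. norm (prob (A n)) \<le> \<beta> n" using assms(2) by simp
  qed (rule assms)
  then have "AE x in M. \<forall>\<^sub>F n in sequentially. x \<in> space M - A n"
    using assms(1) by (intro borel_cantelli_AE1) (simp_all add: emeasure_eq_measure)
  then show ?thesis
  proof eventually_elim
    case (elim x)
    then show ?case by eventually_elim simp
  qed
qed

text \<open>By minimality all proper prefixes occur in \<open>u\<close>. Newness is claimed only if
  the word ends strictly before the end of \<open>w\<close>, because a word that exhausts
  \<open>w\<close> may occur in \<open>u\<close> as well.\<close>

lemma mzm_word_length_bounds:
  assumes "w \<noteq> []"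
  shows "mzm_word_length u w \<le> length w"
    and "sublist (butlast (take (mzm_word_length u w) w)) u"
    and "mzm_word_length u w < length w \<Longrightarrow> \<not> sublist (take (mzm_word_length u w) w) u"
proof -
  let ?k = "mzm_word_length u w"
  have "?k \<le> length w \<and> sublist (butlast (take ?k w)) u \<and>
      (?k < length w \<longrightarrow> \<not> sublist (take ?k w) u)"
  proof (cases "\<exists>k. \<not> sublist (take k w) u")
    case True
    then have k: "?k = (LEAST k. \<not> sublist (take k w) u)" by (simp add: mzm_word_length_def)
    have 1: "\<not> sublist (take ?k w) u" unfolding k using True by (rule LeastI_ex)
    have min: "sublist (take j w) u" if "j < ?k" for j
      using that not_less_Least[of j "\<lambda>k. \<not> sublist (take k w) u"] unfolding k by simp
    have le: "?k \<le> length w"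
    proof (rule ccontr)
      assume "\<not> ?k \<le> length w"
      then show False using min[of "length w"] 1 by simp
    qed
    have "butlast (take ?k w) = take (?k - 1) w" using le by (simp add: butlast_take)
    moreover have "?k > 0" using mzm_word_length_pos[OF assms] .
    ultimately show ?thesis using 1 le min[of "?k - 1"] by simp
  next
    case False
    then have "?k = length w" by (simp add: mzm_word_length_def)
    moreover have "sublist (take (length w - 1) w) u" using False by blast
    ultimately show ?thesis by (simp add: butlast_conv_take)
  qed
  then show "?k \<le> length w" "sublist (butlast (take ?k w)) u"
    "?k < length w \<Longrightarrow> \<not> sublist (take ?k w) u" by auto
qed

lemma mzm_parsing_Nil [simp]: "mzm_parsing u [] = []"
  by (subst mzm_parsing.simps) simp

lemma mzm_parsing_eq_Nil [simp]: "mzm_parsing u w = [] \<longleftrightarrow> w = []"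
  by (subst mzm_parsing.simps) simp

lemma concat_mzm_parsing [simp]: "concat (mzm_parsing u w) = w"
proof (induction u w rule: mzm_parsing.induct)
  case (1 u w)
  then show ?case by (subst mzm_parsing.simps) simp
qed

lemma mzm_parsing_word:
  "v \<in> set (mzm_parsing u w) \<Longrightarrow> v \<noteq> [] \<and> sublist (butlast v) u"
proof (induction u w rule: mzm_parsing.induct)
  case (1 u w)
  show ?case
  proof (cases "w = []")
    case False
    then have "v = take (mzm_word_length u w) w
        \<or> v \<in> set (mzm_parsing u (drop (mzm_word_length u w) w))"
      using 1(2) False by (subst (asm) mzm_parsing.simps) auto
    then show ?thesis
      using 1(1)[OF False] False mzm_word_length_bounds(2)[OF False, of u] mzm_word_length_pos[OF False, of u]
      by auto
  qed (use 1 in simp)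
qed

text \<open>Only the final word of a parsing exhausts the remaining text, hence the
  \<open>butlast\<close>.\<close>

lemma mzm_parsing_fresh:
  "v \<in> set (butlast (mzm_parsing u w)) \<Longrightarrow> \<not> sublist v u"
proof (induction u w rule: mzm_parsing.induct)
  case (1 u w)
  show ?case
  proof (cases "w = []")
    case False
    let ?k = "mzm_word_length u w"
    have "v \<in> set (butlast (take ?k w # mzm_parsing u (drop ?k w)))"
      using 1(2) False by (subst (asm) mzm_parsing.simps) simp
    then have "?k < length w \<and> v = take ?k w \<or> v \<in> set (butlast (mzm_parsing u (drop ?k w)))"
      by (auto split: if_splits)
    then show ?thesis using 1(1)[OF False] mzm_word_length_bounds(3)[OF False, of u] by auto
  qed (use 1 in simp)
qed

lemma length_le_length_concat: "(\<And>v. v \<in> set vs \<Longrightarrow> v \<noteq> []) \<Longrightarrow> length vs \<le> length (concat vs)"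
proof (induction vs)
  case (Cons v vs)
  then have "length v \<ge> 1" "length vs \<le> length (concat vs)" by (auto simp: Suc_le_eq)
  then show ?case by simp
qed simp

lemma mzm_count_le: "mzm_count N y x \<le> N"
  using length_le_length_concat[of "mzm_parsing (initial_word N x) (initial_word N y)"]
  by (auto simp: mzm_count_def mzm_parsing_word)

lemma initial_word_eq_Nil [simp]: "initial_word n x = [] \<longleftrightarrow> n = 0"
  by (simp add: initial_word_def)

lemma mzm_count_pos: "N > 0 \<Longrightarrow> mzm_count N y x > 0"
  by (simp add: mzm_count_def)

context stationary_process
begin

text \<open>Fix the last \<open>m\<close> letters \<open>b\<close> and sum over the block in front
  of them: conditionally on \<open>b\<close>, the extension hypothesis places \<open>w\<close>
  inside this block with probability at least \<theta>.\<close>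

lemma prob_avoid_step:
  fixes \<theta> :: real
  assumes m: "m \<ge> 1" and \<theta>: "0 \<le> \<theta>" "\<theta> \<le> 1"
    and ext: "\<And>b. b \<noteq> [] \<Longrightarrow> p b > 0 \<Longrightarrow> \<exists>\<xi>. length \<xi> \<le> \<tau> \<and> p (w @ \<xi> @ b) \<ge> \<theta> * p b"
  shows "prob {x. \<not> sublist w (initial_word (length w + \<tau> + m) x)}
    \<le> (1 - \<theta>) * prob {x. \<not> sublist w (initial_word m x)}"
proof -
  define n where "n = length w + \<tau>"
  have A: "prob {x. \<not> sublist w (initial_word k x)} = (\<Sum>b\<in>words k. p b * of_bool (\<not> sublist w b))" for k
    unfolding prob_initial_word[of "\<lambda>a. \<not> sublist w a"]
    by (rule sum.mono_neutral_cong_left) auto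
  have step: "(\<Sum>a\<in>words n. p (a @ b) * of_bool (\<not> sublist w (a @ b)))
      \<le> (1 - \<theta>) * (p b * of_bool (\<not> sublist w b))" if b: "b \<in> words m" for b
  proof (cases "p b = 0 \<or> sublist w b")
    case True
    have "p (a @ b) * of_bool (\<not> sublist w (a @ b)) = 0" for a
    proof -
      have "p (a @ b) = 0" if "p b = 0" using that p_append_le2[of a b] by (simp add: antisym)
      moreover have "sublist w (a @ b)" if "sublist w b"
        using that by (rule sublist_order.order_trans) simp
      ultimately show ?thesis using True by auto
    qed
    then have "(\<Sum>a\<in>words n. p (a @ b) * of_bool (\<not> sublist w (a @ b))) = 0"
      by (intro sum.neutral) blast
    moreover have "0 \<le> (1 - \<theta>) * (p b * of_bool (\<not> sublist w b))" using \<theta> by simp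
    ultimately show ?thesis by linarith
  next
    case False
    then have "p b > 0" "b \<noteq> []" using b m by (auto simp: less_le)
    then obtain \<xi> where \<xi>: "length \<xi> \<le> \<tau>" "p (w @ \<xi> @ b) \<ge> \<theta> * p b" using ext by blast
    \<comment> \<open>The length of \<xi> depends on \<open>b\<close>, so further letters are summed
      out on the left to reach the common block length \<open>n\<close>.\<close>
    let ?S = "(\<lambda>a. a @ w @ \<xi>) ` words (\<tau> - length \<xi>)"
    have "p (w @ \<xi> @ b) = (\<Sum>a\<in>words (\<tau> - length \<xi>). p (a @ w @ \<xi> @ b))"
      by (rule sum_p_append_left[symmetric])
    also have "\<dots> = (\<Sum>a\<in>?S. p (a @ b))"
      by (subst sum.reindex) (auto simp: inj_on_def)
    also have "\<dots> = (\<Sum>a\<in>?S. p (a @ b) * of_bool (sublist w (a @ b)))"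
    proof (rule sum.cong)
      fix a assume "a \<in> ?S"
      then obtain a' where "a = a' @ w @ \<xi>" by auto
      then have "sublist w (a @ b)" using sublist_appendI[of w a' "\<xi> @ b"] by simp
      then show "p (a @ b) = p (a @ b) * of_bool (sublist w (a @ b))" by simp
    qed simp
    also have "\<dots> \<le> (\<Sum>a\<in>words n. p (a @ b) * of_bool (sublist w (a @ b)))"
      using \<xi> by (intro sum_mono2) (auto simp: n_def)
    finally have "\<theta> * p b \<le> (\<Sum>a\<in>words n. p (a @ b) * of_bool (sublist w (a @ b)))"
      using \<xi> by linarith
    moreover have "(\<Sum>a\<in>words n. p (a @ b) * of_bool (\<not> sublist w (a @ b)))
        + (\<Sum>a\<in>words n. p (a @ b) * of_bool (sublist w (a @ b))) = p b"
      unfolding sum.distrib[symmetric] by (subst sum_p_append_left[of b n, symmetric]) (auto intro: sum.cong)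
    ultimately show ?thesis using False by (simp add: algebra_simps)
  qed
  have "(\<Sum>c\<in>words (n + m). p c * of_bool (\<not> sublist w c))
      = (\<Sum>b\<in>words m. \<Sum>a\<in>words n. p (a @ b) * of_bool (\<not> sublist w (a @ b)))"
    unfolding sum_words_add by (rule sum.swap)
  also have "\<dots> \<le> (\<Sum>b\<in>words m. (1 - \<theta>) * (p b * of_bool (\<not> sublist w b)))"
    by (intro sum_mono step)
  finally show ?thesis unfolding A n_def[symmetric] sum_distrib_left .
qed

text \<open>Applies the one-block estimate \<open>j\<close> times; the additional letter keeps the
  future nonempty, as the extension hypothesis requires.\<close>

lemma prob_avoid:
  fixes \<theta> :: real
  assumes \<theta>: "0 \<le> \<theta>" "\<theta> \<le> 1" and N: "N \<ge> 1 + j * (length w + \<tau>)"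
    and ext: "\<And>b. b \<noteq> [] \<Longrightarrow> p b > 0 \<Longrightarrow> \<exists>\<xi>. length \<xi> \<le> \<tau> \<and> p (w @ \<xi> @ b) \<ge> \<theta> * p b"
  shows "prob {x. \<not> sublist w (initial_word N x)} \<le> exp (- (\<theta> * real j))"
proof -
  have "prob {x. \<not> sublist w (initial_word (1 + j * (length w + \<tau>)) x)} \<le> (1 - \<theta>) ^ j"
  proof (induction j)
    case (Suc j)
    have "prob {x. \<not> sublist w (initial_word (length w + \<tau> + (1 + j * (length w + \<tau>))) x)}
        \<le> (1 - \<theta>) * prob {x. \<not> sublist w (initial_word (1 + j * (length w + \<tau>)) x)}"
      using ext by (intro prob_avoid_step[OF _ \<theta>]) auto
    also have "\<dots> \<le> (1 - \<theta>) * (1 - \<theta>) ^ j" using \<theta> Suc by (intro mult_left_mono) auto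
    finally show ?case by (simp add: algebra_simps)
  qed simp
  moreover have "prob {x. \<not> sublist w (initial_word N x)}
      \<le> prob {x. \<not> sublist w (initial_word (1 + j * (length w + \<tau>)) x)}"
  proof (rule finite_measure_mono)
    have "sublist (initial_word (1 + j * (length w + \<tau>)) x) (initial_word N x)" for x :: "nat \<Rightarrow> 'a"
      using take_initial_word_le[OF N, of x] sublist_take by metis
    then show "{x. \<not> sublist w (initial_word N x)}
        \<subseteq> {x. \<not> sublist w (initial_word (1 + j * (length w + \<tau>)) x)}"
      using sublist_order.order_trans by blast
  qed (rule sets_initial_word)
  moreover have "(1 - \<theta>) ^ j \<le> exp (- \<theta>) ^ j"
    using \<theta> exp_ge_add_one_self[of "- \<theta>"] by (intro power_mono) auto
  moreover have "exp (- \<theta>) ^ j = exp (- (\<theta> * real j))"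
    by (simp add: exp_of_nat_mult[symmetric] mult.commute)
  ultimately show ?thesis by linarith
qed

text \<open>Lower decoupling costs \<open>exp (- k n)\<close> with \<open>n\<close> the length of the \<^emph>\<open>first\<close> word, so one peels
  blocks off the left end, with \<open>w\<close> first and the long future second.\<close>

lemma likely_words_appear:
  assumes sld: "selectively_lower_decoupled M" and \<epsilon>: "0 < \<epsilon>" "\<epsilon> < 1" and D: "D > 0"
  shows "AE x in M. \<forall>\<^sub>F N in sequentially. \<forall>w. w \<noteq> [] \<longrightarrow> real (length w) \<le> D * ln (real N) \<longrightarrow>
           p w \<ge> real N powr (\<epsilon> - 1) \<longrightarrow> sublist w (initial_word N x)"
proof -
  obtain \<tau> where \<tau>: "\<And>\<epsilon>. \<epsilon> > 0 \<Longrightarrow> \<exists>C\<ge>0. \<forall>a b. a \<noteq> [] \<longrightarrow> b \<noteq> [] \<longrightarrow> p a > 0 \<longrightarrow> p b > 0 \<longrightarrow>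
      (\<exists>\<xi>. length \<xi> \<le> \<tau> \<and> p (a @ \<xi> @ b) \<ge> exp (- (\<epsilon> * real (length a) + C)) * p a * p b)"
    using selectively_lower_decoupled_linear[OF sld] by blast
  \<comment> \<open>For words of length at most D ln N the decoupling loss is then at most a factor
    \<open>exp C\<close> times N^(\<epsilon>/2), half of the margin in the assumed
    probability.\<close>
  define \<delta> where "\<delta> = \<epsilon> / (2 * D)"
  have \<delta>: "\<delta> > 0" "\<delta> * D = \<epsilon> / 2" using \<epsilon> D by (auto simp: \<delta>_def)
  from \<tau>[OF \<delta>(1)] obtain C where C: "C \<ge> 0" and
    ext: "\<And>a b. a \<noteq> [] \<Longrightarrow> b \<noteq> [] \<Longrightarrow> p a > 0 \<Longrightarrow> p b > 0 \<Longrightarrow>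
      \<exists>\<xi>. length \<xi> \<le> \<tau> \<and> p (a @ \<xi> @ b) \<ge> exp (- (\<delta> * real (length a) + C)) * p a * p b"
    by blast
  define W where "W N = {w. w \<noteq> [] \<and> real (length w) \<le> D * ln (real N) \<and> p w \<ge> real N powr (\<epsilon> - 1)}"
    for N :: nat
  \<comment> \<open>The number of candidate words times the avoidance probability of each. Some N /
    ln N disjoint blocks make the exponent of order N^(\<epsilon>/2) / ln N, which beats every power
    of N.\<close>
  define \<beta> where "\<beta> N = real N powr (1 - \<epsilon>) * (D * ln (real N) + 1) *
      exp (- (exp (- C) * real N powr (\<epsilon> / 2 - 1) * ((real N - 1) / (D * ln (real N) + real \<tau>) - 1)))"
    for N :: nat
  have W_words: "W N \<subseteq> (\<Union>n\<le>nat \<lfloor>D * ln (real N)\<rfloor>. words n)" for N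
    unfolding W_def by (auto simp: le_nat_floor)
  then have fin: "finite (W N)" for N by (rule finite_subset) auto
  \<comment> \<open>Each length carries total probability 1, so at most N^(1 - \<epsilon>) words of
    that length qualify.\<close>
  have card_W: "real (card (W N)) \<le> real N powr (1 - \<epsilon>) * (D * ln (real N) + 1)" if "N \<ge> 1" for N
  proof -
    have ln: "D * ln (real N) \<ge> 0" using that D by simp
    have "real (card (W N)) = (\<Sum>w\<in>W N. 1)" by simp
    also have "\<dots> \<le> (\<Sum>w\<in>W N. real N powr (1 - \<epsilon>) * p w)"
    proof (rule sum_mono)
      fix w assume "w \<in> W N"
      then have "real N powr (1 - \<epsilon>) * real N powr (\<epsilon> - 1) \<le> real N powr (1 - \<epsilon>) * p w"
        by (intro mult_left_mono) (auto simp: W_def)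
      then show "1 \<le> real N powr (1 - \<epsilon>) * p w" using that by (simp add: powr_add[symmetric])
    qed
    also have "\<dots> \<le> (\<Sum>w\<in>(\<Union>n\<le>nat \<lfloor>D * ln (real N)\<rfloor>. words n). real N powr (1 - \<epsilon>) * p w)"
      using W_words by (intro sum_mono2) auto
    also have "\<dots> = (\<Sum>n\<le>nat \<lfloor>D * ln (real N)\<rfloor>. \<Sum>w\<in>words n. real N powr (1 - \<epsilon>) * p w)"
      by (rule sum.UNION_disjoint) auto
    also have "\<dots> = real N powr (1 - \<epsilon>) * real (nat \<lfloor>D * ln (real N)\<rfloor> + 1)"
      unfolding sum_distrib_left[symmetric] sum_p by simp
    also have "\<dots> \<le> real N powr (1 - \<epsilon>) * (D * ln (real N) + 1)"
      using ln by (intro mult_left_mono) (auto simp: of_nat_floor)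
    finally show ?thesis .
  qed
  have avoid: "prob {x. \<not> sublist w (initial_word N x)}
      \<le> exp (- (exp (- C) * real N powr (\<epsilon> / 2 - 1) * ((real N - 1) / (D * ln (real N) + real \<tau>) - 1)))"
    if N: "N \<ge> 2" and w: "w \<in> W N" for N w
  proof -
    define \<theta> where "\<theta> = exp (- (\<delta> * real (length w) + C)) * p w"
    define j where "j = (N - 1) div (length w + \<tau>)"
    have w': "w \<noteq> []" "real (length w) \<le> D * ln (real N)" "p w \<ge> real N powr (\<epsilon> - 1)"
      using w by (auto simp: W_def)
    have "real N powr (\<epsilon> - 1) > 0" using N by simp
    then have pw: "p w > 0" using w'(3) by linarith
    have "0 \<le> \<delta> * real (length w) + C" using \<delta> C by simp
    then have \<theta>01: "0 \<le> \<theta>" "\<theta> \<le> 1"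
      by (simp_all add: \<theta>_def mult_le_one)
    have "1 + j * (length w + \<tau>) \<le> N" 
    proof -
      have "j * (length w + \<tau>) \<le> N - 1" unfolding j_def by (rule div_times_less_eq_dividend)
      then show ?thesis using N by linarith
    qed
    then have "prob {x. \<not> sublist w (initial_word N x)} \<le> exp (- (\<theta> * real j))"
    proof (rule prob_avoid[OF \<theta>01])
      fix b assume "b \<noteq> []" "p b > 0"
      from ext[OF w'(1) this(1) pw this(2)]
      show "\<exists>\<xi>. length \<xi> \<le> \<tau> \<and> p (w @ \<xi> @ b) \<ge> \<theta> * p b" by (simp add: \<theta>_def mult.assoc)
    qed
    moreover have "exp (- C) * real N powr (\<epsilon> / 2 - 1) \<le> \<theta>"
    proof -
      have "exp (- C) * real N powr (\<epsilon> / 2 - 1) = exp (- (\<delta> * (D * ln (real N)) + C)) * real N powr (\<epsilon> - 1)"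
      proof -
        have "\<delta> * (D * ln (real N)) = \<epsilon> / 2 * ln (real N)"
          using \<delta>(2) by (metis mult.assoc)
        then have "- C + (\<epsilon> / 2 - 1) * ln (real N) = - (\<delta> * (D * ln (real N)) + C) + (\<epsilon> - 1) * ln (real N)"
          by (simp only: left_diff_distrib)
        then show ?thesis using N by (simp add: powr_def exp_add[symmetric])
      qed
      also have "\<dots> \<le> exp (- (\<delta> * real (length w) + C)) * p w"
        using w' \<delta> by (intro mult_mono) auto
      finally show ?thesis by (simp add: \<theta>_def)
    qed
    moreover have "(real N - 1) / (D * ln (real N) + real \<tau>) - 1 \<le> real j"
    proof -
      have pos: "real (length w + \<tau>) > 0" using w'(1) by (simp only: of_nat_0_less_iff) simp
      have "(real N - 1) / (D * ln (real N) + real \<tau>) \<le> (real N - 1) / real (length w + \<tau>)"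
        using w'(2) N pos by (intro divide_left_mono mult_pos_pos) auto
      also have "\<dots> = real (N - 1) / real (length w + \<tau>)" using N by (simp add: of_nat_diff)
      also have "\<dots> \<le> real j + 1"
        using floor_divide_of_nat_eq[of "N - 1" "length w + \<tau>", where 'a = real]
          real_of_int_floor_add_one_ge[of "real (N - 1) / real (length w + \<tau>)"]
        by (simp add: j_def)
      finally show ?thesis by simp
    qed
    ultimately show ?thesis
    proof -
      assume *: "prob {x. \<not> sublist w (initial_word N x)} \<le> exp (- (\<theta> * real j))"
        "exp (- C) * real N powr (\<epsilon> / 2 - 1) \<le> \<theta>"
        "(real N - 1) / (D * ln (real N) + real \<tau>) - 1 \<le> real j"
      have "exp (- C) * real N powr (\<epsilon> / 2 - 1) * ((real N - 1) / (D * ln (real N) + real \<tau>) - 1)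
          \<le> exp (- C) * real N powr (\<epsilon> / 2 - 1) * real j"
        using *(3) by (intro mult_left_mono) auto
      also have "\<dots> \<le> \<theta> * real j" using *(2) by (intro mult_right_mono) auto
      finally have "exp (- (\<theta> * real j)) \<le> exp (- (exp (- C) * real N powr (\<epsilon> / 2 - 1) *
          ((real N - 1) / (D * ln (real N) + real \<tau>) - 1)))" by simp
      with *(1) show ?thesis by (rule order_trans)
    qed
  qed
  define U where "U N = {x. \<exists>w\<in>W N. \<not> sublist w (initial_word N x)}" for N
  have "AE x in M. \<forall>\<^sub>F N in sequentially. x \<notin> U N"
  proof (rule borel_cantelli_AE)
    show "U N \<in> sets M" for N unfolding U_def by (rule sets_initial_word)
    have "prob (U N) \<le> \<beta> N" if N: "N \<ge> 2" for N
    proof -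
      have "U N = (\<Union>w\<in>W N. {x. \<not> sublist w (initial_word N x)})" by (auto simp: U_def)
      then have "prob (U N) \<le> (\<Sum>w\<in>W N. prob {x. \<not> sublist w (initial_word N x)})"
        using fin by (auto intro!: finite_measure_subadditive_finite sets_initial_word)
      also have "\<dots> \<le> (\<Sum>w\<in>W N. exp (- (exp (- C) * real N powr (\<epsilon> / 2 - 1) * ((real N - 1) / (D * ln (real N) + real \<tau>) - 1))))"
        by (intro sum_mono avoid[OF N])
      also have "\<dots> \<le> \<beta> N"
        unfolding \<beta>_def sum_constant using card_W[of N] N by (intro mult_right_mono) auto
      finally show ?thesis .
    qed
    moreover have "\<forall>\<^sub>F N in sequentially. \<beta> N \<le> 1 / real N ^ 2"
      unfolding \<beta>_def using \<epsilon> D by real_asymp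
    ultimately have le: "N \<ge> 2 \<Longrightarrow> prob (U N) \<le> \<beta> N" and ev: "\<forall>\<^sub>F N in sequentially. \<beta> N \<le> 1 / real N ^ 2" for N
      by auto
    show "\<forall>\<^sub>F N in sequentially. prob (U N) \<le> 1 / real N ^ 2"
      using ev eventually_ge_at_top[of "2::nat"]
    proof eventually_elim
      case (elim N)
      then show ?case using le[of N] by linarith
    qed
    show "summable (\<lambda>N. 1 / real N ^ 2)"
      using inverse_power_summable[of 2, where 'a = real] by (simp add: divide_inverse)
  qed
  then show ?thesis
  proof eventually_elim
    case (elim x)
    then show ?case by eventually_elim (auto simp: U_def W_def)
  qed
qed

end

subsection \<open>Cross entropy and the upper bound\<close>

text \<open>Rational thresholds suffice, so only countably many null sets are involved.\<close>

lemma AE_limsup_le: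
  fixes f :: "nat \<Rightarrow> 'z \<Rightarrow> ereal"
  assumes "\<And>\<kappa>::real. D < ereal \<kappa> \<Longrightarrow> AE z in M. \<forall>\<^sub>F N in sequentially. f N z \<le> ereal \<kappa>"
  shows "AE z in M. limsup (\<lambda>N. f N z) \<le> D"
proof -
  have "AE z in M. \<forall>r::rat. D < ereal (real_of_rat r) \<longrightarrow> (\<forall>\<^sub>F N in sequentially. f N z \<le> ereal (real_of_rat r))"
    unfolding AE_all_countable using assms by auto
  then show ?thesis
  proof eventually_elim
    case (elim z)
    show ?case
    proof (rule ccontr)
      assume "\<not> ?thesis"
      then have "D < limsup (\<lambda>N. f N z)" by simp
      then obtain r where r: "D < ereal (real_of_rat r)" "ereal (real_of_rat r) < limsup (\<lambda>N. f N z)"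
        using ereal_dense3 by blast
      then have "limsup (\<lambda>N. f N z) \<le> ereal (real_of_rat r)"
        using elim by (intro Limsup_bounded) auto
      with r show False by simp
    qed
  qed
qed

lemma AE_liminf_ge:
  fixes f :: "nat \<Rightarrow> 'z \<Rightarrow> ereal"
  assumes "\<And>\<kappa>::real. ereal \<kappa> < D \<Longrightarrow> AE z in M. \<forall>\<^sub>F N in sequentially. ereal \<kappa> \<le> f N z"
  shows "AE z in M. D \<le> liminf (\<lambda>N. f N z)"
proof -
  have "AE z in M. \<forall>r::rat. ereal (real_of_rat r) < D \<longrightarrow> (\<forall>\<^sub>F N in sequentially. ereal (real_of_rat r) \<le> f N z)"
    unfolding AE_all_countable using assms by auto
  then show ?thesis
  proof eventually_elim
    case (elim z)
    show ?case
    proof (rule ccontr)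
      assume "\<not> ?thesis"
      then have "liminf (\<lambda>N. f N z) < D" by simp
      then obtain r where r: "liminf (\<lambda>N. f N z) < ereal (real_of_rat r)" "ereal (real_of_rat r) < D"
        using ereal_dense3 by blast
      then have "ereal (real_of_rat r) \<le> liminf (\<lambda>N. f N z)"
        using elim by (intro Liminf_bounded) auto
      with r show False by simp
    qed
  qed
qed

text \<open>Fekete's argument with a linear error: one long \<open>n\<close> with large
  \<open>t n\<close> serves as a repeated block, and nonnegativity disposes of the
  remainder.\<close>

lemma superadditive_linear_growth:
  fixes t :: "nat \<Rightarrow> real"
  assumes super: "\<And>\<epsilon>. \<epsilon> > 0 \<Longrightarrow> \<exists>C. \<forall>n m. t (n + m) \<ge> t n + t m - \<epsilon> * real n - C"
    and nonneg: "\<And>n. t n \<ge> 0"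
    and freq: "\<exists>\<^sub>F n in sequentially. c * real n \<le> t n" and c': "c' < c"
  shows "\<forall>\<^sub>F n in sequentially. c' * real n \<le> t n"
proof -
  \<comment> \<open>Two \<epsilon> pay for the linear error and the constant of each block, the
    third for the remainder of the division.\<close>
  define \<epsilon> where "\<epsilon> = (c - c') / 3"
  have \<epsilon>: "\<epsilon> > 0" using c' by (simp add: \<epsilon>_def)
  obtain C where C: "\<And>n m. t (n + m) \<ge> t n + t m - \<epsilon> * real n - C" using super[OF \<epsilon>] by blast
  obtain n0 where n0: "C / \<epsilon> < real n0" using reals_Archimedean2 by blast
  obtain n where n: "n \<ge> max n0 1" "c * real n \<le> t n"
    using freq unfolding frequently_sequentially by blast
  have Cn: "C \<le> \<epsilon> * real n"
  proof -
    have "C / \<epsilon> < real n" using n0 n by linarith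
    then show ?thesis using \<epsilon> by (simp add: field_simps)
  qed
  define d where "d = c - 2 * \<epsilon>"
  have step: "t (n + m) \<ge> d * real n + t m" for m
  proof -
    have "d * real n = c * real n - 2 * (\<epsilon> * real n)" by (simp add: d_def algebra_simps)
    then show ?thesis using C[of n m] Cn n(2) by linarith
  qed
  have iter: "t (j * n + r) \<ge> real j * (d * real n)" for j r
  proof (induction j)
    case (Suc j)
    have "Suc j * n + r = n + (j * n + r)" by simp
    then show ?case using step[of "j * n + r"] Suc by (simp add: algebra_simps)
  qed (simp add: nonneg)
  obtain N0 where N0: "\<bar>d\<bar> * real n / \<epsilon> < real N0" using reals_Archimedean2 by blast
  have "c' * real N \<le> t N" if "N \<ge> N0" for N
  proof -
    have "\<bar>d\<bar> * real n / \<epsilon> < real N" using N0 that by linarith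
    then have N: "\<bar>d\<bar> * real n \<le> \<epsilon> * real N" using \<epsilon> by (simp add: field_simps)
    define j where "j = N div n"
    have eq: "N = j * n + N mod n" by (simp add: j_def)
    have r: "real N = real j * real n + real (N mod n)" using eq by (metis of_nat_add of_nat_mult)
    have lt: "real (N mod n) \<le> real n" using n by (simp add: less_imp_le)
    have "d * real (N mod n) \<le> \<bar>d\<bar> * real n" using lt by (intro mult_mono) auto
    moreover have "d * real N = real j * (d * real n) + d * real (N mod n)"
      unfolding r by (simp add: algebra_simps)
    moreover have "t N \<ge> real j * (d * real n)" using iter[of j "N mod n"] eq by simp
    moreover have "d = c' + \<epsilon>" by (simp add: d_def \<epsilon>_def field_simps)
    then have "d * real N = c' * real N + \<epsilon> * real N" by (simp add: algebra_simps)
    ultimately show ?thesis using N by linarith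
  qed
  then show ?thesis unfolding eventually_sequentially by blast
qed

locale process_pair = P: stationary_process P + Q: stationary_process Q
  for P Q :: "(nat \<Rightarrow> 'a::finite) measure" +
  assumes supp_words_sub: "\<And>a. word_prob Q a > 0 \<Longrightarrow> word_prob P a > 0"
    and UD_P: "\<And>\<epsilon>. \<epsilon> > 0 \<Longrightarrow> \<exists>C\<ge>0. \<forall>a b.
      word_prob P (a @ b) \<le> exp (\<epsilon> * real (length a) + C) * word_prob P a * word_prob P b"
begin

abbreviation p where "p \<equiv> word_prob P"
abbreviation q where "q \<equiv> word_prob Q"

sublocale PQ: pair_prob_space P Q ..

lemma space_PQ [simp]: "space (P \<Otimes>\<^sub>M Q) = UNIV"
  by (simp add: space_pair_measure)

lemma measure_Times:
  assumes "A \<in> sets P" "B \<in> sets Q"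
  shows "PQ.prob (A \<times> B) = P.prob A * Q.prob B"
  using assms by (simp add: measure_def Q.emeasure_pair_measure_Times enn2real_mult)

lemma AE_fst: "AE x in P. \<phi> x \<Longrightarrow> AE z in P \<Otimes>\<^sub>M Q. \<phi> (fst z)"
proof -
  assume "AE x in P. \<phi> x"
  then obtain N where N: "N \<in> null_sets P" "{x \<in> space P. \<not> \<phi> x} \<subseteq> N"
    by (auto simp: eventually_ae_filter)
  have "N \<times> space Q \<in> null_sets (P \<Otimes>\<^sub>M Q)"
    using N(1) Q.emeasure_pair_measure_Times[of N P "space Q"] sets.top[of Q] null_setsD1[OF N(1)] null_setsD2[OF N(1)]
    by (intro null_setsI pair_measureI sets.top) auto
  then show ?thesis by (rule AE_I') (use N in auto)
qed

lemma AE_snd: "AE y in Q. \<phi> y \<Longrightarrow> AE z in P \<Otimes>\<^sub>M Q. \<phi> (snd z)"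
proof -
  assume "AE y in Q. \<phi> y"
  then obtain N where N: "N \<in> null_sets Q" "{y \<in> space Q. \<not> \<phi> y} \<subseteq> N"
    by (auto simp: eventually_ae_filter)
  have "space P \<times> N \<in> null_sets (P \<Otimes>\<^sub>M Q)"
    using N(1) Q.emeasure_pair_measure_Times[of "space P" P N] sets.top[of P] null_setsD1[OF N(1)] null_setsD2[OF N(1)]
    by (intro null_setsI pair_measureI sets.top) auto
  then show ?thesis by (rule AE_I') (use N in auto)
qed

lemma pair_event_decomp:
  "{z. R (initial_word N (fst z)) (initial_word N (snd z))}
    = (\<Union>u\<in>words N. cylinder u \<times> {y. R u (initial_word N y)})"
  by (auto simp: cylinder_def)

lemma sets_pair_event: "{z. R (initial_word N (fst z)) (initial_word N (snd z))} \<in> sets (P \<Otimes>\<^sub>M Q)"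
  unfolding pair_event_decomp by (intro sets.finite_UN pair_measureI Q.sets_initial_word) simp_all

lemma prob_pair_event_le:
  assumes "\<And>u. u \<in> words N \<Longrightarrow> Q.prob {y. R u (initial_word N y)} \<le> \<beta>"
  shows "PQ.prob {z. R (initial_word N (fst z)) (initial_word N (snd z))} \<le> \<beta>"
proof -
  have "PQ.prob {z. R (initial_word N (fst z)) (initial_word N (snd z))}
      \<le> (\<Sum>u\<in>words N. PQ.prob (cylinder u \<times> {y. R u (initial_word N y)}))"
    unfolding pair_event_decomp
    by (intro PQ.finite_measure_subadditive_finite)
       (auto intro!: pair_measureI Q.sets_initial_word)
  also have "\<dots> = (\<Sum>u\<in>words N. p u * Q.prob {y. R u (initial_word N y)})"
    by (simp add: measure_Times Q.sets_initial_word word_prob_def)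
  also have "\<dots> \<le> (\<Sum>u\<in>words N. p u * \<beta>)"
    using assms by (intro sum_mono mult_left_mono) auto
  finally show ?thesis by (simp add: sum_distrib_right[symmetric])
qed

text \<open>With s = - \<alpha> this is the sum under the logarithm of the pressure. It may run over
  all words because \<open>0 powr s = 0\<close>.\<close>

definition pressure_sum :: "nat \<Rightarrow> real \<Rightarrow> real" where
  "pressure_sum n s = (\<Sum>a\<in>words n. p a powr s * q a)"

lemma pressure_sum_pos: "pressure_sum n s > 0"
proof -
  have "\<exists>a\<in>words n. q a > 0"
  proof (rule ccontr)
    assume "\<not> ?thesis"
    then have "(\<Sum>a\<in>words n. q a) = 0" by (intro sum.neutral) (auto simp: not_less antisym)
    then show False by simp
  qed
  then obtain a where a: "a \<in> words n" "q a > 0" by blast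
  then have "0 < p a powr s * q a" using supp_words_sub[of a] by simp
  also have "\<dots> \<le> pressure_sum n s" unfolding pressure_sum_def
    using a by (intro member_le_sum) auto
  finally show ?thesis .
qed

lemma pressure_n_eq: "pressure_n P Q n (- s) = ereal (ln (pressure_sum n s))"
proof -
  have "(\<Sum>a\<in>supp_words P n. p a powr (- (- s)) * q a) = pressure_sum n s"
    unfolding pressure_sum_def supp_words_def
    by (rule sum.mono_neutral_cong_left) (auto simp: not_less antisym)
  then show ?thesis using pressure_sum_pos[of n s] by (simp add: pressure_n_def ext_ln_def)
qed

lemma upper_pressure_less:
  assumes "upper_pressure P Q (- s) < ereal r"
  shows "\<forall>\<^sub>F n in sequentially. pressure_sum n s \<le> exp (r * real n)"
proof -
  have "\<forall>\<^sub>F n in sequentially. pressure_n P Q n (- s) / ereal (real n) < ereal r"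
    using Limsup_lessD[OF assms[unfolded upper_pressure_def]] .
  then show ?thesis using eventually_gt_at_top[of 0]
  proof eventually_elim
    case (elim n)
    then have "ln (pressure_sum n s) < r * real n"
      unfolding pressure_n_eq by (simp add: field_simps)
    then have "exp (ln (pressure_sum n s)) \<le> exp (r * real n)" by simp
    then show ?case using pressure_sum_pos[of n s] by simp
  qed
qed

text \<open>The expected number of pairs of positions showing a common word of length L is at most
  N^2 times \<open>pressure_sum L 1\<close>, which decays exponentially in L by
  nondegeneracy.\<close>

lemma no_long_common_words:
  assumes "nondegenerate P Q"
  shows "\<exists>D>0. AE z in P \<Otimes>\<^sub>M Q. \<forall>\<^sub>F N in sequentially. \<forall>a. real (length a) \<ge> D * ln (real N) \<longrightarrow>
    \<not> (sublist a (initial_word N (fst z)) \<and> sublist a (initial_word N (snd z)))"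
proof -
  obtain r where r: "upper_pressure P Q (-1) < ereal r" "ereal r < 0"
    using assms ereal_dense2 unfolding nondegenerate_def by blast
  define \<gamma> where "\<gamma> = - r"
  have \<gamma>: "\<gamma> > 0" using r by (simp add: \<gamma>_def)
  have ev: "\<forall>\<^sub>F n in sequentially. pressure_sum n 1 \<le> exp (- \<gamma> * real n)"
    using upper_pressure_less[of 1 r] r by (simp add: \<gamma>_def)
  \<comment> \<open>Makes the pressure sum at length D ln N at most N^(-4); the positions cost N^2,
    and N^(-2) is still summable.\<close>
  define D where "D = 4 / \<gamma>"
  have D: "D > 0" using \<gamma> by (simp add: D_def)
  define L where "L N = nat \<lceil>D * ln (real N)\<rceil>" for N :: nat
  have "filterlim L at_top sequentially"
    unfolding L_def using D by real_asymp
  then have evL: "\<forall>\<^sub>F N in sequentially. pressure_sum (L N) 1 \<le> exp (- \<gamma> * real (L N))"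
    using ev by (rule eventually_compose_filterlim[rotated])
  define R where "R N u v \<longleftrightarrow> (\<exists>a\<in>words (L N). sublist a u \<and> sublist a v)" for N and u v :: "'a list"
  have bound: "PQ.prob {z. R N (initial_word N (fst z)) (initial_word N (snd z))}
      \<le> real N ^ 2 * pressure_sum (L N) 1" if N: "N \<ge> 1" for N
  proof -
    have eq: "{z. R N (initial_word N (fst z)) (initial_word N (snd z))}
      = (\<Union>a\<in>words (L N). {x. sublist a (initial_word N x)} \<times> {y. sublist a (initial_word N y)})"
      by (auto simp: R_def)
    have "PQ.prob {z. R N (initial_word N (fst z)) (initial_word N (snd z))}
      \<le> (\<Sum>a\<in>words (L N). PQ.prob ({x. sublist a (initial_word N x)} \<times> {y. sublist a (initial_word N y)}))"
      unfolding eq by (intro PQ.finite_measure_subadditive_finite)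
       (auto intro!: pair_measureI Q.sets_initial_word P.sets_initial_word)
    also have "\<dots> = (\<Sum>a\<in>words (L N). P.prob {x. sublist a (initial_word N x)} * Q.prob {y. sublist a (initial_word N y)})"
      by (intro sum.cong refl measure_Times Q.sets_initial_word P.sets_initial_word)
    also have "\<dots> \<le> (\<Sum>a\<in>words (L N). (real N * p a) * (real N * q a))"
      by (intro sum_mono mult_mono P.prob_sublist_le Q.prob_sublist_le N) auto
    also have "\<dots> = real N ^ 2 * pressure_sum (L N) 1"
      unfolding pressure_sum_def sum_distrib_left
      by (intro sum.cong) (auto simp: power2_eq_square)
    finally show ?thesis .
  qed
  have "AE z in P \<Otimes>\<^sub>M Q. \<forall>\<^sub>F N in sequentially. z \<notin> {z. R N (initial_word N (fst z)) (initial_word N (snd z))}"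
  proof (rule PQ.borel_cantelli_AE)
    show "\<forall>\<^sub>F N in sequentially. PQ.prob {z. R N (initial_word N (fst z)) (initial_word N (snd z))} \<le> 1 / real N ^ 2"
      using evL eventually_gt_at_top[of 0]
    proof eventually_elim
      case (elim N)
      have "\<gamma> * (D * ln (real N)) \<le> \<gamma> * real (L N)"
        unfolding L_def using \<gamma> by (intro mult_left_mono) linarith+
      then have "4 * ln (real N) \<le> \<gamma> * real (L N)" using \<gamma> by (simp add: D_def)
      then have "pressure_sum (L N) 1 \<le> exp (- (4 * ln (real N)))"
        using elim(1) by (elim order_trans) simp
      also have "\<dots> = 1 / real N ^ 4" using elim(2)
        by (simp add: exp_minus exp_of_nat_mult[of 4, simplified] divide_inverse)
      finally have "real N ^ 2 * pressure_sum (L N) 1 \<le> real N ^ 2 * (1 / real N ^ 4)"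
        by (intro mult_left_mono) auto
      also have "\<dots> = 1 / real N ^ 2" using elim(2)
        by (simp add: field_simps power_add[symmetric])
      finally show ?case using bound[of N] elim(2) by linarith
    qed
    show "summable (\<lambda>N. 1 / real N ^ 2)"
      using inverse_power_summable[of 2, where 'a = real] by (simp add: divide_inverse)
  qed (rule sets_pair_event)
  then have "AE z in P \<Otimes>\<^sub>M Q. \<forall>\<^sub>F N in sequentially. \<forall>a. real (length a) \<ge> D * ln (real N) \<longrightarrow>
    \<not> (sublist a (initial_word N (fst z)) \<and> sublist a (initial_word N (snd z)))"
  proof eventually_elim
    case (elim z)
    then show ?case
    proof eventually_elim
      case (elim N)
      show ?case
      proof (intro allI impI notI)
        fix a assume a: "D * ln (real N) \<le> real (length a)"
          "sublist a (initial_word N (fst z)) \<and> sublist a (initial_word N (snd z))"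
        have "L N \<le> length a" using a(1) unfolding L_def by linarith
        then have "take (L N) a \<in> words (L N)" by simp
        moreover have "sublist (take (L N) a) (initial_word N (fst z))"
          "sublist (take (L N) a) (initial_word N (snd z))"
          using a(2) sublist_take sublist_order.order_trans by blast+
        ultimately show False using elim by (auto simp: R_def)
      qed
    qed
  qed
  with D show ?thesis by blast
qed

text \<open>Real-valued because \<open>p a = 0\<close> forces \<open>q a = 0\<close>, so the default
  value of \<open>ln 0\<close> never enters.\<close>

definition cross_sum :: "nat \<Rightarrow> real" where
  "cross_sum n = (\<Sum>a\<in>words n. q a * - ln (p a))"

lemma ln_p_nonpos: "ln (p a) \<le> 0"
  using P.p_nonneg[of a] P.p_le_1[of a] by (cases "p a = 0") (auto simp: less_le)

lemma cross_sum_nonneg: "cross_sum n \<ge> 0"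
  unfolding cross_sum_def by (intro sum_nonneg mult_nonneg_nonneg) (simp_all add: ln_p_nonpos)

lemma cross_term:
  "- (\<Sum>a | length a = n. ereal (q a) * ext_ln (p a)) / ereal (real n) = ereal (cross_sum n / real n)"
  if "n > 0"
proof -
  have "ereal (q a) * ext_ln (p a) = ereal (q a * ln (p a))" for a
    using supp_words_sub[of a] Q.p_nonneg[of a] by (cases "q a = 0") (auto simp: ext_ln_def less_le)
  then have "(\<Sum>a | length a = n. ereal (q a) * ext_ln (p a)) = ereal (- cross_sum n)"
    by (simp add: cross_sum_def sum_negf)
  then show ?thesis using that by simp
qed

lemma ln_p_append:
  assumes C: "\<And>a b. p (a @ b) \<le> exp (\<epsilon> * real (length a) + C) * p a * p b" and pos: "p (a @ b) > 0"
  shows "ln (p (a @ b)) \<le> ln (p a) + ln (p b) + \<epsilon> * real (length a) + C"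
proof -
  have "p a > 0" "p b > 0" using pos P.p_append_le1[of a b] P.p_append_le2[of a b] by linarith+
  then have "ln (exp (\<epsilon> * real (length a) + C) * p a * p b) = ln (p a) + ln (p b) + \<epsilon> * real (length a) + C"
    by (simp add: ln_mult)
  moreover have "ln (p (a @ b)) \<le> ln (exp (\<epsilon> * real (length a) + C) * p a * p b)"
    using C[of a b] pos by (subst ln_le_cancel_iff) (auto intro: less_le_trans)
  ultimately show ?thesis by simp
qed

text \<open>Upper decoupling of P bounds - ln p from below along a concatenation, and stationarity
  of Q gives both parts their own means.\<close>

lemma cross_sum_superadditive:
  assumes "\<epsilon> > 0"
  shows "\<exists>C. \<forall>n m. cross_sum (n + m) \<ge> cross_sum n + cross_sum m - \<epsilon> * real n - C"
proof -
  obtain C where C: "\<And>a b. p (a @ b) \<le> exp (\<epsilon> * real (length a) + C) * p a * p b"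
    using UD_P[OF assms] by blast
  have "cross_sum (n + m) \<ge> cross_sum n + cross_sum m - \<epsilon> * real n - C" for n m
  proof -
    \<comment> \<open>The vacuous \<open>drop 0\<close> puts the first part into the window form of
      \<open>sum_factor\<close>.\<close>
    have "cross_sum (n + m) \<ge> (\<Sum>c\<in>words (n + m). q c * (- ln (p (take n (drop 0 c)))) +
        q c * (- ln (p (take m (drop n c)))) - q c * (\<epsilon> * real n + C))"
      unfolding cross_sum_def
    proof (rule sum_mono)
      fix c :: "'a list" assume c: "c \<in> words (n + m)"
      show "q c * - ln (p (take n (drop 0 c))) + q c * - ln (p (take m (drop n c))) - q c * (\<epsilon> * real n + C)
        \<le> q c * - ln (p c)"
      proof (cases "q c = 0")
        case False
        then have "q c > 0" by (simp add: less_le)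
        then have "p (take n c @ drop n c) > 0" using supp_words_sub by simp
        from ln_p_append[OF C this] c
        have "- ln (p (take n (drop 0 c))) + - ln (p (take m (drop n c))) - (\<epsilon> * real n + C) \<le> - ln (p c)"
          by simp
        then have "q c * (- ln (p (take n (drop 0 c))) + - ln (p (take m (drop n c))) - (\<epsilon> * real n + C)) \<le> q c * - ln (p c)"
          by (rule mult_left_mono) simp
        then show ?thesis by (simp add: algebra_simps)
      qed simp
    qed
    also have "(\<Sum>c\<in>words (n + m). q c * (- ln (p (take n (drop 0 c)))) +
        q c * (- ln (p (take m (drop n c)))) - q c * (\<epsilon> * real n + C)) =
        cross_sum n + cross_sum m - (\<epsilon> * real n + C)"
      unfolding sum_subtractf sum.distrib cross_sum_def
      by (subst Q.sum_factor[where g = "\<lambda>a. - ln (p a)"], simp)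
         (subst Q.sum_factor[where g = "\<lambda>a. - ln (p a)"], simp, simp add: sum_distrib_right[symmetric])
    finally show ?thesis by simp
  qed
  then show ?thesis by blast
qed

text \<open>Superadditivity turns growth at infinitely many n into growth at all large n, hence
  limsup \<le> liminf; the limit may be infinite.\<close>

lemma cross_entropy_tendsto: "(\<lambda>n. ereal (cross_sum n / real n)) \<longlonglongrightarrow> cross_entropy Q P"
proof -
  let ?h = "\<lambda>n. ereal (cross_sum n / real n)"
  have "limsup ?h \<le> liminf ?h"
  proof (rule ccontr)
    assume "\<not> ?thesis"
    then obtain c' where c': "liminf ?h < ereal c'" "ereal c' < limsup ?h"
      using ereal_dense2[of "liminf ?h" "limsup ?h"] unfolding not_le by blast
    obtain c where c: "ereal c' < ereal c" "ereal c < limsup ?h" using ereal_dense2[OF c'(2)] by auto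
    have "\<exists>\<^sub>F n in sequentially. ereal c < ?h n"
      using c(2) Limsup_bounded[of ?h "ereal c" sequentially] by (auto simp: frequently_def not_less)
    then have "\<exists>\<^sub>F n in sequentially. ereal c < ?h n \<and> n > 0"
      using eventually_gt_at_top[of 0] by (rule frequently_eventually_frequently)
    then have "\<exists>\<^sub>F n in sequentially. c * real n \<le> cross_sum n"
      by (rule frequently_elim1) (auto simp: pos_less_divide_eq)
    then have "\<forall>\<^sub>F n in sequentially. c' * real n \<le> cross_sum n"
      using cross_sum_superadditive cross_sum_nonneg c(1)
      by (intro superadditive_linear_growth) auto
    then have "\<forall>\<^sub>F n in sequentially. ereal c' \<le> ?h n"
      using eventually_gt_at_top[of 0] by eventually_elim (simp add: field_simps)
    then have "ereal c' \<le> liminf ?h" by (rule Liminf_bounded)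
    with c'(1) show False by simp
  qed
  then have "?h \<longlonglongrightarrow> limsup ?h"
    using Liminf_le_Limsup[of sequentially ?h] by (subst tendsto_iff_Liminf_eq_Limsup) auto
  moreover have ev: "\<forall>\<^sub>F n in sequentially. ?h n =
      - (\<Sum>a | length a = n. ereal (q a) * ext_ln (p a)) / ereal (real n)"
    using eventually_gt_at_top[of 0] by eventually_elim (simp only: cross_term)
  ultimately have lim: "(\<lambda>n. - (\<Sum>a | length a = n. ereal (q a) * ext_ln (p a)) / ereal (real n))
      \<longlonglongrightarrow> limsup ?h"
    by (rule Lim_transform_eventually)
  then have "cross_entropy Q P = limsup ?h" unfolding cross_entropy_def by (rule limI)
  with \<open>?h \<longlonglongrightarrow> limsup ?h\<close> show ?thesis by simp
qed

lemma cross_entropy_nonneg: "0 \<le> cross_entropy Q P"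
  by (rule LIMSEQ_le_const[OF cross_entropy_tendsto]) (auto simp: cross_sum_nonneg)

text \<open>The function \<open>ln p\<close> is itself subadditive up to the decoupling error,
  nonpositive, and has mean \<open>- cross_sum n\<close>, so the ergodic lemma bounds it from
  below.\<close>

lemma entropy_upper_AE:
  assumes erg: "ergodic Q" and h: "cross_entropy Q P < ereal h"
  shows "AE y in Q. \<forall>\<^sub>F n in sequentially. - ln (p (initial_word n y)) \<le> h * real n"
proof -
  obtain h0 where h0: "cross_entropy Q P < ereal h0" "h0 < h" using ereal_dense2[OF h] by auto
  have "\<forall>\<^sub>F n in sequentially. ereal (cross_sum n / real n) < ereal h0"
    using cross_entropy_tendsto h0(1) by (rule order_tendstoD)
  then have "\<forall>\<^sub>F n in sequentially. (- h0) * real n \<le> (\<Sum>a\<in>words n. q a * ln (p a))"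
    using eventually_gt_at_top[of 0]
  proof eventually_elim
    case (elim n)
    then have "cross_sum n \<le> h0 * real n" by (simp add: field_simps)
    then show ?case by (simp add: cross_sum_def sum_negf)
  qed
  then have freq: "\<exists>\<^sub>F n in sequentially. (- h0) * real n \<le> (\<Sum>a\<in>words n. q a * ln (p a))"
    by (rule eventually_frequently[rotated]) simp
  have "AE y in Q. \<forall>\<^sub>F n in sequentially. (- h) * real n \<le> ln (p (initial_word n y))"
  proof (rule Q.subadditive_lower_AE[OF erg _ _ _ freq, where B = 0])
    fix \<epsilon> :: real assume "\<epsilon> > 0"
    then obtain C where "\<And>a b. p (a @ b) \<le> exp (\<epsilon> * real (length a) + C) * p a * p b"
      using UD_P by blast
    from ln_p_append[OF this] supp_words_sub
    show "\<exists>C. \<forall>a b. q (a @ b) > 0 \<longrightarrow> ln (p (a @ b)) \<le> ln (p a) + ln (p b) + \<epsilon> * real (length a) + C"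
      by blast
  next
    show "ln (p a) \<le> 0 * real (length a) + 0" for a by (simp add: ln_p_nonpos)
  qed (use h0 in auto)
  then show ?thesis by (simp add: minus_le_iff)
qed


text \<open>The last word of a parsing need not be new and is only bounded by 1, hence the
  \<open>butlast\<close> and the exponent \<open>length vs - 1\<close>.\<close>

lemma p_concat_le:
  assumes C: "\<And>a b. p (a @ b) \<le> exp (\<epsilon> * real (length a) + C) * p a * p b"
    and "\<epsilon> \<ge> 0" "\<beta> \<ge> 0" "\<And>v. v \<in> set (butlast vs) \<Longrightarrow> p v \<le> \<beta>"
  shows "p (concat vs) \<le> exp (\<epsilon> * real (length (concat vs))) * (exp C * \<beta>) ^ (length vs - 1)"
  using assms(4)
proof (induction vs rule: induct_list012)
  case (2 v)
  have "p v \<le> 1" by simp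
  also have "1 \<le> exp (\<epsilon> * real (length v))" using \<open>\<epsilon> \<ge> 0\<close> by simp
  finally show ?case by simp
next
  case (3 v v' vs)
  let ?r = "concat (v' # vs)"
  have IH: "p ?r \<le> exp (\<epsilon> * real (length ?r)) * (exp C * \<beta>) ^ (length (v' # vs) - 1)"
    using 3 by simp
  have "p (v @ ?r) \<le> exp (\<epsilon> * real (length v) + C) * p v * p ?r" by (rule C)
  also have "\<dots> \<le> exp (\<epsilon> * real (length v) + C) * \<beta> *
      (exp (\<epsilon> * real (length ?r)) * (exp C * \<beta>) ^ (length (v' # vs) - 1))"
    using 3(3)[of v] \<open>\<beta> \<ge> 0\<close> by (intro mult_mono IH) auto
  also have "\<dots> = exp (\<epsilon> * real (length v) + \<epsilon> * real (length ?r)) * ((exp C * \<beta>) * (exp C * \<beta>) ^ (length (v' # vs) - 1))"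
    by (simp add: exp_add)
  also have "\<dots> = exp (\<epsilon> * real (length (concat (v # v' # vs)))) * (exp C * \<beta>) ^ (length (v # v' # vs) - 1)"
    by (simp add: distrib_left)
  finally show ?case by simp
qed simp

lemma estimator_upper_AE:
  assumes sld: "selectively_lower_decoupled P" and nd: "nondegenerate P Q" and erg: "ergodic Q"
    and \<kappa>: "cross_entropy Q P < ereal \<kappa>"
  shows "AE z in P \<Otimes>\<^sub>M Q. \<forall>\<^sub>F N in sequentially. mzm_estimator N (snd z) (fst z) \<le> ereal \<kappa>"
proof -
  obtain h where h: "cross_entropy Q P < ereal h" "h < \<kappa>" using ereal_dense2[OF \<kappa>] by auto
  have h0: "h > 0" using cross_entropy_nonneg h(1) by (metis ereal_less(2) le_less_trans)
  \<comment> \<open>Chosen to make \<open>(h + \<epsilon>) / (1 - \<epsilon>) < \<kappa>\<close>;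
    the left side is the limit of the estimator evaluated at \<open>b N\<close> below.\<close>
  define \<epsilon> where "\<epsilon> = min (1 / 2) ((\<kappa> - h) / (2 * (1 + \<kappa>)))"
  have \<epsilon>: "0 < \<epsilon>" "\<epsilon> < 1" using h h0 by (auto simp: \<epsilon>_def)
  have \<epsilon>\<kappa>: "(h + \<epsilon>) / (1 - \<epsilon>) < \<kappa>"
  proof -
    have "\<epsilon> \<le> (\<kappa> - h) / (2 * (1 + \<kappa>))" by (simp add: \<epsilon>_def)
    then have "\<epsilon> * (2 * (1 + \<kappa>)) \<le> \<kappa> - h" using h h0 by (simp add: pos_le_divide_eq)
    moreover have "0 < \<epsilon> * (1 + \<kappa>)" using \<epsilon> h h0 by simp
    ultimately have "h + \<epsilon> < \<kappa> * (1 - \<epsilon>)" by (simp add: algebra_simps)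
    then show ?thesis using \<epsilon> by (simp add: pos_divide_less_eq)
  qed
  obtain C where C: "C \<ge> 0" "\<And>a b. p (a @ b) \<le> exp (\<epsilon> * real (length a) + C) * p a * p b"
    using UD_P[OF \<epsilon>(1)] by blast
  obtain D where D: "D > 0" and no_match: "AE z in P \<Otimes>\<^sub>M Q. \<forall>\<^sub>F N in sequentially. \<forall>a.
      real (length a) \<ge> D * ln (real N) \<longrightarrow>
      \<not> (sublist a (initial_word N (fst z)) \<and> sublist a (initial_word N (snd z)))"
    using no_long_common_words[OF nd] by blast
  \<comment> \<open>Absence of long common words controls a parsed word only without its last
    letter; the additional ln N covers that letter.\<close>
  have appear: "AE z in P \<Otimes>\<^sub>M Q. \<forall>\<^sub>F N in sequentially. \<forall>w. w \<noteq> [] \<longrightarrow>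
      real (length w) \<le> (D + 1) * ln (real N) \<longrightarrow> p w \<ge> real N powr (\<epsilon> - 1) \<longrightarrow>
      sublist w (initial_word N (fst z))"
    using D by (intro AE_fst P.likely_words_appear sld \<epsilon>) auto
  have entropy: "AE z in P \<Otimes>\<^sub>M Q. \<forall>\<^sub>F n in sequentially. - ln (p (initial_word n (snd z))) \<le> h * real n"
    by (intro AE_snd entropy_upper_AE erg h)
  have pos: "AE z in P \<Otimes>\<^sub>M Q. \<forall>n i. q (initial_word n (\<lambda>k. snd z (k + i))) > 0"
    by (intro AE_snd Q.AE_p_pos)
  \<comment> \<open>The largest c allowed by \<open>(c - 1) * ((1 - \<epsilon>) * ln N - C) \<le> (h
    + \<epsilon>) * N\<close>, which results from comparing the entropy bound with the product bound
    on \<open>p y\<close>.\<close>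
  define b where "b N = (h + \<epsilon>) * real N / ((1 - \<epsilon>) * ln (real N) - C) + 1" for N :: nat
  have "(\<lambda>N. b N * ln (real N) / (real N - b N)) \<longlonglongrightarrow> (h + \<epsilon>) / (1 - \<epsilon>)"
  proof -
    have "1 - \<epsilon> > 0" "h + \<epsilon> > 0" using \<epsilon> h0 by auto
    then have "((\<lambda>N::nat. (x * real N / (g * ln (real N) - C) + 1) * ln (real N) /
        (real N - (x * real N / (g * ln (real N) - C) + 1))) \<longlongrightarrow> x / g) sequentially"
      if "g = 1 - \<epsilon>" "x = h + \<epsilon>" for g x
      using that unfolding divide_inverse[of x g] by real_asymp
    then show ?thesis unfolding b_def by blast
  qed
  then have ev1: "\<forall>\<^sub>F N in sequentially. b N * ln (real N) / (real N - b N) < \<kappa>"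
    using \<epsilon>\<kappa> by (rule order_tendstoD)
  have ev2: "\<forall>\<^sub>F N in sequentially. b N < real N"
    unfolding b_def using \<epsilon> h0 by real_asymp
  have ev3: "\<forall>\<^sub>F N::nat in sequentially. (1 - \<epsilon>) * ln (real N) - C > 0"
    using \<epsilon> by real_asymp
  have ev4: "\<forall>\<^sub>F N::nat in sequentially. ln (real N) \<ge> 1"
    by real_asymp
  show ?thesis
    using no_match appear entropy pos
  proof eventually_elim
    case (elim z)
    note qpos = elim(4)
    show ?case
      using elim(1-3) ev1 ev2 ev3 ev4 eventually_gt_at_top[of 1]
    proof eventually_elim
      case (elim N)
      define x where "x = initial_word N (fst z)"
      define y where "y = initial_word N (snd z)"
      define ws where "ws = mzm_parsing x y"
      define c where "c = length ws"
      have c: "mzm_count N (snd z) (fst z) = c" by (simp add: mzm_count_def c_def ws_def x_def y_def)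
      have c1: "c \<ge> 1" using mzm_count_pos[of N "snd z" "fst z"] elim(8) unfolding c by simp
      have small: "p v \<le> real N powr (\<epsilon> - 1)" if v: "v \<in> set (butlast ws)" for v
      proof -
        have v': "v \<in> set ws" using v by (rule in_set_butlastD)
        then have ne: "v \<noteq> []" and sx: "sublist (butlast v) x"
          using mzm_parsing_word unfolding ws_def by blast+
        obtain vs vs' where "ws = vs @ v # vs'" using split_list[OF v'] by blast
        then have "sublist v (concat ws)"
          using sublist_appendI[of v "concat vs" "concat vs'"] by simp
        then have "sublist v y" by (simp add: ws_def)
        then have "sublist (butlast v) y" using sublist_butlast sublist_order.order_trans by blast
        then have "real (length (butlast v)) < D * ln (real N)"
          using elim(1) sx unfolding x_def y_def by (meson not_le)
        then have "real (length v) \<le> (D + 1) * ln (real N)"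
          using elim(7) by (simp add: algebra_simps)
        moreover have "\<not> sublist v x" using mzm_parsing_fresh v unfolding ws_def by blast
        ultimately show ?thesis using elim(2) ne unfolding x_def by (meson not_le less_imp_le)
      qed
      have "p y \<le> exp (\<epsilon> * real N) * (exp C * real N powr (\<epsilon> - 1)) ^ (c - 1)"
        using p_concat_le[where vs = ws, OF C(2) less_imp_le[OF \<epsilon>(1)] powr_ge_zero small]
        by (simp add: c_def ws_def y_def)
      also have "\<dots> = exp (\<epsilon> * real N + real (c - 1) * (C + (\<epsilon> - 1) * ln (real N)))"
        using elim(8) by (simp add: powr_def exp_add exp_of_nat_mult)
      finally have "p y \<le> exp (\<epsilon> * real N + real (c - 1) * (C + (\<epsilon> - 1) * ln (real N)))" .
      moreover have "p y > 0"
        using qpos[rule_format, of N 0] supp_words_sub unfolding y_def by simp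
      ultimately have "ln (p y) \<le> \<epsilon> * real N + real (c - 1) * (C + (\<epsilon> - 1) * ln (real N))"
        by (metis ln_exp ln_le_cancel_iff exp_gt_zero)
      then have "real (c - 1) * ((1 - \<epsilon>) * ln (real N) - C) \<le> (h + \<epsilon>) * real N"
        using elim(3) unfolding y_def by (simp add: algebra_simps)
      then have "real (c - 1) \<le> (h + \<epsilon>) * real N / ((1 - \<epsilon>) * ln (real N) - C)"
        using elim(6) by (simp add: pos_le_divide_eq)
      then have cb: "real c \<le> b N" using c1 by (simp add: b_def of_nat_diff)
      then have "real c < real N" using elim(5) by linarith
      \<comment> \<open>The quotient c ln N / (N - c) increases with c as long as c < N.\<close>
      moreover have "real c * ln (real N) / (real N - real c) \<le> b N * ln (real N) / (real N - b N)"
        using cb elim(5,7) by (intro frac_le mult_right_mono mult_nonneg_nonneg) auto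
      ultimately show ?case using elim(4) by (simp add: mzm_estimator_def c)
    qed
  qed
qed

end

subsection \<open>The lower bound\<close>

lemma finite_sublists [simp]: "finite {a. sublist a u}"
  using set_sublists_eq[of u] by (metis List.finite_set)

lemma sum_lists_prod:
  fixes f :: "'b \<Rightarrow> real"
  assumes "finite W"
  shows "(\<Sum>ws | set ws \<subseteq> W \<and> length ws = c. prod_list (map f ws)) = (\<Sum>w\<in>W. f w) ^ c"
proof (induction c)
  case 0
  have "{ws. set ws \<subseteq> W \<and> length ws = 0} = {[]}" by auto
  then show ?case by simp
next
  case (Suc c)
  have "(\<Sum>ws | set ws \<subseteq> W \<and> length ws = Suc c. prod_list (map f ws))
      = (\<Sum>(w, ws)\<in>W \<times> {ws. set ws \<subseteq> W \<and> length ws = c}. f w * prod_list (map f ws))"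
    by (rule sum.reindex_bij_witness[of _ "\<lambda>(w, ws). w # ws" "\<lambda>ws. (hd ws, tl ws)"])
       (auto simp: length_Suc_conv)
  also have "\<dots> = (\<Sum>w\<in>W. f w) * (\<Sum>w\<in>W. f w) ^ c"
    by (simp add: sum.cartesian_product[symmetric] sum_distrib_left[symmetric] Suc
        sum_distrib_right[symmetric])
  finally show ?case by simp
qed

lemma dyadic_between:
  assumes "N \<ge> 1"
  shows "\<exists>j. N \<le> 2 ^ j \<and> 2 ^ j \<le> 2 * (N::nat)"
  using assms
proof (induction N rule: dec_induct)
  case base
  show ?case by (intro exI[of _ 0]) simp
next
  case (step N)
  then obtain j where j: "N \<le> 2 ^ j" "2 ^ j \<le> 2 * N" by blast
  show ?case
  proof (cases "Suc N \<le> 2 ^ j")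
    case True
    with j show ?thesis by (intro exI[of _ j]) auto
  next
    case False
    with j have "2 ^ j = N" by simp
    with step show ?thesis by (intro exI[of _ "Suc j"]) auto
  qed
qed

context process_pair
begin

text \<open>Words occurring in \<open>u\<close>, weighted by Q with an exponential tilt in the
  length. In its use \<rho> is negative, so long matches are weighted up.\<close>

definition match_weight :: "real \<Rightarrow> 'a list \<Rightarrow> real" where
  "match_weight \<rho> u = (\<Sum>a | sublist a u. q a * exp (- \<rho> * real (length a)))"

lemma match_weight_nonneg: "match_weight \<rho> u \<ge> 0"
  unfolding match_weight_def by (intro sum_nonneg) auto

lemma match_weight_mono: "sublist u v \<Longrightarrow> match_weight \<rho> u \<le> match_weight \<rho> v"
  unfolding match_weight_def
  by (intro sum_mono2) (auto intro: sublist_order.order_trans)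

lemma pressure_sum_bound:
  assumes "upper_pressure P Q (- s) < ereal r"
  shows "\<exists>K>0. \<forall>n. pressure_sum n s \<le> K * exp (r * real n)"
proof -
  obtain n0 where n0: "\<And>n. n \<ge> n0 \<Longrightarrow> pressure_sum n s \<le> exp (r * real n)"
    using upper_pressure_less[OF assms] by (auto simp: eventually_sequentially)
  define K where "K = 1 + (\<Sum>n<n0. pressure_sum n s * exp (- (r * real n)))"
  have nn: "0 \<le> pressure_sum n s * exp (- (r * real n))" for n
    using pressure_sum_pos[of n s] by simp
  then have K: "K \<ge> 1" unfolding K_def by (simp add: sum_nonneg)
  have "pressure_sum n s \<le> K * exp (r * real n)" for n
  proof (cases "n < n0")
    case True
    then have "pressure_sum n s * exp (- (r * real n)) \<le> (\<Sum>n<n0. pressure_sum n s * exp (- (r * real n)))"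
      using nn by (intro member_le_sum) auto
    then have "pressure_sum n s * exp (- (r * real n)) * exp (r * real n) \<le> K * exp (r * real n)"
      by (intro mult_right_mono) (auto simp: K_def)
    then show ?thesis by (simp add: mult.assoc exp_add[symmetric])
  next
    case False
    then have "pressure_sum n s \<le> 1 * exp (r * real n)" using n0 by simp
    also have "\<dots> \<le> K * exp (r * real n)" using K by (intro mult_right_mono) auto
    finally show ?thesis .
  qed
  with K show ?thesis by (intro exI[of _ K]) auto
qed

text \<open>The exponent \<open>s\<close> enters through \<open>min 1 (N p) \<le> (N p)\<^sup>s\<close>, a bound for the probability that
  a word of probability \<open>p\<close> occurs in \<open>x\<^sub>1\<dots>x\<^sub>N\<close>.\<close>

lemma mean_match_weight_le:
  assumes s: "0 < s" "s \<le> 1" and r: "upper_pressure P Q (- s) < ereal r" and \<rho>: "r < \<rho>"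
  shows "\<exists>K>0. \<forall>N\<ge>1. (\<Sum>u\<in>words N. p u * match_weight \<rho> u) \<le> K * real N powr s"
proof -
  obtain K where K: "K > 0" "\<And>n. pressure_sum n s \<le> K * exp (r * real n)"
    using pressure_sum_bound[OF r] by blast
  \<comment> \<open>The strict inequality \<open>r < \<rho>\<close> leaves a convergent geometric
    series over the word lengths.\<close>
  define x where "x = exp (r - \<rho>)"
  have x: "0 < x" "x < 1" using \<rho> by (auto simp: x_def)
  have "(\<Sum>u\<in>words N. p u * match_weight \<rho> u) \<le> K / (1 - x) * real N powr s" if N: "N \<ge> 1" for N
  proof -
    have mw: "match_weight \<rho> u = (\<Sum>n\<le>N. \<Sum>a\<in>words n. of_bool (sublist a u) * (q a * exp (- \<rho> * real n)))"
      if u: "u \<in> words N" for u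
    proof -
      have "(\<Sum>n\<le>N. \<Sum>a\<in>words n. of_bool (sublist a u) * (q a * exp (- \<rho> * real n)))
          = (\<Sum>n\<le>N. \<Sum>a\<in>words n. of_bool (sublist a u) * (q a * exp (- \<rho> * real (length a))))"
        by (intro sum.cong) auto
      also have "\<dots> = (\<Sum>a\<in>(\<Union>n\<le>N. words n). of_bool (sublist a u) * (q a * exp (- \<rho> * real (length a))))"
        by (rule sum.UNION_disjoint[symmetric]) auto
      also have "\<dots> = match_weight \<rho> u"
        unfolding match_weight_def
        using u by (intro sum.mono_neutral_cong_right) (auto dest: sublist_length_le)
      finally show ?thesis ..
    qed
    have occ: "(\<Sum>u\<in>words N. p u * of_bool (sublist a u)) \<le> real N powr s * p a powr s" for a
    proof -
      have "(\<Sum>u\<in>words N. p u * of_bool (sublist a u)) = P.prob {x. sublist a (initial_word N x)}"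
        unfolding P.prob_initial_word[of "sublist a"]
        by (rule sum.mono_neutral_cong_right) auto
      also have "\<dots> \<le> P.prob {x. sublist a (initial_word N x)} powr s"
      proof (cases "P.prob {x. sublist a (initial_word N x)} = 0")
        case False
        then have "P.prob {x. sublist a (initial_word N x)} > 0" by (simp add: less_le)
        then show ?thesis
          using powr_mono'[of s 1 "P.prob {x. sublist a (initial_word N x)}"] s by simp
      qed simp
      also have "\<dots> \<le> (real N * p a) powr s"
        using s P.prob_sublist_le[OF N] by (intro powr_mono2) auto
      finally show ?thesis by (simp add: powr_mult)
    qed
    have geo: "(\<Sum>n\<le>N. pressure_sum n s * exp (- \<rho> * real n)) \<le> K * (1 / (1 - x))"
    proof -
      have "(\<Sum>n\<le>N. pressure_sum n s * exp (- \<rho> * real n)) \<le> (\<Sum>n\<le>N. K * x ^ n)"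
      proof (rule sum_mono)
        fix n
        have "pressure_sum n s * exp (- \<rho> * real n) \<le> K * exp (r * real n) * exp (- \<rho> * real n)"
          by (intro mult_right_mono K) auto
        also have "\<dots> = K * x ^ n"
          by (simp add: x_def mult.assoc exp_add[symmetric] exp_of_nat_mult[symmetric] algebra_simps)
        finally show "pressure_sum n s * exp (- \<rho> * real n) \<le> K * x ^ n" .
      qed
      also have "(\<Sum>n\<le>N. K * x ^ n) \<le> K * (1 / (1 - x))"
      proof -
        have "(\<Sum>n\<le>N. x ^ n) \<le> (\<Sum>n. x ^ n)"
          using x by (intro sum_le_suminf summable_geometric) auto
        also have "\<dots> = 1 / (1 - x)" using x by (intro suminf_geometric) auto
        finally show ?thesis
          unfolding sum_distrib_left[symmetric] using K(1) by (intro mult_left_mono) auto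
      qed
      finally show ?thesis .
    qed
    have "(\<Sum>u\<in>words N. p u * match_weight \<rho> u)
        = (\<Sum>u\<in>words N. \<Sum>n\<le>N. \<Sum>a\<in>words n. (p u * of_bool (sublist a u)) * (q a * exp (- \<rho> * real n)))"
      by (intro sum.cong refl) (simp only: mw sum_distrib_left mult.assoc)
    also have "\<dots> = (\<Sum>n\<le>N. \<Sum>a\<in>words n. \<Sum>u\<in>words N. (p u * of_bool (sublist a u)) * (q a * exp (- \<rho> * real n)))"
      by (subst sum.swap, rule sum.cong[OF refl], rule sum.swap)
    also have "\<dots> = (\<Sum>n\<le>N. \<Sum>a\<in>words n. (\<Sum>u\<in>words N. p u * of_bool (sublist a u)) * (q a * exp (- \<rho> * real n)))"
      by (simp only: sum_distrib_right)
    also have "\<dots> \<le> (\<Sum>n\<le>N. \<Sum>a\<in>words n. (real N powr s * p a powr s) * (q a * exp (- \<rho> * real n)))"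
      by (intro sum_mono mult_right_mono occ) auto
    also have "\<dots> = real N powr s * (\<Sum>n\<le>N. pressure_sum n s * exp (- \<rho> * real n))"
      unfolding pressure_sum_def sum_distrib_left sum_distrib_right
      by (intro sum.cong refl) simp
    also have "\<dots> \<le> real N powr s * (K * (1 / (1 - x)))"
      by (intro mult_left_mono geo) auto
    finally show ?thesis by (simp add: mult.commute)
  qed
  moreover have "K / (1 - x) > 0" using K x by simp
  ultimately show ?thesis by blast
qed

text \<open>Markov's inequality only gives failure probabilities of order \<open>N powr - \<delta>\<close>, summable along
  powers of two; monotonicity of the weight fills in the remaining lengths.\<close>

lemma match_weight_AE:
  assumes s: "0 < s" "s \<le> 1" and r: "upper_pressure P Q (- s) < ereal r" and \<rho>: "r < \<rho>" and \<delta>: "\<delta> > 0"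
  shows "AE x in P. \<forall>\<^sub>F N in sequentially. match_weight \<rho> (initial_word N x) \<le> (2 * real N) powr (s + \<delta>)"
proof -
  obtain K where K: "K > 0" "\<And>N. N \<ge> 1 \<Longrightarrow> (\<Sum>u\<in>words N. p u * match_weight \<rho> u) \<le> K * real N powr s"
    using mean_match_weight_le[OF s r \<rho>] by blast
  define A where "A j = {x. match_weight \<rho> (initial_word (2 ^ j) x) > real (2 ^ j) powr (s + \<delta>)}" for j :: nat
  have "AE x in P. \<forall>\<^sub>F j in sequentially. x \<notin> A j"
  proof (rule P.borel_cantelli_AE)
    show "A j \<in> sets P" for j unfolding A_def by (rule P.sets_initial_word)
    show "summable (\<lambda>j. K * (2 powr (- \<delta>)) ^ j)"
    proof (intro summable_mult summable_geometric)
      have "2 powr (- \<delta>) < (2::real) powr 0" using \<delta> by (intro powr_less_mono) auto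
      then show "norm (2 powr (- \<delta>) :: real) < 1" by simp
    qed
    have "P.prob (A j) \<le> K * (2 powr (- \<delta>)) ^ j" for j
    proof -
      define N where "N = (2::nat) ^ j"
      define t where "t = real N powr (s + \<delta>)"
      have N: "N \<ge> 1" by (simp add: N_def)
      have t: "t > 0" using N by (simp add: t_def)
      have "P.prob (A j) = (\<Sum>u | length u = N \<and> match_weight \<rho> u > t. p u)"
        unfolding A_def N_def t_def by (rule P.prob_initial_word)
      also have "\<dots> \<le> (\<Sum>u | length u = N \<and> match_weight \<rho> u > t. p u * match_weight \<rho> u / t)"
      proof (rule sum_mono)
        fix u assume "u \<in> {u. length u = N \<and> match_weight \<rho> u > t}"
        then have "p u * t \<le> p u * match_weight \<rho> u" by (intro mult_left_mono) auto
        then show "p u \<le> p u * match_weight \<rho> u / t" using t by (simp add: pos_le_divide_eq)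
      qed
      also have "\<dots> \<le> (\<Sum>u\<in>words N. p u * match_weight \<rho> u / t)"
        using t match_weight_nonneg by (intro sum_mono2) auto
      also have "\<dots> \<le> K * real N powr s / t"
        unfolding sum_divide_distrib[symmetric] using t K(2)[OF N] by (intro divide_right_mono) auto
      also have "\<dots> = K * real N powr (- \<delta>)"
        using N by (simp add: t_def powr_add powr_minus divide_inverse)
      also have "real N powr (- \<delta>) = (2 powr (- \<delta>)) ^ j"
        by (simp add: N_def powr_realpow[symmetric] powr_powr mult.commute)
      finally show ?thesis .
    qed
    then show "\<forall>\<^sub>F j in sequentially. P.prob (A j) \<le> K * (2 powr (- \<delta>)) ^ j" by simp
  qed
  then show ?thesis
  proof eventually_elim
    case (elim x)
    then obtain j0 where j0: "\<And>j. j \<ge> j0 \<Longrightarrow> x \<notin> A j" by (auto simp: eventually_sequentially)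
    \<comment> \<open>The factor 2 comes from comparing with a power of two between N and 2
      N.\<close>
    have "match_weight \<rho> (initial_word N x) \<le> (2 * real N) powr (s + \<delta>)" if N: "N > 2 ^ j0" for N
    proof -
      have "N \<ge> 1" using N by simp
      then obtain j where j: "N \<le> 2 ^ j" "2 ^ j \<le> 2 * N" using dyadic_between by blast
      have "(2::nat) ^ j0 < 2 ^ j" using N j(1) by (rule less_le_trans)
      then have "j0 < j" by simp
      have "sublist (initial_word N x) (initial_word (2 ^ j) x)"
        using take_initial_word_le[OF j(1), of x] sublist_take by metis
      then have "match_weight \<rho> (initial_word N x) \<le> match_weight \<rho> (initial_word (2 ^ j) x)"
        by (rule match_weight_mono)
      also have "\<dots> \<le> real (2 ^ j) powr (s + \<delta>)"
        using j0[of j] \<open>j0 < j\<close> by (simp add: A_def not_less)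
      also have "\<dots> \<le> (2 * real N) powr (s + \<delta>)"
      proof (intro powr_mono2)
        have "real (2 ^ j) \<le> real (2 * N)" using j(2) by (simp only: of_nat_le_iff)
        then show "real (2 ^ j) \<le> 2 * real N" by simp
      qed (use s \<delta> in auto)
      finally show ?thesis .
    qed
    then show ?case unfolding eventually_sequentially by (metis less_eq_Suc_le)
  qed
qed

text \<open>Split \<open>w\<close> into a start, a gap of \<tau> letters and one last letter: the
  gap is spent on decoupling, the last letter is dropped by monotonicity. For shorter
  \<open>w\<close> truncated subtraction makes the start empty and the bound trivial.\<close>

lemma UD_Q_gap:
  assumes ud: "upper_decoupled_with \<tau> k Q" and \<epsilon>: "\<epsilon> > 0"
  shows "\<exists>C\<ge>0. \<forall>w b. q (w @ b) \<le>
    exp (\<epsilon> * real (length w - Suc \<tau>) + C) * q (take (length w - Suc \<tau>) w) * q b"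
proof -
  obtain C where C: "C \<ge> 0" "\<And>a \<xi> b. length \<xi> = \<tau> \<Longrightarrow>
      q (a @ \<xi> @ b) \<le> exp (\<epsilon> * real (length a) + C) * q a * q b"
    using Q.upper_decoupled_linear[OF ud \<epsilon>] by blast
  have "q (w @ b) \<le> exp (\<epsilon> * real (length w - Suc \<tau>) + C) * q (take (length w - Suc \<tau>) w) * q b" for w b
  proof (cases "length w \<ge> Suc \<tau>")
    case True
    define a where "a = take (length w - Suc \<tau>) w"
    define \<xi> where "\<xi> = take \<tau> (drop (length w - Suc \<tau>) w)"
    define e where "e = drop \<tau> (drop (length w - Suc \<tau>) w)"
    have w: "w = a @ \<xi> @ e" unfolding a_def \<xi>_def e_def by (simp only: append_take_drop_id)
    have len: "length \<xi> = \<tau>" "length a = length w - Suc \<tau>" using True by (auto simp: \<xi>_def a_def)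
    have "q (w @ b) \<le> exp (\<epsilon> * real (length a) + C) * q a * q (e @ b)"
      using C(2)[OF len(1), of a "e @ b"] w by simp
    also have "\<dots> \<le> exp (\<epsilon> * real (length a) + C) * q a * q b"
      by (intro mult_left_mono Q.p_append_le2) auto
    finally show ?thesis unfolding len a_def[symmetric] .
  next
    case False
    then have "q (w @ b) \<le> 1 * q b" using Q.p_append_le2[of w b] by simp
    also have "\<dots> \<le> exp C * q b" using C(1) by (intro mult_right_mono) auto
    finally show ?thesis using False by simp
  qed
  with C(1) show ?thesis by blast
qed

text \<open>Every parsed word is a word occurring in \<open>u\<close> followed by at most \<open>\<tau> + 1\<close> further letters:
  the gap needed for decoupling together with the letter that made it new.\<close>

lemma prob_few_words_le:
  assumes ud: "upper_decoupled_with \<tau> k Q" and \<epsilon>: "\<epsilon> > 0"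
  shows "\<exists>K\<ge>1. \<forall>N u m. u \<in> words N \<longrightarrow>
     Q.prob {y. length (mzm_parsing u (initial_word N y)) \<le> m}
       \<le> exp ((\<rho> + \<epsilon>) * real N) * (\<Sum>c\<le>m. (K * match_weight \<rho> u) ^ c)"
proof -
  obtain C where C: "C \<ge> 0" "\<And>w b. q (w @ b) \<le>
      exp (\<epsilon> * real (length w - Suc \<tau>) + C) * q (take (length w - Suc \<tau>) w) * q b"
    using UD_Q_gap[OF ud \<epsilon>] by blast
  \<comment> \<open>The \<epsilon> pays for the decoupling error over the core, so tilting a whole
    word by \<sigma> leaves the tilt \<rho> on its core.\<close>
  define \<sigma> where "\<sigma> = \<rho> + \<epsilon>"
  define core where "core w = take (length w - Suc \<tau>) w" for w :: "'a list"
  define g where "g w = exp (\<epsilon> * real (length (core w)) + C) * q (core w)" for w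
  define f where "f w = g w * exp (- \<sigma> * real (length w))" for w
  define T :: "'a list set" where "T = {t. length t \<le> Suc \<tau>}"
  \<comment> \<open>Covers the tilt of up to \<open>Suc \<tau>\<close> discarded letters for either
    sign of \<sigma>.\<close>
  define E where "E = exp (C + \<bar>\<sigma>\<bar> * real (Suc \<tau>))"
  define K where "K = real (card T) * E"
  have len_core: "length (core w) = length w - Suc \<tau>" for w by (simp add: core_def)
  have finT: "finite T"
    unfolding T_def using finite_lists_length_le[of "UNIV :: 'a set" "Suc \<tau>"] by simp
  have K1: "K \<ge> 1"
  proof -
    have "[] \<in> T" by (simp add: T_def)
    then have "card T \<ge> 1" using finT by (metis card_0_eq empty_iff less_one linorder_not_le)
    then have "1 * 1 \<le> real (card T) * E"
      using C(1) by (intro mult_mono) (auto simp: E_def)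
    then show ?thesis by (simp add: K_def)
  qed
  have g_nonneg: "0 \<le> g w" for w by (simp add: g_def)
  have q_concat: "q (concat ws) \<le> prod_list (map g ws)" for ws
  proof (induction ws)
    case (Cons w ws)
    have "q (w @ concat ws) \<le> g w * q (concat ws)"
      using C(2)[of w "concat ws"] unfolding g_def len_core unfolding core_def .
    also have "\<dots> \<le> g w * prod_list (map g ws)" by (intro mult_left_mono Cons g_nonneg)
    finally show ?case by simp
  qed simp
  have f_prod: "prod_list (map f ws) = prod_list (map g ws) * exp (- \<sigma> * real (length (concat ws)))" for ws
    by (induction ws) (auto simp: f_def exp_add[symmetric] algebra_simps simp flip: exp_add)
  have f_nonneg: "0 \<le> f w" for w by (simp add: f_def g_nonneg)
  have f_le: "f w \<le> E * (q (core w) * exp (- \<rho> * real (length (core w))))" for w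
  proof -
    have le: "length (core w) \<le> length w" "length w - length (core w) \<le> Suc \<tau>" by (auto simp: core_def)
    define d where "d = real (length w) - real (length (core w))"
    have d: "0 \<le> d" "d \<le> real (Suc \<tau>)" using le by (auto simp: d_def simp flip: of_nat_diff)
    have "- \<sigma> * d \<le> \<bar>\<sigma>\<bar> * real (Suc \<tau>)"
      using d by (intro mult_mono) auto
    then have "\<epsilon> * real (length (core w)) + C - \<sigma> * real (length w)
        \<le> C + \<bar>\<sigma>\<bar> * real (Suc \<tau>) - \<rho> * real (length (core w))"
      by (simp add: d_def \<sigma>_def algebra_simps)
    then have "exp (\<epsilon> * real (length (core w)) + C - \<sigma> * real (length w)) * q (core w)
        \<le> exp (C + \<bar>\<sigma>\<bar> * real (Suc \<tau>) - \<rho> * real (length (core w))) * q (core w)"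
      by (intro mult_right_mono) auto
    then show ?thesis by (simp add: f_def g_def E_def exp_diff exp_add exp_minus field_simps)
  qed
  have main: "Q.prob {y. length (mzm_parsing u (initial_word N y)) \<le> m}
       \<le> exp (\<sigma> * real N) * (\<Sum>c\<le>m. (K * match_weight \<rho> u) ^ c)" if u: "u \<in> words N" for N u m
  proof -
    define W where "W = {w. length w \<le> N \<and> sublist (core w) u}"
    have finW: "finite W"
      using finite_lists_length_le[of "UNIV :: 'a set" N] by (auto simp: W_def intro: finite_subset[rotated])
    have sumW: "(\<Sum>w\<in>W. f w) \<le> K * match_weight \<rho> u"
    proof -
      let ?\<phi> = "\<lambda>w. (core w, drop (length w - Suc \<tau>) w)"
      let ?h = "\<lambda>a. q a * exp (- \<rho> * real (length a))"
      \<comment> \<open>A word is determined by its core and its discarded tail, and there are at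
        most \<open>card T\<close> tails.\<close>
      have inj: "inj_on ?\<phi> W"
      proof (rule inj_onI)
        fix w w' assume "?\<phi> w = ?\<phi> w'"
        then show "w = w'" unfolding core_def by (metis append_take_drop_id prod.inject)
      qed
      have "(\<Sum>w\<in>W. f w) \<le> (\<Sum>w\<in>W. E * ?h (fst (?\<phi> w)))"
        by (intro sum_mono) (use f_le in auto)
      also have "\<dots> = (\<Sum>z\<in>?\<phi> ` W. E * ?h (fst z))"
        by (simp add: sum.reindex[OF inj])
      also have "\<dots> \<le> (\<Sum>z\<in>{a. sublist a u} \<times> T. E * ?h (fst z))"
        using finT by (intro sum_mono2) (auto simp: W_def T_def E_def)
      also have "\<dots> = (\<Sum>a | sublist a u. \<Sum>t\<in>T. E * ?h a)"
        by (simp only: sum.cartesian_product split_def)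
      also have "\<dots> = K * match_weight \<rho> u"
        by (simp add: K_def match_weight_def sum_distrib_left mult.assoc)
      finally show ?thesis .
    qed
    have parse_W: "set (mzm_parsing u v) \<subseteq> W" if v: "v \<in> words N" for v
    proof
      fix w assume w: "w \<in> set (mzm_parsing u v)"
      then have ne: "w \<noteq> []" "sublist (butlast w) u" using mzm_parsing_word by blast+
      have "core w = take (length w - Suc \<tau>) (butlast w)"
        by (simp add: core_def butlast_conv_take min_def)
      then have "sublist (core w) (butlast w)" by simp
      then have "sublist (core w) u" using ne(2) sublist_order.order_trans by blast
      moreover obtain vs vs' where "mzm_parsing u v = vs @ w # vs'" using split_list[OF w] by blast
      then have "length w \<le> length (concat (mzm_parsing u v))"
        by (simp del: concat_mzm_parsing)
      ultimately show "w \<in> W" using v by (simp add: W_def)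
    qed
    let ?V = "{v. length v = N \<and> length (mzm_parsing u v) \<le> m}"
    let ?L = "\<lambda>c. {ws. set ws \<subseteq> W \<and> length ws = c}"
    \<comment> \<open>Distinct \<open>v\<close> have distinct parsings, so the sum over
      \<open>v\<close> can be enlarged to all lists of at most \<open>m\<close> words from
      \<open>W\<close>.\<close>
    have inj: "inj_on (mzm_parsing u) ?V" by (rule inj_on_inverseI[of _ concat]) simp
    have "Q.prob {y. length (mzm_parsing u (initial_word N y)) \<le> m} = (\<Sum>v\<in>?V. q v)"
      by (rule Q.prob_initial_word)
    also have "\<dots> \<le> (\<Sum>v\<in>?V. exp (\<sigma> * real N) * prod_list (map f (mzm_parsing u v)))"
    proof (rule sum_mono)
      fix v assume v: "v \<in> ?V"
      \<comment> \<open>The lengths of the parsed words add up to N, so their tilts multiply to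
        exactly the inverse of the prefactor.\<close>
      have "exp (\<sigma> * real N) * prod_list (map f (mzm_parsing u v)) = prod_list (map g (mzm_parsing u v))"
        using v by (simp add: f_prod mult.left_commute exp_add[symmetric])
      then show "q v \<le> exp (\<sigma> * real N) * prod_list (map f (mzm_parsing u v))"
        using q_concat[of "mzm_parsing u v"] by simp
    qed
    also have "\<dots> = exp (\<sigma> * real N) * (\<Sum>ws\<in>mzm_parsing u ` ?V. prod_list (map f ws))"
      by (simp add: sum.reindex[OF inj] sum_distrib_left)
    also have "(\<Sum>ws\<in>mzm_parsing u ` ?V. prod_list (map f ws)) \<le> (\<Sum>ws\<in>(\<Union>c\<le>m. ?L c). prod_list (map f ws))"
    proof (rule sum_mono2)
      show "finite (\<Union>c\<le>m. ?L c)" using finite_lists_length_eq[OF finW] by simp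
      show "mzm_parsing u ` ?V \<subseteq> (\<Union>c\<le>m. ?L c)" using parse_W by auto
      show "0 \<le> prod_list (map f ws)" for ws by (rule prod_list_nonneg) (auto simp: f_nonneg)
    qed
    also have "\<dots> = (\<Sum>c\<le>m. \<Sum>ws\<in>?L c. prod_list (map f ws))"
      using finite_lists_length_eq[OF finW] by (intro sum.UNION_disjoint) auto
    also have "\<dots> = (\<Sum>c\<le>m. (\<Sum>w\<in>W. f w) ^ c)" by (simp add: sum_lists_prod[OF finW])
    also have "\<dots> \<le> (\<Sum>c\<le>m. (K * match_weight \<rho> u) ^ c)"
      by (intro sum_mono power_mono sumW sum_nonneg f_nonneg)
    finally show ?thesis by simp
  qed
  with K1 show ?thesis unfolding \<sigma>_def by blast
qed

lemma estimator_lower_AE: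
  assumes udQ: "upper_decoupled Q" and s: "0 < s" "s \<le> 1"
    and up: "upper_pressure P Q (- s) < ereal (- \<kappa> * s)"
  shows "AE z in P \<Otimes>\<^sub>M Q. \<forall>\<^sub>F N in sequentially. ereal \<kappa> \<le> mzm_estimator N (snd z) (fst z)"
proof (cases "\<kappa> \<le> 0")
  case True
  have "ereal \<kappa> \<le> mzm_estimator N y x" if "N > 0" for N and x y :: "nat \<Rightarrow> 'a"
  proof -
    have "0 \<le> real (mzm_count N y x) * ln (real N) / (real N - real (mzm_count N y x))"
      using that mzm_count_le[of N y x] by (intro divide_nonneg_nonneg mult_nonneg_nonneg) auto
    then show ?thesis using True by (simp add: mzm_estimator_def)
  qed
  then show ?thesis by (intro AE_I2 eventually_mono[OF eventually_gt_at_top[of 0]]) blast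
next
  case False
  then have \<kappa>: "\<kappa> > 0" by simp
  obtain \<tau> k where ud: "upper_decoupled_with \<tau> k Q" using udQ by (auto simp: upper_decoupled_def)
  obtain r where r: "upper_pressure P Q (- s) < ereal r" "r < - \<kappa> * s" using ereal_dense2[OF up] by auto
  \<comment> \<open>A quarter of the slack: one share each goes to \<rho> - r, to the decoupling
    error and to \<kappa> \<delta>, and the last remains as the rate of decay.\<close>
  define e where "e = (- \<kappa> * s - r) / 4"
  have e: "e > 0" using r by (simp add: e_def)
  define \<rho> where "\<rho> = r + e"
  define \<delta> where "\<delta> = e / \<kappa>"
  have \<delta>: "\<delta> > 0" using e \<kappa> by (simp add: \<delta>_def)
  define t where "t = s + \<delta>"
  have t: "t > 0" using s \<delta> by (simp add: t_def)
  have \<rho>: "r < \<rho>" using e by (simp add: \<rho>_def)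
  have \<sigma>: "\<rho> + e = - e - \<kappa> * t"
    using \<kappa> by (simp add: \<rho>_def t_def \<delta>_def e_def field_simps)
  obtain K where K: "K \<ge> 1" "\<And>N u m. u \<in> words N \<Longrightarrow>
     Q.prob {y. length (mzm_parsing u (initial_word N y)) \<le> m}
       \<le> exp ((- e - \<kappa> * t) * real N) * (\<Sum>c\<le>m. (K * match_weight \<rho> u) ^ c)"
    using prob_few_words_le[OF ud e, of \<rho>] unfolding \<sigma> by blast
  have weight: "AE z in P \<Otimes>\<^sub>M Q. \<forall>\<^sub>F N in sequentially.
      match_weight \<rho> (initial_word N (fst z)) \<le> (2 * real N) powr t"
    unfolding t_def by (intro AE_fst match_weight_AE[OF s r(1) \<rho> \<delta>])
  \<comment> \<open>More than \<kappa> N / ln N words push the estimator above \<kappa>, since its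
    denominator is at most N.\<close>
  define m where "m N = nat \<lfloor>\<kappa> * real N / ln (real N)\<rfloor>" for N :: nat
  define R where "R N u v \<longleftrightarrow> match_weight \<rho> u \<le> (2 * real N) powr t \<and> length (mzm_parsing u v) \<le> m N"
    for N and u v :: "'a list"
  \<comment> \<open>The weights contribute \<kappa> t N + o(N), which cancels the matching part of
    the first term; \<open>ln K\<close> contributes O(N / ln N), and \<open>real N + 1\<close>
    bounds the number of values of c. Up to subexponential factors exp (- e N) remains.\<close>
  define \<beta> where "\<beta> N = exp ((- e - \<kappa> * t) * real N + \<kappa> * real N / ln (real N) * (ln K + t * ln (2 * real N)))
      * (real N + 1)" for N :: nat
  have prob_R: "PQ.prob {z. R N (initial_word N (fst z)) (initial_word N (snd z))} \<le> \<beta> N"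
    if N: "N \<ge> 2" "ln (real N) \<ge> \<kappa>" for N
  proof (rule prob_pair_event_le)
    fix u :: "'a list" assume u: "u \<in> words N"
    show "Q.prob {y. R N u (initial_word N y)} \<le> \<beta> N"
    proof (cases "match_weight \<rho> u \<le> (2 * real N) powr t")
      case False
      then show ?thesis by (simp add: R_def \<beta>_def)
    next
      case True
      define B where "B = K * (2 * real N) powr t"
      have B1: "B \<ge> 1"
      proof -
        have "1 * 1 \<le> K * (2 * real N) powr t"
          using K(1) N t by (intro mult_mono ge_one_powr_ge_zero) auto
        then show ?thesis by (simp add: B_def)
      qed
      have lnpos: "ln (real N) > 0" using N by simp
      have mle: "real (m N) \<le> \<kappa> * real N / ln (real N)"
        unfolding m_def using \<kappa> lnpos by (intro of_nat_floor) auto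
      also have "\<dots> \<le> real N" using N lnpos by (simp add: divide_le_eq mult.commute mult_left_mono)
      finally have mN: "real (m N) \<le> real N" .
      have "(\<Sum>c\<le>m N. (K * match_weight \<rho> u) ^ c) \<le> (\<Sum>c\<le>m N. B ^ m N)"
      proof (rule sum_mono)
        fix c assume "c \<in> {..m N}"
        have "K * match_weight \<rho> u \<le> B" unfolding B_def using True K(1) by (intro mult_left_mono) auto
        then have "(K * match_weight \<rho> u) ^ c \<le> B ^ c"
          using K(1) match_weight_nonneg by (intro power_mono) auto
        also have "\<dots> \<le> B ^ m N" using B1 \<open>c \<in> {..m N}\<close> by (intro power_increasing) auto
        finally show "(K * match_weight \<rho> u) ^ c \<le> B ^ m N" .
      qed
      also have "\<dots> = (real (m N) + 1) * B ^ m N" by simp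
      also have "B ^ m N = exp (real (m N) * ln B)"
        using B1 by (simp add: exp_of_nat_mult)
      also have "ln B = ln K + t * ln (2 * real N)"
        using K(1) N by (simp add: B_def ln_mult ln_powr)
      also have "(real (m N) + 1) * exp (real (m N) * (ln K + t * ln (2 * real N)))
          \<le> (real N + 1) * exp (\<kappa> * real N / ln (real N) * (ln K + t * ln (2 * real N)))"
      proof (intro mult_mono)
        have "0 \<le> ln K + t * ln (2 * real N)" using K(1) t N by (intro add_nonneg_nonneg mult_nonneg_nonneg) auto
        then show "exp (real (m N) * (ln K + t * ln (2 * real N))) \<le> exp (\<kappa> * real N / ln (real N) * (ln K + t * ln (2 * real N)))"
          using mle by (simp only: exp_le_cancel_iff mult_right_mono)
      qed (use mN in auto)
      finally have "exp ((- e - \<kappa> * t) * real N) * (\<Sum>c\<le>m N. (K * match_weight \<rho> u) ^ c) \<le> \<beta> N"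
        unfolding \<beta>_def exp_add by (simp add: mult_left_mono mult.assoc mult.commute)
      with K(2)[OF u, of "m N"] True show ?thesis by (simp add: R_def)
    qed
  qed
  have ev\<beta>: "\<forall>\<^sub>F N in sequentially. \<beta> N \<le> 1 / real N ^ 2"
    unfolding \<beta>_def using \<kappa> e t by real_asymp
  have evln: "\<forall>\<^sub>F N::nat in sequentially. ln (real N) \<ge> \<kappa>" by real_asymp
  have "AE z in P \<Otimes>\<^sub>M Q. \<forall>\<^sub>F N in sequentially. z \<notin> {z. R N (initial_word N (fst z)) (initial_word N (snd z))}"
  proof (rule PQ.borel_cantelli_AE)
    show "\<forall>\<^sub>F N in sequentially. PQ.prob {z. R N (initial_word N (fst z)) (initial_word N (snd z))} \<le> 1 / real N ^ 2"
      using ev\<beta> evln eventually_ge_at_top[of 2]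
    proof eventually_elim
      case (elim N)
      show ?case using prob_R[OF elim(3,2)] elim(1) by linarith
    qed
    show "summable (\<lambda>N. 1 / real N ^ 2)"
      using inverse_power_summable[of 2, where 'a = real] by (simp add: divide_inverse)
  qed (rule sets_pair_event)
  with weight show ?thesis
  proof eventually_elim
    case (elim z)
    then show ?case using eventually_gt_at_top[of 1]
    proof eventually_elim
      case (elim N)
      define c where "c = mzm_count N (snd z) (fst z)"
      have lnpos: "ln (real N) > 0" using elim by simp
      have "\<not> c \<le> m N" using elim by (simp add: R_def c_def mzm_count_def)
      then have "\<kappa> * real N / ln (real N) < real c" unfolding m_def by linarith
      then have big: "\<kappa> * real N < real c * ln (real N)" using lnpos by (simp add: pos_divide_less_eq)
      show ?case
      proof (cases "c = N")
        case False
        then have c: "real c < real N" using mzm_count_le[of N "snd z" "fst z"] by (simp add: c_def)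
        have "\<kappa> * (real N - real c) \<le> \<kappa> * real N" using \<kappa> by (intro mult_left_mono) auto
        then have "\<kappa> \<le> real c * ln (real N) / (real N - real c)"
          using big c by (simp add: pos_le_divide_eq)
        then show ?thesis using False by (simp add: mzm_estimator_def c_def)
      qed (simp add: mzm_estimator_def c_def)
    qed
  qed
qed

end

subsection \<open>The left derivative of the pressure\<close>

text \<open>Each event lies in the tail union from its index on, and these unions decrease to a null
  set.\<close>

lemma (in prob_space) prob_tendsto_0_of_AE:
  assumes A: "\<And>n. A n \<in> sets M" and ev: "AE x in M. \<forall>\<^sub>F n in sequentially. x \<notin> A n"
  shows "(\<lambda>n. prob (A n)) \<longlonglongrightarrow> 0"
proof -
  define B where "B m = (\<Union>n\<in>{m..}. A n)" for m
  have B: "B m \<in> sets M" for m unfolding B_def using A by (intro sets.countable_UN') auto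
  have "decseq B" by (force simp: decseq_def B_def)
  then have "(\<lambda>m. prob (B m)) \<longlonglongrightarrow> prob (\<Inter>m. B m)"
    using B by (intro finite_Lim_measure_decseq) auto
  moreover have "prob (\<Inter>m. B m) = 0"
  proof -
    have "AE x in M. x \<notin> (\<Inter>m. B m)" using ev
    proof eventually_elim
      case (elim x)
      then obtain N where "\<And>n. n \<ge> N \<Longrightarrow> x \<notin> A n" by (auto simp: eventually_sequentially)
      then have "x \<notin> B N" by (auto simp: B_def)
      then show ?case by blast
    qed
    moreover have "(\<Inter>m. B m) \<in> sets M" using B by auto
    ultimately show ?thesis using prob_eq_0 by blast
  qed
  ultimately have lim: "(\<lambda>m. prob (B m)) \<longlonglongrightarrow> 0" by simp
  have "prob (A m) \<le> prob (B m)" for m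
    using B by (intro finite_measure_mono) (auto simp: B_def)
  then show ?thesis
    by (intro tendsto_sandwich[OF _ _ tendsto_const lim]) auto
qed

lemma ereal_less_divide_neg_iff:
  assumes "s > 0"
  shows "ereal c < u / ereal (- s) \<longleftrightarrow> u < ereal (- c * s)"
    and "ereal c \<le> u / ereal (- s) \<longleftrightarrow> u \<le> ereal (- c * s)"
proof -
  have "(ereal c < u / ereal (- s) \<longleftrightarrow> u < ereal (- c * s)) \<and>
      (ereal c \<le> u / ereal (- s) \<longleftrightarrow> u \<le> ereal (- c * s))"
  proof (cases u)
    case (real r)
    have "u / ereal (- s) = ereal (r / (- s))" using real assms by simp
    moreover have "c < r / (- s) \<longleftrightarrow> r < - c * s" "c \<le> r / (- s) \<longleftrightarrow> r \<le> - c * s"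
      using assms neg_less_divide_eq[of "- s" c r] neg_le_divide_eq[of "- s" c r] by simp_all
    ultimately show ?thesis using real by (simp only: ereal_less_eq less_ereal.simps)
  qed (use assms in \<open>simp_all add: divide_ereal_def\<close>)
  then show "ereal c < u / ereal (- s) \<longleftrightarrow> u < ereal (- c * s)"
    and "ereal c \<le> u / ereal (- s) \<longleftrightarrow> u \<le> ereal (- c * s)" by blast+
qed

context process_pair
begin

lemma pressure_sum_le_1: "s \<ge> 0 \<Longrightarrow> pressure_sum n s \<le> 1"
proof -
  assume s: "s \<ge> 0"
  have "p a powr s \<le> 1" for a using powr_mono2[OF s, of "p a" 1] by simp
  then have "pressure_sum n s \<le> (\<Sum>a\<in>words n. 1 * q a)"
    unfolding pressure_sum_def by (intro sum_mono mult_right_mono) auto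
  then show ?thesis by simp
qed

text \<open>The power mean inequality for the probability weights q, by summing Young's inequality
  for \<open>p a powr s' / m\<close> and 1, where m is the mean.\<close>

lemma pressure_sum_power_mean:
  assumes s: "0 < s" "s \<le> s'"
  shows "pressure_sum n s \<le> pressure_sum n s' powr (s / s')"
proof -
  define \<theta> where "\<theta> = s / s'"
  have \<theta>: "0 < \<theta>" "\<theta> \<le> 1" using s by (auto simp: \<theta>_def)
  define m where "m = pressure_sum n s'"
  have m: "m > 0" unfolding m_def by (rule pressure_sum_pos)
  have "p a powr s * q a \<le> m powr \<theta> * (\<theta> * (p a powr s' * q a / m) + (1 - \<theta>) * q a)" for a
  proof (cases "p a = 0")
    case True
    then show ?thesis using m \<theta> s by simp
  next
    case False
    then have pa: "p a powr s' > 0" by simp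
    have "(p a powr s' / m) powr \<theta> * 1 powr (1 - \<theta>) \<le> \<theta> * (p a powr s' / m) + (1 - \<theta>) * 1"
      using \<theta> m pa by (intro Youngs_inequality_0) auto
    moreover have "(p a powr s' / m) powr \<theta> = p a powr s / m powr \<theta>"
      using s m by (simp add: powr_divide powr_powr \<theta>_def)
    ultimately have "p a powr s \<le> m powr \<theta> * (\<theta> * (p a powr s' / m) + (1 - \<theta>))"
      using m by (simp add: pos_divide_le_eq mult.commute)
    then have "p a powr s * q a \<le> m powr \<theta> * (\<theta> * (p a powr s' / m) + (1 - \<theta>)) * q a"
      by (intro mult_right_mono) auto
    then show ?thesis by (simp add: algebra_simps)
  qed
  then have "pressure_sum n s \<le> (\<Sum>a\<in>words n. m powr \<theta> * (\<theta> * (p a powr s' * q a / m) + (1 - \<theta>) * q a))"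
    unfolding pressure_sum_def by (intro sum_mono)
  also have "\<dots> = m powr \<theta> * (\<theta> * (m / m) + (1 - \<theta>))"
    by (simp only: sum_distrib_left[symmetric] sum.distrib sum_divide_distrib[symmetric]
        pressure_sum_def[symmetric] m_def[symmetric] Q.sum_p mult_1_right)
  also have "\<dots> = m powr \<theta>" using m by simp
  finally show ?thesis by (simp add: m_def \<theta>_def)
qed

text \<open>Takes the place of convexity: power means make the slope of the chord to the origin
  monotone for each n, and this survives the limsup. Comparing with a real c avoids arithmetic with
  infinite pressures.\<close>

lemma pressure_slope_mono:
  assumes s: "0 < s" "s \<le> s'"
  shows "upper_pressure P Q (- s') / ereal (- s') \<le> upper_pressure P Q (- s) / ereal (- s)"
proof (rule ccontr)
  assume "\<not> ?thesis"
  then obtain c where c: "upper_pressure P Q (- s) / ereal (- s) < ereal c"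
    "ereal c < upper_pressure P Q (- s') / ereal (- s')"
    using ereal_dense2 unfolding not_le by blast
  have s': "s' > 0" using s by simp
  have "upper_pressure P Q (- s') < ereal (- c * s')"
    using c(2) ereal_less_divide_neg_iff(1)[OF s'] by blast
  from upper_pressure_less[OF this]
  have "\<forall>\<^sub>F n in sequentially. pressure_n P Q n (- s) / ereal (real n) \<le> ereal (- c * s)"
    using eventually_gt_at_top[of 0]
  proof eventually_elim
    case (elim n)
    have "pressure_sum n s \<le> pressure_sum n s' powr (s / s')" by (rule pressure_sum_power_mean[OF s])
    also have "\<dots> \<le> exp (- c * s' * real n) powr (s / s')"
      using elim(1) pressure_sum_pos[of n s'] s by (intro powr_mono2) auto
    also have "\<dots> = exp (- c * s * real n)" using s' by (simp add: powr_def)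
    finally have "ln (pressure_sum n s) \<le> - c * s * real n"
      using pressure_sum_pos[of n s] by (metis ln_exp ln_le_cancel_iff exp_gt_zero)
    then show ?case using elim(2) by (simp add: pressure_n_eq field_simps)
  qed
  then have "upper_pressure P Q (- s) \<le> ereal (- c * s)"
    unfolding upper_pressure_def by (rule Limsup_bounded)
  then have "ereal c \<le> upper_pressure P Q (- s) / ereal (- s)"
    using ereal_less_divide_neg_iff(2)[OF s(1)] by blast
  with c(1) show False by simp
qed

text \<open>Monotone slopes converge to their supremum, so the \<open>Lim\<close> in the definition
  is a genuine limit.\<close>

lemma pressure_left_deriv_eq_SUP:
  "pressure_left_deriv_0 P Q = (SUP \<alpha>\<in>{..<0}. upper_pressure P Q \<alpha> / ereal \<alpha>)"
proof -
  let ?\<phi> = "\<lambda>\<alpha>. upper_pressure P Q \<alpha> / ereal \<alpha>"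
  have mono: "?\<phi> \<alpha> \<le> ?\<phi> \<beta>" if "\<alpha> \<le> \<beta>" "\<beta> < 0" for \<alpha> \<beta>
    using pressure_slope_mono[of "- \<beta>" "- \<alpha>"] that by simp
  have "(?\<phi> \<longlongrightarrow> (SUP \<alpha>\<in>{..<0}. ?\<phi> \<alpha>)) (at_left 0)"
  proof (rule order_tendstoI)
    fix a assume "a < (SUP \<alpha>\<in>{..<0}. ?\<phi> \<alpha>)"
    then obtain \<alpha> where \<alpha>: "\<alpha> < 0" "a < ?\<phi> \<alpha>" by (auto simp: less_SUP_iff)
    have "\<forall>\<^sub>F \<beta> in at_left 0. \<beta> \<in> {\<alpha><..<0}" using \<alpha>(1) by (rule eventually_at_left_real)
    then show "\<forall>\<^sub>F \<beta> in at_left 0. a < ?\<phi> \<beta>"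
    proof eventually_elim
      case (elim \<beta>)
      then show ?case using mono[of \<alpha> \<beta>] \<alpha>(2) by (auto intro: less_le_trans)
    qed
  next
    fix a assume a: "(SUP \<alpha>\<in>{..<0}. ?\<phi> \<alpha>) < a"
    have "\<forall>\<^sub>F \<beta> in at_left 0. \<beta> \<in> {-1<..<(0::real)}" by (rule eventually_at_left_real) simp
    then show "\<forall>\<^sub>F \<beta> in at_left 0. ?\<phi> \<beta> < a"
    proof eventually_elim
      case (elim \<beta>)
      then have "?\<phi> \<beta> \<le> (SUP \<alpha>\<in>{..<0}. ?\<phi> \<alpha>)" by (intro SUP_upper) auto
      then show ?case using a by simp
    qed
  qed
  then show ?thesis unfolding pressure_left_deriv_0_def by (intro tendsto_Lim) auto
qed

text \<open>Shrinking s never lowers the slope, so s \<le> 1 can be arranged; bounding occurrence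
  probabilities by their s-th powers needs it.\<close>

lemma less_left_derivD:
  assumes "ereal \<kappa> < pressure_left_deriv_0 P Q"
  shows "\<exists>s. 0 < s \<and> s \<le> 1 \<and> upper_pressure P Q (- s) < ereal (- \<kappa> * s)"
proof -
  obtain \<alpha> where \<alpha>: "\<alpha> < 0" "ereal \<kappa> < upper_pressure P Q \<alpha> / ereal \<alpha>"
    using assms unfolding pressure_left_deriv_eq_SUP by (auto simp: less_SUP_iff)
  define s where "s = min 1 (- \<alpha>)"
  have s: "0 < s" "s \<le> 1" "s \<le> - \<alpha>" using \<alpha>(1) by (auto simp: s_def)
  have "ereal \<kappa> < upper_pressure P Q (- s) / ereal (- s)"
    using \<alpha>(2) pressure_slope_mono[OF s(1,3)] by simp
  with s show ?thesis using ereal_less_divide_neg_iff(1)[OF s(1)] by blast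
qed

lemma le_left_derivI:
  assumes "0 < s" "upper_pressure P Q (- s) \<le> ereal (- \<kappa> * s)"
  shows "ereal \<kappa> \<le> pressure_left_deriv_0 P Q"
proof -
  have "ereal \<kappa> \<le> upper_pressure P Q (- s) / ereal (- s)"
    using assms ereal_less_divide_neg_iff(2) by blast
  also have "\<dots> \<le> pressure_left_deriv_0 P Q"
    unfolding pressure_left_deriv_eq_SUP using assms(1) by (intro SUP_upper) auto
  finally show ?thesis .
qed

text \<open>The missing half of the Shannon--McMillan--Breiman theorem for \<open>- ln p\<close>. Averaging the
  block decomposition over all \<open>L\<close> offsets compares \<open>- L ln p\<close> with a Birkhoff sum of \<open>- ln p\<close>
  over windows of length \<open>L\<close>, which is additive up to a constant.\<close>

lemma entropy_lower_AE:
  assumes erg: "ergodic Q" and \<kappa>: "ereal \<kappa> < cross_entropy Q P"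
  shows "AE y in Q. \<forall>\<^sub>F n in sequentially. \<kappa> * real n \<le> - ln (p (initial_word n y))"
proof -
  obtain \<kappa>2 where \<kappa>2: "\<kappa> < \<kappa>2" "ereal \<kappa>2 < cross_entropy Q P" using ereal_dense2[OF \<kappa>] by auto
  \<comment> \<open>One \<epsilon> is lost in the ergodic lemma, two in
    \<open>\<epsilon> * L + C \<le> 2 * \<epsilon> * L\<close>.\<close>
  define \<epsilon> where "\<epsilon> = (\<kappa>2 - \<kappa>) / 3"
  have \<epsilon>: "\<epsilon> > 0" using \<kappa>2 by (simp add: \<epsilon>_def)
  obtain C where C: "C \<ge> 0" "\<And>a b. p (a @ b) \<le> exp (\<epsilon> * real (length a) + C) * p a * p b"
    using UD_P[OF \<epsilon>] by blast
  have "\<forall>\<^sub>F n in sequentially. ereal \<kappa>2 < ereal (cross_sum n / real n)"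
    using cross_entropy_tendsto \<kappa>2(2) by (rule order_tendstoD)
  moreover have "\<forall>\<^sub>F n::nat in sequentially. C < \<epsilon> * real n" using \<epsilon> by real_asymp
  ultimately have "\<forall>\<^sub>F n in sequentially. \<kappa>2 * real n \<le> cross_sum n \<and> C < \<epsilon> * real n \<and> n > 0"
    using eventually_gt_at_top[of 0] by eventually_elim (auto simp: pos_less_divide_eq)
  then obtain L where L: "\<kappa>2 * real L \<le> cross_sum L" "C < \<epsilon> * real L" "L > 0"
    by (auto simp: eventually_sequentially)
  \<comment> \<open>A valid bound even for words with \<open>p a = 0\<close>, because
    \<open>ln 0 = 0\<close>.\<close>
  define B where "B = (\<Sum>a\<in>words L. - ln (p a))"
  have B: "B \<ge> 0" unfolding B_def by (intro sum_nonneg) (simp add: ln_p_nonpos)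
  have B_ge: "- ln (p a) \<le> B" if "a \<in> words L" for a
    unfolding B_def using that by (intro member_le_sum) (auto simp: ln_p_nonpos)
  define blk where "blk u = (if L \<le> length u then - ln (p (take L u)) else 0)" for u
  have blk: "0 \<le> blk u" "blk u \<le> B" for u
    using B B_ge[of "take L u"] by (auto simp: blk_def ln_p_nonpos)
  define F where "F v = (\<Sum>i<length v. blk (drop i v))" for v
  have F_Cons: "F (z # v) = blk (z # v) + F v" for z v
    unfolding F_def by (simp add: sum.lessThan_Suc_shift del: sum.lessThan_Suc)
  have F_Nil: "F [] = 0" by (simp add: F_def)
  \<comment> \<open>Only windows that start in \<open>a\<close> and reach into \<open>b\<close> are
    new, and there are at most \<open>min (length a) L\<close> of them.\<close>
  have F_append: "F (a @ b) \<le> F a + F b + B * real (min (length a) L)" for a b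
  proof (induction a)
    case (Cons z a)
    show ?case
    proof (cases "L \<le> length (z # a)")
      case True
      then have "take L ((z # a) @ b) = take L (z # a)" unfolding take_append by simp
      with True have "blk (z # a @ b) = blk (z # a)" by (simp add: blk_def)
      moreover have "B * real (min (length a) L) \<le> B * real (min (length (z # a)) L)"
        using B by (intro mult_left_mono) auto
      ultimately show ?thesis using Cons by (simp add: F_Cons)
    next
      case False
      then have "B * real (min (length (z # a)) L) = B * real (min (length a) L) + B"
        by (simp add: min_def algebra_simps)
      then show ?thesis using Cons blk(2)[of "z # a @ b"] blk(1)[of "z # a"] by (simp add: F_Cons)
    qed
  qed (simp add: F_Nil)
  have F_le: "F v \<le> B * real (length v) + B" for v
  proof -
    have "F v \<le> (\<Sum>i<length v. B)" unfolding F_def by (intro sum_mono blk)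
    then show ?thesis using B by (simp add: mult.commute)
  qed
  have mean: "(\<Sum>a\<in>words n. q a * F a) \<ge> (real n - real L) * cross_sum L" if n: "n \<ge> L" for n
  proof -
    have win: "(\<Sum>a\<in>words n. q a * blk (drop i a)) = cross_sum L" if i: "i + L \<le> n" for i
    proof -
      have "(\<Sum>a\<in>words n. q a * blk (drop i a)) = (\<Sum>a\<in>words n. q a * - ln (p (take L (drop i a))))"
        using i by (intro sum.cong) (auto simp: blk_def)
      also have "\<dots> = cross_sum L" unfolding cross_sum_def by (rule Q.sum_factor[OF i])
      finally show ?thesis .
    qed
    have "(real n - real L) * cross_sum L = (\<Sum>i<n - L. cross_sum L)" using n by (simp add: of_nat_diff)
    also have "\<dots> = (\<Sum>i<n - L. \<Sum>a\<in>words n. q a * blk (drop i a))"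
      by (intro sum.cong refl) (use win in auto)
    also have "\<dots> \<le> (\<Sum>i<n. \<Sum>a\<in>words n. q a * blk (drop i a))"
      using blk by (intro sum_mono2 sum_nonneg mult_nonneg_nonneg) auto
    also have "\<dots> = (\<Sum>a\<in>words n. \<Sum>i<n. q a * blk (drop i a))" by (rule sum.swap)
    also have "\<dots> = (\<Sum>a\<in>words n. q a * F a)"
      by (intro sum.cong) (auto simp: F_def sum_distrib_left)
    finally show ?thesis .
  qed
  \<comment> \<open>Half of \<epsilon> absorbs the windows missing at the end of the word, the other
    half is the strict gap for the ergodic lemma.\<close>
  define c where "c = (\<kappa>2 - \<epsilon> / 2) * real L"
  have "\<forall>\<^sub>F n::nat in sequentially. real L * cross_sum L < \<epsilon> / 2 * real L * real n"
    using \<epsilon> L(3) by real_asymp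
  then have "\<forall>\<^sub>F n in sequentially. c * real n \<le> (\<Sum>a\<in>words n. q a * F a)"
    using eventually_ge_at_top[of L]
  proof eventually_elim
    case (elim n)
    have "\<kappa>2 * real L * real n \<le> cross_sum L * real n" using L(1) by (intro mult_right_mono) auto
    then have "c * real n \<le> (real n - real L) * cross_sum L"
      using elim(1) by (simp add: c_def algebra_simps)
    then show ?case using mean[OF elim(2)] by linarith
  qed
  then have freq: "\<exists>\<^sub>F n in sequentially. c * real n \<le> (\<Sum>a\<in>words n. q a * F a)"
    by (rule eventually_frequently[rotated]) simp
  have F_AE: "AE y in Q. \<forall>\<^sub>F n in sequentially. ((\<kappa>2 - \<epsilon>) * real L) * real n \<le> F (initial_word n y)"
  proof (rule Q.subadditive_lower_AE[OF erg _ _ B freq])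
    fix \<eta> :: real assume \<eta>: "\<eta> > 0"
    have "F (a @ b) \<le> F a + F b + \<eta> * real (length a) + B * real L" for a b
    proof -
      have "B * real (min (length a) L) \<le> B * real L" using B by (intro mult_left_mono) auto
      moreover have "0 \<le> \<eta> * real (length a)" using \<eta> by simp
      ultimately show ?thesis using F_append[of a b] by linarith
    qed
    then show "\<exists>C. \<forall>a b. q (a @ b) > 0 \<longrightarrow> F (a @ b) \<le> F a + F b + \<eta> * real (length a) + C" by blast
  next
    show "(\<kappa>2 - \<epsilon>) * real L < c" using \<epsilon> L(3) by (simp add: c_def)
  qed (rule F_le)
  \<comment> \<open>The sum over the L offsets. Putting \<open>z\<close> before \<open>v\<close>
    changes it by \<open>- ln (p (z # v)) + ln (p (drop (L - 1) v))\<close>, so each letter requires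
    a single cut, after the first L letters of \<open>z # v\<close>.\<close>
  define G where "G v = (\<Sum>r<L. - ln (p (drop r v)))" for v
  have G_ge: "p v > 0 \<Longrightarrow> F v - real (length v) * (\<epsilon> * real L + C) \<le> G v" for v
  proof (induction v)
    case Nil
    then show ?case by (simp add: F_Nil G_def)
  next
    case (Cons z v)
    obtain l where l: "L = Suc l" using L(3) gr0_implies_Suc by blast
    have "p v > 0" using Cons.prems P.p_append_le2[of "[z]" v] by simp
    then have IH: "F v - real (length v) * (\<epsilon> * real L + C) \<le> G v" by (rule Cons.IH)
    have G1: "G (z # v) = - ln (p (z # v)) + (\<Sum>r<l. - ln (p (drop r v)))"
      unfolding G_def l by (simp add: sum.lessThan_Suc_shift del: sum.lessThan_Suc)
    have G2: "G v = (\<Sum>r<l. - ln (p (drop r v))) - ln (p (drop l v))"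
      unfolding G_def l by simp
    have "blk (z # v) - (\<epsilon> * real L + C) \<le> - ln (p (z # v)) + ln (p (drop l v))"
    proof (cases "L \<le> length (z # v)")
      case True
      have eq: "take L (z # v) @ drop l v = z # v" by (simp add: l)
      have "ln (p (take L (z # v) @ drop l v)) \<le> ln (p (take L (z # v))) + ln (p (drop l v))
          + \<epsilon> * real (length (take L (z # v))) + C"
        using Cons.prems by (intro ln_p_append C(2)) (simp only: eq)
      moreover have "length (take L (z # v)) = L" using True by simp
      ultimately show ?thesis using True unfolding eq by (simp add: blk_def)
    next
      case False
      have "p (z # v) \<le> p (drop l v)" using P.p_drop_le[of "z # v" L] by (simp add: l)
      then have "ln (p (z # v)) \<le> ln (p (drop l v))" using Cons.prems by simp
      moreover have "0 \<le> \<epsilon> * real L" using \<epsilon> by simp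
      ultimately show ?thesis using False C(1) by (simp add: blk_def)
    qed
    then show ?case using IH unfolding G1 G2 F_Cons by (simp add: algebra_simps)
  qed
  have G_le: "G v \<le> real L * - ln (p v)" if "p v > 0" for v
  proof -
    have "- ln (p (drop r v)) \<le> - ln (p v)" for r
      using that P.p_drop_le[of v r] by simp
    then have "G v \<le> (\<Sum>r<L. - ln (p v))" unfolding G_def by (intro sum_mono)
    then show ?thesis by simp
  qed
  show ?thesis using F_AE Q.AE_p_pos
  proof eventually_elim
    case (elim y)
    note pos = elim(2)
    from elim(1) show ?case
    proof eventually_elim
      case (elim n)
      have "p (initial_word n y) > 0"
        using pos[rule_format, of n 0] supp_words_sub by simp
      then have "F (initial_word n y) - real n * (\<epsilon> * real L + C) \<le> real L * - ln (p (initial_word n y))"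
        using order_trans[OF G_ge G_le, of "initial_word n y"] by simp
      moreover have "real n * (\<epsilon> * real L + C) \<le> real n * (2 * \<epsilon> * real L)"
        using L(2) by (intro mult_left_mono) auto
      ultimately have "(\<kappa>2 - \<epsilon>) * real L * real n - real n * (2 * \<epsilon> * real L) \<le> real L * - ln (p (initial_word n y))"
        using elim by linarith
      moreover have "(\<kappa>2 - \<epsilon>) * real L * real n - real n * (2 * \<epsilon> * real L) = real L * (\<kappa> * real n)"
      proof -
        have eq: "\<kappa>2 = \<kappa> + 3 * \<epsilon>" by (simp add: \<epsilon>_def field_simps)
        show ?thesis unfolding eq by (simp add: algebra_simps)
      qed
      ultimately have "real L * (\<kappa> * real n) \<le> real L * - ln (p (initial_word n y))" by simp
      then show ?case using L(3) by (simp only: mult_le_cancel_left_pos of_nat_0_less_iff)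
    qed
  qed
qed

text \<open>With \<open>s = t / m\<close> the errors per block of length \<open>m\<close> are bounded independently of \<open>t\<close>, while
  the gain is \<open>t\<close> times the entropy: let \<open>m \<rightarrow> \<infinity>\<close> first and \<open>t \<rightarrow> \<infinity>\<close> afterwards.\<close>

lemma cross_entropy_le_left_deriv:
  assumes erg: "ergodic Q" and ud: "upper_decoupled_with \<tau> k Q" "k \<in> O(\<lambda>_. 1)"
  shows "cross_entropy Q P \<le> pressure_left_deriv_0 P Q"
proof (rule ccontr)
  assume "\<not> ?thesis"
  then obtain \<kappa> where \<kappa>: "pressure_left_deriv_0 P Q < ereal \<kappa>" "ereal \<kappa> < cross_entropy Q P"
    using ereal_dense2 unfolding not_le by blast
  obtain \<kappa>1 where \<kappa>1: "\<kappa> < \<kappa>1" "ereal \<kappa>1 < cross_entropy Q P" using ereal_dense2[OF \<kappa>(2)] by auto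
  define \<epsilon> where "\<epsilon> = (\<kappa>1 - \<kappa>) / 4"
  have \<epsilon>: "\<epsilon> > 0" using \<kappa>1 by (simp add: \<epsilon>_def)
  \<comment> \<open>Equal to - \<kappa> - \<epsilon>. Per unit of t the gain is \<kappa>1,
    decoupling of P costs 2 \<epsilon>, and the constants collected in the choice of t cost
    \<epsilon>.\<close>
  define x where "x = 3 * \<epsilon> - \<kappa>1"
  have x: "x < - \<kappa>" using \<kappa>1 by (simp add: x_def \<epsilon>_def field_simps)
  obtain C where C: "C \<ge> 0" "\<And>a b. p (a @ b) \<le> exp (\<epsilon> * real (length a) + C) * p a * p b"
    using UD_P[OF \<epsilon>] by blast
  \<comment> \<open>Errors of P are raised to the power s = t / m, those of Q are not. As t is fixed
    before m, the argument needs an error of Q that does not grow with m.\<close>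
  obtain CQ where CQ: "CQ \<ge> 0" "\<And>a \<xi> b. length \<xi> = \<tau> \<Longrightarrow> q (a @ \<xi> @ b) \<le> exp CQ * q a * q b"
    using Q.upper_decoupled_bounded[OF ud] by blast
  define A where "A = real (card (words \<tau> :: 'a list set))"
  have "replicate \<tau> undefined \<in> (words \<tau> :: 'a list set)" by simp
  then have "card (words \<tau> :: 'a list set) > 0"
    unfolding card_gt_0_iff using finite_words by blast
  then have A: "A > 0" by (simp add: A_def)
  define t where "t = max 1 ((ln A + CQ + ln 2) / \<epsilon>)"
  have t: "t > 0" by (simp add: t_def)
  have "(ln A + CQ + ln 2) / \<epsilon> \<le> t" by (simp add: t_def)
  then have t\<epsilon>: "ln A + CQ + ln 2 \<le> t * \<epsilon>" using \<epsilon> by (simp add: pos_divide_le_eq)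
  define bad where "bad m a \<longleftrightarrow> - ln (p a) < \<kappa>1 * real m" for m a
  have "AE y in Q. \<forall>\<^sub>F m in sequentially. y \<notin> {y. bad m (initial_word m y)}"
    using entropy_lower_AE[OF erg \<kappa>1(2)]
  proof eventually_elim
    case (elim y)
    then show ?case by eventually_elim (auto simp: bad_def)
  qed
  then have "(\<lambda>m. Q.prob {y. bad m (initial_word m y)}) \<longlonglongrightarrow> 0"
    by (intro Q.prob_tendsto_0_of_AE Q.sets_initial_word)
  then have "\<forall>\<^sub>F m in sequentially. Q.prob {y. bad m (initial_word m y)} < exp (- t * \<kappa>1)"
    by (rule order_tendstoD) simp
  moreover have "\<forall>\<^sub>F m::nat in sequentially. C < \<epsilon> * real m" using \<epsilon> by real_asymp
  \<comment> \<open>The gap letters dilute the gain by the factor m / (m + \<tau>); the margin in x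
    covers this for large m.\<close>
  moreover have "\<forall>\<^sub>F m::nat in sequentially. x * (real m / (real m + real \<tau>)) < - \<kappa>"
  proof -
    have "(\<lambda>m::nat. x * (real m / (real m + real \<tau>))) \<longlonglongrightarrow> x * 1"
      by (intro tendsto_mult tendsto_const) real_asymp
    then show ?thesis using x by (intro order_tendstoD) auto
  qed
  ultimately have "\<forall>\<^sub>F m in sequentially. Q.prob {y. bad m (initial_word m y)} < exp (- t * \<kappa>1)
      \<and> C < \<epsilon> * real m \<and> x * (real m / (real m + real \<tau>)) < - \<kappa> \<and> m > 0"
    using eventually_gt_at_top[of 0] by eventually_elim simp
  then obtain m where m: "Q.prob {y. bad m (initial_word m y)} < exp (- t * \<kappa>1)" "C < \<epsilon> * real m"
      "x * (real m / (real m + real \<tau>)) < - \<kappa>" "m > 0"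
    by (auto simp: eventually_sequentially)
  define s where "s = t / real m"
  have s: "s > 0" using t m by (simp add: s_def)
  \<comment> \<open>Typical words satisfy \<open>p a powr s \<le> exp (- t * \<kappa>1)\<close>; the
    others have total Q-measure below the same bound because m was chosen after t.\<close>
  have block: "pressure_sum m s \<le> 2 * exp (- t * \<kappa>1)"
  proof -
    have "pressure_sum m s \<le> (\<Sum>a\<in>words m. q a * of_bool (bad m a) + exp (- t * \<kappa>1) * q a)"
      unfolding pressure_sum_def
    proof (rule sum_mono)
      fix a :: "'a list" assume "a \<in> words m"
      show "p a powr s * q a \<le> q a * of_bool (bad m a) + exp (- t * \<kappa>1) * q a"
      proof (cases "q a = 0 \<or> bad m a")
        case True
        have "p a powr s \<le> 1" using powr_mono2[of s "p a" 1] s by simp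
        then have "p a powr s * q a \<le> 1 * q a" by (intro mult_right_mono) auto
        also have "\<dots> \<le> q a * of_bool (bad m a) + exp (- t * \<kappa>1) * q a" using True by auto
        finally show ?thesis .
      next
        case False
        then have "q a > 0" by (simp add: less_le)
        then have pa: "p a > 0" by (rule supp_words_sub)
        have "s * ln (p a) \<le> s * (- \<kappa>1 * real m)"
          using False s by (intro mult_left_mono) (auto simp: bad_def)
        also have "\<dots> = - t * \<kappa>1" using m by (simp add: s_def)
        finally have "p a powr s \<le> exp (- t * \<kappa>1)" using pa by (simp add: powr_def)
        then have "p a powr s * q a \<le> exp (- t * \<kappa>1) * q a" by (intro mult_right_mono) auto
        then show ?thesis using False by simp
      qed
    qed
    also have "\<dots> = Q.prob {y. bad m (initial_word m y)} + exp (- t * \<kappa>1)"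
    proof -
      have "(\<Sum>a\<in>words m. q a * of_bool (bad m a)) = Q.prob {y. bad m (initial_word m y)}"
        unfolding Q.prob_initial_word[of "bad m"] by (rule sum.mono_neutral_cong_right) auto
      then show ?thesis by (simp add: sum.distrib sum_distrib_left[symmetric])
    qed
    finally show ?thesis using m(1) by simp
  qed
  \<comment> \<open>The growth factor for one block of m letters with its gap; \<open>A\<close>
    counts the fillings of the gap.\<close>
  define H where "H = A * exp (CQ + s * (\<epsilon> * real m + C)) * pressure_sum m s"
  have H0: "H \<ge> 0" using A pressure_sum_pos[of m s] by (simp add: H_def)
  have H_le: "H \<le> exp (t * x)"
  proof -
    have sC: "s * (\<epsilon> * real m + C) \<le> 2 * (t * \<epsilon>)"
    proof -
      have "s * (\<epsilon> * real m + C) \<le> s * (2 * \<epsilon> * real m)" using s m(2) by (intro mult_left_mono) auto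
      also have "\<dots> = 2 * (t * \<epsilon>)" using m(4) by (simp add: s_def)
      finally show ?thesis .
    qed
    have "H \<le> A * exp (CQ + s * (\<epsilon> * real m + C)) * (2 * exp (- t * \<kappa>1))"
      unfolding H_def using A by (intro mult_left_mono block) auto
    also have "\<dots> = exp (ln A + CQ + ln 2 + s * (\<epsilon> * real m + C) - t * \<kappa>1)"
      using A by (simp add: exp_add exp_diff exp_minus divide_inverse)
    also have "\<dots> \<le> exp (t * x)" using t\<epsilon> sC by (simp add: x_def algebra_simps)
    finally show ?thesis .
  qed
  have step: "pressure_sum (m + (\<tau> + n)) s \<le> H * pressure_sum n s" for n
  proof -
    have "pressure_sum (m + (\<tau> + n)) s
        = (\<Sum>a\<in>words m. \<Sum>\<xi>\<in>words \<tau>. \<Sum>b\<in>words n. p (a @ \<xi> @ b) powr s * q (a @ \<xi> @ b))"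
      unfolding pressure_sum_def sum_words_add ..
    also have "\<dots> \<le> (\<Sum>a\<in>words m. \<Sum>\<xi>\<in>(words \<tau> :: 'a list set). \<Sum>b\<in>words n.
        exp (CQ + s * (\<epsilon> * real m + C)) * (p a powr s * q a) * (p b powr s * q b))"
    proof (intro sum_mono)
      fix a \<xi> b :: "'a list" assume a: "a \<in> words m" and \<xi>: "\<xi> \<in> words \<tau>" and b: "b \<in> words n"
      have "p (a @ \<xi> @ b) \<le> exp (\<epsilon> * real m + C) * p a * p (\<xi> @ b)" using C(2)[of a "\<xi> @ b"] a by simp
      also have "\<dots> \<le> exp (\<epsilon> * real m + C) * p a * p b" by (intro mult_left_mono P.p_append_le2) auto
      finally have "p (a @ \<xi> @ b) powr s \<le> (exp (\<epsilon> * real m + C) * p a * p b) powr s"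
        using s by (intro powr_mono2) auto
      also have "\<dots> = exp (s * (\<epsilon> * real m + C)) * p a powr s * p b powr s"
        by (simp add: powr_mult powr_def[of "exp _"])
      finally have "p (a @ \<xi> @ b) powr s * q (a @ \<xi> @ b)
          \<le> (exp (s * (\<epsilon> * real m + C)) * p a powr s * p b powr s) * (exp CQ * q a * q b)"
        using \<xi> by (intro mult_mono CQ(2)) auto
      then show "p (a @ \<xi> @ b) powr s * q (a @ \<xi> @ b) \<le>
          exp (CQ + s * (\<epsilon> * real m + C)) * (p a powr s * q a) * (p b powr s * q b)"
        by (simp add: exp_add mult_ac)
    qed
    also have "\<dots> = (\<Sum>a\<in>words m. A * (exp (CQ + s * (\<epsilon> * real m + C)) * (p a powr s * q a) * pressure_sum n s))"
      by (intro sum.cong refl)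
         (simp only: pressure_sum_def A_def sum_distrib_left[symmetric] sum_constant, simp only: mult_ac)
    also have "\<dots> = H * pressure_sum n s"
      unfolding H_def pressure_sum_def[of m] sum_distrib_left sum_distrib_right
      by (intro sum.cong refl) (simp only: mult_ac)
    finally show ?thesis .
  qed
  define M where "M = m + \<tau>"
  have M: "M > 0" using m(4) by (simp add: M_def)
  have iter: "pressure_sum (j * M + r) s \<le> H ^ j" for j r
  proof (induction j)
    case 0
    show ?case using pressure_sum_le_1[of s r] s by simp
  next
    case (Suc j)
    have "Suc j * M + r = m + (\<tau> + (j * M + r))" by (simp add: M_def)
    then have "pressure_sum (Suc j * M + r) s \<le> H * pressure_sum (j * M + r) s" using step by metis
    also have "\<dots> \<le> H * H ^ j" using H0 Suc by (intro mult_left_mono) auto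
    finally show ?case by simp
  qed
  have ps: "ln (pressure_sum n s) \<le> t * x / real M * real n + \<bar>t * x\<bar>" for n
  proof -
    define j where "j = n div M"
    have "pressure_sum n s \<le> H ^ j" using iter[of j "n mod M"] by (simp add: j_def)
    also have "\<dots> \<le> exp (t * x) ^ j" using H0 H_le by (intro power_mono) auto
    also have "\<dots> = exp (real j * (t * x))" by (simp add: exp_of_nat_mult)
    finally have 1: "ln (pressure_sum n s) \<le> real j * (t * x)"
      using pressure_sum_pos[of n s] by (metis ln_exp ln_le_cancel_iff exp_gt_zero)
    have "real j \<le> real n / real M" "real n / real M \<le> real j + 1"
      using floor_divide_of_nat_eq[of n M, where 'a = real] of_int_floor_le[of "real n / real M"]
        real_of_int_floor_add_one_ge[of "real n / real M"] by (simp_all add: j_def)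
    then have "\<bar>real j - real n / real M\<bar> \<le> 1" by linarith
    then have "\<bar>(real j - real n / real M) * (t * x)\<bar> \<le> 1 * \<bar>t * x\<bar>"
      unfolding abs_mult[of _ "t * x"] by (intro mult_right_mono) auto
    then have "real j * (t * x) \<le> real n / real M * (t * x) + \<bar>t * x\<bar>"
      by (simp add: left_diff_distrib)
    with 1 show ?thesis by (simp add: mult_ac)
  qed
  have lim: "t * x / real M < - \<kappa> * s"
  proof -
    have "t * (x * (real m / (real m + real \<tau>))) < t * (- \<kappa>)" using m(3) t by (intro mult_strict_left_mono) auto
    then have "t * (x * (real m / real M)) / real m < t * (- \<kappa>) / real m"
      using m(4) by (intro divide_strict_right_mono) (auto simp: M_def)
    then show ?thesis using m(4) by (simp add: s_def mult_ac)
  qed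
  have "\<forall>\<^sub>F n::nat in sequentially. t * x / real M + \<bar>t * x\<bar> / real n < - \<kappa> * s"
  proof -
    have "(\<lambda>n::nat. t * x / real M + \<bar>t * x\<bar> / real n) \<longlonglongrightarrow> t * x / real M + 0"
      by (intro tendsto_add tendsto_const) real_asymp
    then show ?thesis using lim by (intro order_tendstoD) auto
  qed
  then have "\<forall>\<^sub>F n in sequentially. pressure_n P Q n (- s) / ereal (real n) \<le> ereal (- \<kappa> * s)"
    using eventually_gt_at_top[of 0]
  proof eventually_elim
    case (elim n)
    have "ln (pressure_sum n s) / real n \<le> (t * x / real M * real n + \<bar>t * x\<bar>) / real n"
      using ps by (intro divide_right_mono) auto
    also have "\<dots> = t * x / real M + \<bar>t * x\<bar> / real n" using elim(2) by (simp add: add_divide_distrib)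
    finally show ?case using elim by (simp add: pressure_n_eq)
  qed
  then have "upper_pressure P Q (- s) \<le> ereal (- \<kappa> * s)"
    unfolding upper_pressure_def by (rule Limsup_bounded)
  then have "ereal \<kappa> \<le> pressure_left_deriv_0 P Q" by (rule le_left_derivI[OF s])
  with \<kappa>(1) show False by simp
qed

end

theorem corollary5p3:
  fixes P Q :: "(nat \<Rightarrow> 'a::finite) measure"
  assumes "prob_space P" and "sets P = sets seq_algebra" and "shift_invariant P"
    and "prob_space Q" and "sets Q = sets seq_algebra" and "shift_invariant Q"
    and "selectively_lower_decoupled P"
    and "\<exists>k. upper_decoupled_with 0 k P"
    and "upper_decoupled Q"
    and "ergodic Q"
    and "nondegenerate P Q"
    and "supp Q \<subseteq> supp P"
  shows "(AE (x, y) in P \<Otimes>\<^sub>M Q.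
            pressure_left_deriv_0 P Q \<le> liminf (\<lambda>N. mzm_estimator N y x) \<and>
            liminf (\<lambda>N. mzm_estimator N y x) \<le> limsup (\<lambda>N. mzm_estimator N y x) \<and>
            limsup (\<lambda>N. mzm_estimator N y x) \<le> cross_entropy Q P) \<and>
         ((\<exists>\<tau> k. upper_decoupled_with \<tau> k Q \<and> k \<in> O(\<lambda>_. 1)) \<longrightarrow>
          (AE (x, y) in P \<Otimes>\<^sub>M Q. (\<lambda>N. mzm_estimator N y x) \<longlonglongrightarrow> cross_entropy Q P))"
proof -
  interpret P: stationary_process P
    using assms by (simp add: stationary_process_def stationary_process_axioms_def)
  interpret Q: stationary_process Q
    using assms by (simp add: stationary_process_def stationary_process_axioms_def)
  interpret process_pair P Q
  proof unfold_locales
    fix a assume a: "word_prob Q a > 0"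
    \<comment> \<open>The hypothesis compares supports of sequences, so a point of
      \<open>supp Q\<close> with prefix \<open>a\<close> is needed: a cylinder of positive measure
      meets the set of full measure on which all factors have positive probability.\<close>
    have "\<exists>y\<in>cylinder a. \<forall>n i. word_prob Q (initial_word n (\<lambda>k. y (k + i))) > 0"
    proof (rule ccontr)
      assume none: "\<not> ?thesis"
      have "AE y in Q. y \<notin> cylinder a"
        using Q.AE_p_pos
      proof eventually_elim
        case (elim y)
        then show ?case using none by blast
      qed
      then have "word_prob Q a = 0" unfolding word_prob_def by (simp add: Q.prob_eq_0)
      with a show False by simp
    qed
    then obtain y where y: "y \<in> cylinder a"
      and pos: "\<And>n i. word_prob Q (initial_word n (\<lambda>k. y (k + i))) > 0" by blast
    have "y \<in> supp Q" using pos[of _ 0] by (simp add: supp_def)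
    then have "word_prob P (initial_word (length a) y) > 0" using assms by (auto simp: supp_def)
    then show "word_prob P a > 0" using y by (simp add: cylinder_def)
  next
    fix \<epsilon> :: real assume "\<epsilon> > 0"
    obtain k where "upper_decoupled_with 0 k P" using assms by blast
    from P.upper_decoupled_linear[OF this \<open>\<epsilon> > 0\<close>] show "\<exists>C\<ge>0. \<forall>a b.
      word_prob P (a @ b) \<le> exp (\<epsilon> * real (length a) + C) * word_prob P a * word_prob P b"
      by simp
  qed
  let ?f = "\<lambda>N z. mzm_estimator N (snd z) (fst z)"
  have lower: "AE z in P \<Otimes>\<^sub>M Q. pressure_left_deriv_0 P Q \<le> liminf (\<lambda>N. ?f N z)"
  proof (rule AE_liminf_ge)
    fix \<kappa> assume "ereal \<kappa> < pressure_left_deriv_0 P Q"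
    then obtain s where "0 < s" "s \<le> 1" "upper_pressure P Q (- s) < ereal (- \<kappa> * s)"
      using less_left_derivD by blast
    then show "AE z in P \<Otimes>\<^sub>M Q. \<forall>\<^sub>F N in sequentially. ereal \<kappa> \<le> ?f N z"
      by (intro estimator_lower_AE assms)
  qed
  have upper: "AE z in P \<Otimes>\<^sub>M Q. limsup (\<lambda>N. ?f N z) \<le> cross_entropy Q P"
    by (intro AE_limsup_le estimator_upper_AE assms)
  show ?thesis
  proof (intro conjI impI)
    show "AE (x, y) in P \<Otimes>\<^sub>M Q.
            pressure_left_deriv_0 P Q \<le> liminf (\<lambda>N. mzm_estimator N y x) \<and>
            liminf (\<lambda>N. mzm_estimator N y x) \<le> limsup (\<lambda>N. mzm_estimator N y x) \<and>
            limsup (\<lambda>N. mzm_estimator N y x) \<le> cross_entropy Q P"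
      using lower upper
      by eventually_elim (simp add: split_beta Liminf_le_Limsup)
  next
    assume "\<exists>\<tau> k. upper_decoupled_with \<tau> k Q \<and> k \<in> O(\<lambda>_. 1)"
    then have deriv: "cross_entropy Q P \<le> pressure_left_deriv_0 P Q"
      using cross_entropy_le_left_deriv assms by blast
    show "AE (x, y) in P \<Otimes>\<^sub>M Q. (\<lambda>N. mzm_estimator N y x) \<longlonglongrightarrow> cross_entropy Q P"
      using lower upper
    proof eventually_elim
      case (elim z)
      have "liminf (\<lambda>N. ?f N z) \<le> limsup (\<lambda>N. ?f N z)" by (rule Liminf_le_Limsup) simp
      then have "(\<lambda>N. ?f N z) \<longlonglongrightarrow> cross_entropy Q P"
        using elim deriv by (intro Liminf_eq_Limsup antisym) auto
      then show ?case by (simp add: split_beta)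
    qed
  qed
qed

end
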